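(* Let $M$ be a smooth manifold satisfying $H^1_{\rm dR}(M;\mathbf{R})=0$. If a Finsler structure $F$ on $M$ satisfies $\mathbf{J}=0$ and $\mathsf{e}=0$, then $S=0$ (for a suitable choice of the volume form on $M$ used to define $S$).
   Context: Indices: $n=\dim M\ge2$; $i,j,k,l,p,q$ run over $1,\dots,n$; $\alpha,\beta,\gamma,\mu$ run over $1,\dots,n-1$; $\bar\alpha:=n+\alpha$; repeated indices are summed. Finsler setup. $F:TM\to[0,\infty)$ is continuous, smooth on $TM\setminus 0$, positively $1$-homogeneous in $y$, and $g_{ij}=\frac12[F^2]_{y^iy^j}$ is positive definite on $TM\setminus0$. $SM=\{(x,y)\in TM: F(x,y)=1\}$ with projection $\pi:SM\to M$; objects on $TM\setminus 0$ that are $0$-homogeneous in $y$ are regarded as objects on $SM$. Spray coefficients $G^i=\frac14 g^{il}([F^2]_{x^ky^l}y^k-[F^2]_{x^l})$, $N^i_k=\partial G^i/\partial y^k$, $\frac{\delta}{\delta x^i}=\frac{\partial}{\partial x^i}-N^k_i\frac{\partial}{\partial y^k}$, $\delta y^i=dy^i+N^i_kdx^k$. A local adapted frame of $T(SM)$ is $\mathbf{e}_i=u_i^j\frac{\delta}{\delta x^j}$, $\mathbf{e}_{\bar\alpha}=-u_\alpha^jF\frac{\partial}{\partial y^j}$, where $g_{kl}u^k_iu^l_j=\delta_{ij}$ and $u_n^i=y^i/F$; its dual coframe is $\omega^i,\omega^{\bar\alpha}$. Thus $\mathbf{e}_n=\mathbf{G}=\frac{y^i}{F}\frac{\delta}{\delta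 x^i}$ is the Reeb field and $\omega^n=F_{y^i}dx^i$ is the Hilbert form. $H(SM)$ is the bundle spanned by $\mathbf{e}_1,\dots,\mathbf{e}_n$. Chern connection. $\nabla^{\rm Ch}\mathbf{e}_i=\omega_i^j\otimes\mathbf{e}_j$ on $H(SM)$ is determined by $d\omega^i=\omega^j\wedge\omega^i_j$ and $\omega^i_j+\omega^j_i=-2H_{ij}$, where $H_{ij}=H_{ij\gamma}\omega^{\bar\gamma}$, $H_{ij\gamma}=-A_{pqk}u_i^pu_j^qu_\gamma^k$, $A_{pqk}=\frac14F[F^2]_{y^py^qy^k}$; moreover $\omega^n_\alpha=-\omega^\alpha_n=\omega^{\bar\alpha}$, $\omega^n_n=0$. Its curvature forms are $\Omega^i_j=d\omega^i_j-\omega^k_j\wedge\omega^i_k=\frac12R^{~i}_{j~kl}\omega^k\wedge\omega^l+P^{~i}_{j~k\gamma}\omega^k\wedge\omega^{\bar\gamma}$. The Landsberg curvature has components $L^i_{j\gamma}=-P^{~i}_{j~n\gamma}$, and the mean Landsberg curvature is $\mathbf{J}=J_\gamma\omega^{\bar\gamma}=-P^{~i}_{i~n\gamma}\omega^{\bar\gamma}$. Berwald connection. Its connection forms are $\tilde\omega^i_j=\omega^i_j-L^i_{j\alpha}\omega^\alpha$ (in natural coordinates, $\frac{\partial^2G^i}{\partial y^j\partial y^k}dx^k$), with curvature forms $\tilde\Omega^i_j=d\tilde\omega^i_j-\tilde\omega^k_j\wedge\tilde\omega^i_k=\frac12\tilde R^{~i}_{j~kl}\omega^k\wedge\omega^l+\tilde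 P^{~i}_{j~k\gamma}\omega^k\wedge\omega^{\bar\gamma}$. The mean Berwald curvature is $\mathbf{E}=\mathrm{tr}\tilde P=\tilde P^{~i}_{i~\gamma\mu}\omega^\gamma\wedge\omega^{\bar\mu}=:E_{\gamma\mu}\omega^\gamma\wedge\omega^{\bar\mu}$, and the Berwald scalar curvature is the function $\mathsf{e}=\mathrm{tr}\,\mathbf{E}=\sum_\gamma E_{\gamma\gamma}$ on $SM$. $S$-curvature. For a volume form $dV_M=\sigma(x)\,dx^1\wedge\cdots\wedge dx^n$, $\sigma>0$, on $M$ (a positive density if $M$ is not orientable), the distortion is $\tau=\ln\frac{\sqrt{\det(g_{ij})}}{\sigma(x)}$, and $S:=\mathbf{G}(\tau)$ is a function on $SM$, called the $S$-curvature. Replacing $dV_M$ by $e^{-f}dV_M$, $f\in C^\infty(M)$, changes $S$ to $S+\pi^*df(\mathbf{G})$; $S$-curvature is regarded as determined up to such exact terms. *)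

theory Defs
  imports "HOL-Analysis.Analysis"
begin

section \<open>Smooth maps and differential forms on open sets of a vector space\<close>

abbreviation dir_deriv :: "('a::real_normed_vector \<Rightarrow> 'b::real_normed_vector) \<Rightarrow> 'a \<Rightarrow> 'a \<Rightarrow> 'b" where
  "dir_deriv f z v \<equiv> frechet_derivative f (at z) v"

text \<open>On open subsets of finite-dimensional spaces this is the usual class of \<open>k\<close> times
  continuously differentiable maps; only open sets are used below.\<close>

primrec Ck_on :: "nat \<Rightarrow> 'a::real_normed_vector set \<Rightarrow> ('a \<Rightarrow> 'b::real_normed_vector) \<Rightarrow> bool" where
  "Ck_on 0 S f \<longleftrightarrow> continuous_on S f"
| "Ck_on (Suc k) S f \<longleftrightarrow>
     (\<forall>z\<in>S. f differentiable (at z)) \<and> (\<forall>v. Ck_on k S (\<lambda>z. dir_deriv f z v))"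

definition smooth_on :: "'a::real_normed_vector set \<Rightarrow> ('a \<Rightarrow> 'b::real_normed_vector) \<Rightarrow> bool" where
  "smooth_on S f \<longleftrightarrow> (\<forall>k. Ck_on k S f)"

type_synonym 'a form1 = "'a \<Rightarrow> 'a \<Rightarrow> real"
type_synonym 'a form2 = "'a \<Rightarrow> 'a \<Rightarrow> 'a \<Rightarrow> real"

definition smooth_form1_on :: "'a::real_normed_vector set \<Rightarrow> 'a form1 \<Rightarrow> bool" where
  "smooth_form1_on S \<theta> \<longleftrightarrow> (\<forall>z\<in>S. linear (\<theta> z)) \<and> (\<forall>v. smooth_on S (\<lambda>z. \<theta> z v))"

text \<open>The exterior derivative is evaluated on constant vector fields, so that the bracket term
  is absent; with this normalisation \<open>d(f dx) = df \<and> dx\<close> for the wedge product below.\<close>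

definition ext_d :: "'a::real_normed_vector form1 \<Rightarrow> 'a form2" where
  "ext_d \<theta> z v w = dir_deriv (\<lambda>z'. \<theta> z' w) z v - dir_deriv (\<lambda>z'. \<theta> z' v) z w"

definition wedge :: "'a form1 \<Rightarrow> 'a form1 \<Rightarrow> 'a form2" where
  "wedge \<theta> \<eta> z v w = \<theta> z v * \<eta> z w - \<theta> z w * \<eta> z v"

section \<open>Smooth manifolds\<close>

text \<open>A chart is a pair of its domain and its coordinate map. The manifold is the whole type
  \<open>'m\<close>. Tensors on it are families of coordinate expressions, one for each chart of the
  atlas, related by the usual transformation laws; values off the chart images are
  irrelevant.\<close>

type_synonym ('m, 'e) chart = "'m set \<times> ('m \<Rightarrow> 'e)"

definition chart_dom :: "('m, 'e) chart \<Rightarrow> 'm set" where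
  "chart_dom c = fst c"

definition chart_img :: "('m, 'e) chart \<Rightarrow> 'e set" where
  "chart_img c = snd c ` fst c"

definition chart_inv :: "('m, 'e) chart \<Rightarrow> 'e \<Rightarrow> 'm" where
  "chart_inv c = inv_into (fst c) (snd c)"

definition overlap :: "('m, 'e) chart \<Rightarrow> ('m, 'e) chart \<Rightarrow> 'e set" where
  "overlap c c' = snd c ` (chart_dom c \<inter> chart_dom c')"

definition transition :: "('m, 'e) chart \<Rightarrow> ('m, 'e) chart \<Rightarrow> 'e \<Rightarrow> 'e" where
  "transition c c' = snd c' \<circ> chart_inv c"

definition smooth_atlas ::
  "('m::{t2_space, second_countable_topology}, real ^ 'n) chart set \<Rightarrow> bool" where
  "smooth_atlas A \<longleftrightarrow>
     (\<Union>c\<in>A. chart_dom c) = UNIV \<and>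
     (\<forall>c\<in>A. open (chart_dom c) \<and> open (chart_img c) \<and>
        homeomorphism (chart_dom c) (chart_img c) (snd c) (chart_inv c)) \<and>
     (\<forall>c\<in>A. \<forall>c'\<in>A. smooth_on (overlap c c') (transition c c'))"

definition smooth_function :: "('m, real ^ 'n) chart set \<Rightarrow> ('m \<Rightarrow> real) \<Rightarrow> bool" where
  "smooth_function A f \<longleftrightarrow> (\<forall>c\<in>A. smooth_on (chart_img c) (f \<circ> chart_inv c))"

definition one_form :: "('m, real ^ 'n) chart set \<Rightarrow>
    (('m, real ^ 'n) chart \<Rightarrow> (real ^ 'n) form1) \<Rightarrow> bool" where
  "one_form A \<theta> \<longleftrightarrow>
     (\<forall>c\<in>A. smooth_form1_on (chart_img c) (\<theta> c)) \<and>
     (\<forall>c\<in>A. \<forall>c'\<in>A. \<forall>x\<in>overlap c c'. \<forall>v.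
        \<theta> c x v = \<theta> c' (transition c c' x) (dir_deriv (transition c c') x v))"

definition closed_form :: "('m, real ^ 'n) chart set \<Rightarrow>
    (('m, real ^ 'n) chart \<Rightarrow> (real ^ 'n) form1) \<Rightarrow> bool" where
  "closed_form A \<theta> \<longleftrightarrow> (\<forall>c\<in>A. \<forall>x\<in>chart_img c. \<forall>v w. ext_d (\<theta> c) x v w = 0)"

definition exact_form :: "('m, real ^ 'n) chart set \<Rightarrow>
    (('m, real ^ 'n) chart \<Rightarrow> (real ^ 'n) form1) \<Rightarrow> bool" where
  "exact_form A \<theta> \<longleftrightarrow> (\<exists>f. smooth_function A f \<and>
     (\<forall>c\<in>A. \<forall>x\<in>chart_img c. \<forall>v. \<theta> c x v = dir_deriv (f \<circ> chart_inv c) x v))"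

definition de_rham_H1_trivial :: "('m, real ^ 'n) chart set \<Rightarrow> bool" where
  "de_rham_H1_trivial A \<longleftrightarrow> (\<forall>\<theta>. one_form A \<theta> \<and> closed_form A \<theta> \<longrightarrow> exact_form A \<theta>)"

definition volume_density :: "('m, real ^ 'n) chart set \<Rightarrow>
    (('m, real ^ 'n) chart \<Rightarrow> real ^ 'n \<Rightarrow> real) \<Rightarrow> bool" where
  "volume_density A \<sigma> \<longleftrightarrow>
     (\<forall>c\<in>A. smooth_on (chart_img c) (\<sigma> c) \<and> (\<forall>x\<in>chart_img c. \<sigma> c x > 0)) \<and>
     (\<forall>c\<in>A. \<forall>c'\<in>A. \<forall>x\<in>overlap c c'.
        \<sigma> c x = \<bar>det (matrix (dir_deriv (transition c c') x))\<bar> * \<sigma> c' (transition c c' x))"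

section \<open>Finsler structures in natural coordinates\<close>

text \<open>A point \<open>(x, y)\<close> of the type \<open>'n tm\<close> stands for the tangent vector with components
  \<open>y\<close> at the point with coordinates \<open>x\<close>; a tangent vector of \<open>TM\<close> is of the same type and its
  two components are the values of \<open>dx\<close> and \<open>dy\<close> on it.\<close>

type_synonym 'n tm = "(real ^ 'n) \<times> (real ^ 'n)"

definition d_x :: "'n \<Rightarrow> ('n::finite tm \<Rightarrow> real) \<Rightarrow> 'n tm \<Rightarrow> real" where
  "d_x i f z = dir_deriv f z (axis i 1, 0)"

definition d_y :: "'n \<Rightarrow> ('n::finite tm \<Rightarrow> real) \<Rightarrow> 'n tm \<Rightarrow> real" where
  "d_y i f z = dir_deriv f z (0, axis i 1)"

definition F_sq :: "('n::finite tm \<Rightarrow> real) \<Rightarrow> 'n tm \<Rightarrow> real" where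
  "F_sq F z = (F z)\<^sup>2"

definition g_mat :: "('n::finite tm \<Rightarrow> real) \<Rightarrow> 'n tm \<Rightarrow> real ^ 'n ^ 'n" where
  "g_mat F z = (\<chi> i j. 1/2 * d_y j (d_y i (F_sq F)) z)"

definition finsler_structure :: "('m, real ^ 'n::finite) chart set \<Rightarrow>
    (('m, real ^ 'n) chart \<Rightarrow> 'n tm \<Rightarrow> real) \<Rightarrow> bool" where
  "finsler_structure A F \<longleftrightarrow>
     (\<forall>c\<in>A.
        continuous_on (chart_img c \<times> UNIV) (F c) \<and>
        smooth_on (chart_img c \<times> (- {0})) (F c) \<and>
        (\<forall>x\<in>chart_img c. \<forall>y. F c (x, y) \<ge> 0) \<and>
        (\<forall>x\<in>chart_img c. \<forall>y. \<forall>t>0. F c (x, t *\<^sub>R y) = t * F c (x, y)) \<and>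
        (\<forall>x\<in>chart_img c. \<forall>y. y \<noteq> 0 \<longrightarrow>
           (\<forall>v. v \<noteq> 0 \<longrightarrow> v \<bullet> (g_mat (F c) (x, y) *v v) > 0))) \<and>
     (\<forall>c\<in>A. \<forall>c'\<in>A. \<forall>x\<in>overlap c c'. \<forall>y.
        F c (x, y) = F c' (transition c c' x, dir_deriv (transition c c') x y))"

definition spray :: "('n::finite tm \<Rightarrow> real) \<Rightarrow> 'n \<Rightarrow> 'n tm \<Rightarrow> real" where
  "spray F i z = 1/4 * (\<Sum>l\<in>UNIV. matrix_inv (g_mat F z) $ i $ l *
     ((\<Sum>k\<in>UNIV. d_y l (d_x k (F_sq F)) z * snd z $ k) - d_x l (F_sq F) z))"

text \<open>\<open>N_coeff F i k\<close> is \<open>N\<^sup>i\<^sub>k\<close>.\<close>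

definition N_coeff :: "('n::finite tm \<Rightarrow> real) \<Rightarrow> 'n \<Rightarrow> 'n \<Rightarrow> 'n tm \<Rightarrow> real" where
  "N_coeff F i k z = d_y k (spray F i) z"

text \<open>\<open>hlift F z a\<close> is the vector \<open>\<Sum>\<^sub>i a\<^sup>i \<delta>/\<delta>x\<^sup>i\<close> at \<open>z\<close>.\<close>

definition hlift :: "('n::finite tm \<Rightarrow> real) \<Rightarrow> 'n tm \<Rightarrow> real ^ 'n \<Rightarrow> 'n tm" where
  "hlift F z a = (a, \<chi> k. - (\<Sum>i\<in>UNIV. N_coeff F k i z * a $ i))"

definition delta_y :: "('n::finite tm \<Rightarrow> real) \<Rightarrow> 'n \<Rightarrow> 'n tm form1" where
  "delta_y F i z V = snd V $ i + (\<Sum>k\<in>UNIV. N_coeff F i k z * fst V $ k)"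

definition cartan :: "('n::finite tm \<Rightarrow> real) \<Rightarrow> 'n \<Rightarrow> 'n \<Rightarrow> 'n \<Rightarrow> 'n tm \<Rightarrow> real" where
  "cartan F p q k z = 1/4 * F z * d_y k (d_y q (d_y p (F_sq F))) z"

section \<open>Adapted frames\<close>

text \<open>Objects on \<open>SM\<close> are represented by the corresponding objects on \<open>TM\<close> minus the zero
  section: functions are \<open>0\<close>-homogeneous, and forms are the pullbacks along
  \<open>(x, y) \<mapsto> (x, y/F)\<close>, that is, they annihilate the radial field and are invariant under the
  dilations of the fibres. Pullback commutes with exterior derivative and wedge product, so
  the structure equations on \<open>SM\<close> may be read on conic open sets \<open>W\<close>. The
  parameter \<open>m\<close> is the distinguished last index of the frame (the direction of the Reeb
  field); the indices \<open>\<alpha>, \<beta>, \<gamma>, \<mu>\<close> run over \<open>- {m}\<close>.\<close>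

definition conic_open :: "'n::finite tm set \<Rightarrow> bool" where
  "conic_open W \<longleftrightarrow> open W \<and> (\<forall>x y. (x, y) \<in> W \<longrightarrow> y \<noteq> 0) \<and>
     (\<forall>x y. \<forall>t>0. (x, y) \<in> W \<longrightarrow> (x, t *\<^sub>R y) \<in> W)"

definition form1_on_SM :: "'n::finite tm set \<Rightarrow> 'n tm form1 \<Rightarrow> bool" where
  "form1_on_SM W \<theta> \<longleftrightarrow> smooth_form1_on W \<theta> \<and>
     (\<forall>x y. (x, y) \<in> W \<longrightarrow> \<theta> (x, y) (0, y) = 0 \<and>
        (\<forall>t>0. \<forall>a b. \<theta> (x, t *\<^sub>R y) (a, t *\<^sub>R b) = \<theta> (x, y) (a, b)))"

text \<open>\<open>u i z $ j\<close> is \<open>u\<^sub>i\<^sup>j\<close>.\<close>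

definition adapted_frame :: "('n::finite tm \<Rightarrow> real) \<Rightarrow> 'n tm set \<Rightarrow> 'n \<Rightarrow>
    ('n \<Rightarrow> 'n tm \<Rightarrow> real ^ 'n) \<Rightarrow> bool" where
  "adapted_frame F W m u \<longleftrightarrow>
     (\<forall>i. smooth_on W (u i)) \<and>
     (\<forall>i x y. \<forall>t>0. (x, y) \<in> W \<longrightarrow> u i (x, t *\<^sub>R y) = u i (x, y)) \<and>
     (\<forall>z\<in>W. \<forall>i j. u i z \<bullet> (g_mat F z *v u j z) = (if i = j then 1 else 0)) \<and>
     (\<forall>z\<in>W. u m z = (1 / F z) *\<^sub>R snd z)"

definition frame_h :: "('n::finite tm \<Rightarrow> real) \<Rightarrow> ('n \<Rightarrow> 'n tm \<Rightarrow> real ^ 'n) \<Rightarrow>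
    'n \<Rightarrow> 'n tm \<Rightarrow> 'n tm" where
  "frame_h F u i z = hlift F z (u i z)"

definition frame_v :: "('n::finite tm \<Rightarrow> real) \<Rightarrow> ('n \<Rightarrow> 'n tm \<Rightarrow> real ^ 'n) \<Rightarrow>
    'n \<Rightarrow> 'n tm \<Rightarrow> 'n tm" where
  "frame_v F u \<alpha> z = (0, - (F z *\<^sub>R u \<alpha> z))"

definition u_inv :: "('n::finite \<Rightarrow> 'n tm \<Rightarrow> real ^ 'n) \<Rightarrow> 'n tm \<Rightarrow> real ^ 'n ^ 'n" where
  "u_inv u z = matrix_inv (\<chi> j i. u i z $ j)"

text \<open>The coframe \<open>\<omega>\<^sup>i\<close> and \<open>\<omega>\<close> with index \<open>n + \<alpha>\<close>, dual to the frame and annihilating the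
  radial field; the lemmas below verify this.\<close>

definition coframe_h :: "('n::finite \<Rightarrow> 'n tm \<Rightarrow> real ^ 'n) \<Rightarrow> 'n \<Rightarrow> 'n tm form1" where
  "coframe_h u i z V = (\<Sum>j\<in>UNIV. u_inv u z $ i $ j * fst V $ j)"

definition coframe_v :: "('n::finite tm \<Rightarrow> real) \<Rightarrow> ('n \<Rightarrow> 'n tm \<Rightarrow> real ^ 'n) \<Rightarrow>
    'n \<Rightarrow> 'n tm form1" where
  "coframe_v F u \<alpha> z V = - (1 / F z) * (\<Sum>j\<in>UNIV. u_inv u z $ \<alpha> $ j * delta_y F j z V)"

lemma u_inv_u:
  fixes u :: "'n::finite \<Rightarrow> 'n tm \<Rightarrow> real ^ 'n"
  assumes "adapted_frame F W m u" and "z \<in> W"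
  shows "(\<Sum>j\<in>UNIV. u_inv u z $ i $ j * u k z $ j) = (if i = k then 1 else 0)"
proof -
  define U :: "real ^ 'n ^ 'n" where "U = (\<chi> j i. u i z $ j)"
  have orth: "u i z \<bullet> (g_mat F z *v u j z) = (if i = j then 1 else 0)" for i j
    using assms by (auto simp: adapted_frame_def)
  have "(transpose U ** (g_mat F z ** U)) $ i $ j = u i z \<bullet> (g_mat F z *v u j z)" for i j
    by (simp add: U_def transpose_def matrix_matrix_mult_def matrix_vector_mult_def inner_vec_def)
  then have "(transpose U ** g_mat F z) ** U = mat 1"
    by (simp add: vec_eq_iff mat_def orth matrix_mul_assoc)
  then have "invertible U"
    by (metis invertible_left_inverse)
  then have "matrix_inv U ** U = mat 1"
    unfolding matrix_inv_def invertible_def by (rule someI2_ex) simp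
  then have "(matrix_inv U ** U) $ i $ k = (if i = k then 1 else 0)"
    by (simp add: mat_def)
  then show ?thesis
    by (simp add: u_inv_def U_def matrix_matrix_mult_def)
qed

lemma coframe_dual:
  fixes u :: "'n::finite \<Rightarrow> 'n tm \<Rightarrow> real ^ 'n"
  assumes "adapted_frame F W m u" and "z \<in> W" and "F z \<noteq> 0"
  shows "coframe_h u i z (frame_h F u k z) = (if i = k then 1 else 0)"
    and "coframe_h u i z (frame_v F u \<beta> z) = 0"
    and "coframe_v F u \<alpha> z (frame_h F u k z) = 0"
    and "coframe_v F u \<alpha> z (frame_v F u \<beta> z) = (if \<alpha> = \<beta> then 1 else 0)"
    and "coframe_h u i z (0, snd z) = 0"
    and "\<alpha> \<noteq> m \<Longrightarrow> coframe_v F u \<alpha> z (0, snd z) = 0"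
proof -
  note dual = u_inv_u[OF assms(1,2)]
  show "coframe_h u i z (frame_h F u k z) = (if i = k then 1 else 0)"
    by (simp add: coframe_h_def frame_h_def hlift_def dual)
  show "coframe_h u i z (frame_v F u \<beta> z) = 0"
    by (simp add: coframe_h_def frame_v_def)
  show "coframe_v F u \<alpha> z (frame_h F u k z) = 0"
    by (simp add: coframe_v_def frame_h_def hlift_def delta_y_def)
  have "(\<Sum>j\<in>UNIV. u_inv u z $ \<alpha> $ j * delta_y F j z (frame_v F u \<beta> z)) =
      - F z * (\<Sum>j\<in>UNIV. u_inv u z $ \<alpha> $ j * u \<beta> z $ j)"
    by (simp add: delta_y_def frame_v_def sum_distrib_left sum_negf[symmetric] algebra_simps)
  then show "coframe_v F u \<alpha> z (frame_v F u \<beta> z) = (if \<alpha> = \<beta> then 1 else 0)"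
    using assms(3) by (simp add: coframe_v_def dual)
  show "coframe_h u i z (0, snd z) = 0"
    by (simp add: coframe_h_def)
  assume "\<alpha> \<noteq> m"
  have "snd z = F z *\<^sub>R u m z"
    using assms by (simp add: adapted_frame_def)
  then have "(\<Sum>j\<in>UNIV. u_inv u z $ \<alpha> $ j * delta_y F j z (0, snd z)) =
      F z * (\<Sum>j\<in>UNIV. u_inv u z $ \<alpha> $ j * u m z $ j)"
    by (simp add: delta_y_def sum_distrib_left algebra_simps)
  then show "coframe_v F u \<alpha> z (0, snd z) = 0"
    using \<open>\<alpha> \<noteq> m\<close> by (simp add: coframe_v_def dual)
qed

section \<open>Chern and Berwald connections\<close>

text \<open>Connection forms \<open>\<omega> i j\<close> stand for \<open>\<omega>\<^sup>i\<^sub>j\<close> (upper index first), and likewise for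
  curvature components.\<close>

definition H_coeff :: "('n::finite tm \<Rightarrow> real) \<Rightarrow> ('n \<Rightarrow> 'n tm \<Rightarrow> real ^ 'n) \<Rightarrow>
    'n \<Rightarrow> 'n \<Rightarrow> 'n \<Rightarrow> 'n tm \<Rightarrow> real" where
  "H_coeff F u i j \<gamma> z = - (\<Sum>p\<in>UNIV. \<Sum>q\<in>UNIV. \<Sum>k\<in>UNIV.
     cartan F p q k z * u i z $ p * u j z $ q * u \<gamma> z $ k)"

definition chern_connection :: "('n::finite tm \<Rightarrow> real) \<Rightarrow> 'n tm set \<Rightarrow> 'n \<Rightarrow>
    ('n \<Rightarrow> 'n tm \<Rightarrow> real ^ 'n) \<Rightarrow> ('n \<Rightarrow> 'n \<Rightarrow> 'n tm form1) \<Rightarrow> bool" where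
  "chern_connection F W m u \<omega> \<longleftrightarrow>
     (\<forall>i j. form1_on_SM W (\<omega> i j)) \<and>
     (\<forall>z\<in>W. \<forall>i V V'.
        ext_d (coframe_h u i) z V V' = (\<Sum>j\<in>UNIV. wedge (coframe_h u j) (\<omega> i j) z V V')) \<and>
     (\<forall>z\<in>W. \<forall>i j V.
        \<omega> i j z V + \<omega> j i z V = - 2 * (\<Sum>\<gamma>\<in>- {m}. H_coeff F u i j \<gamma> z * coframe_v F u \<gamma> z V))"

definition curvature_form :: "('n::finite \<Rightarrow> 'n \<Rightarrow> 'n tm form1) \<Rightarrow> 'n \<Rightarrow> 'n \<Rightarrow> 'n tm form2" where
  "curvature_form \<omega> i j z V V' =
     ext_d (\<omega> i j) z V V' - (\<Sum>k\<in>UNIV. wedge (\<omega> k j) (\<omega> i k) z V V')"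

text \<open>The coefficient of the wedge of \<open>\<omega>\<^sup>k\<close> with the vertical coframe form of index \<open>\<gamma>\<close> in the
  curvature form: its value on the dual pair of frame vectors.\<close>

definition P_comp :: "('n::finite tm \<Rightarrow> real) \<Rightarrow> ('n \<Rightarrow> 'n tm \<Rightarrow> real ^ 'n) \<Rightarrow>
    ('n \<Rightarrow> 'n \<Rightarrow> 'n tm form1) \<Rightarrow> 'n \<Rightarrow> 'n \<Rightarrow> 'n \<Rightarrow> 'n \<Rightarrow> 'n tm \<Rightarrow> real" where
  "P_comp F u \<omega> i j k \<gamma> z = curvature_form \<omega> i j z (frame_h F u k z) (frame_v F u \<gamma> z)"

text \<open>In the following definitions \<open>\<omega>\<close> is meant to be the family of Chern connection forms.\<close>

definition landsberg :: "('n::finite tm \<Rightarrow> real) \<Rightarrow> 'n \<Rightarrow> ('n \<Rightarrow> 'n tm \<Rightarrow> real ^ 'n) \<Rightarrow>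
    ('n \<Rightarrow> 'n \<Rightarrow> 'n tm form1) \<Rightarrow> 'n \<Rightarrow> 'n \<Rightarrow> 'n \<Rightarrow> 'n tm \<Rightarrow> real" where
  "landsberg F m u \<omega> i j \<gamma> z = - P_comp F u \<omega> i j m \<gamma> z"

definition mean_landsberg :: "('n::finite tm \<Rightarrow> real) \<Rightarrow> 'n \<Rightarrow> ('n \<Rightarrow> 'n tm \<Rightarrow> real ^ 'n) \<Rightarrow>
    ('n \<Rightarrow> 'n \<Rightarrow> 'n tm form1) \<Rightarrow> 'n \<Rightarrow> 'n tm \<Rightarrow> real" where
  "mean_landsberg F m u \<omega> \<gamma> z = - (\<Sum>i\<in>UNIV. P_comp F u \<omega> i i m \<gamma> z)"

definition berwald_connection :: "('n::finite tm \<Rightarrow> real) \<Rightarrow> 'n \<Rightarrow> ('n \<Rightarrow> 'n tm \<Rightarrow> real ^ 'n) \<Rightarrow>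
    ('n \<Rightarrow> 'n \<Rightarrow> 'n tm form1) \<Rightarrow> 'n \<Rightarrow> 'n \<Rightarrow> 'n tm form1" where
  "berwald_connection F m u \<omega> i j z V =
     \<omega> i j z V - (\<Sum>\<alpha>\<in>- {m}. landsberg F m u \<omega> i j \<alpha> z * coframe_h u \<alpha> z V)"

definition mean_berwald :: "('n::finite tm \<Rightarrow> real) \<Rightarrow> 'n \<Rightarrow> ('n \<Rightarrow> 'n tm \<Rightarrow> real ^ 'n) \<Rightarrow>
    ('n \<Rightarrow> 'n \<Rightarrow> 'n tm form1) \<Rightarrow> 'n \<Rightarrow> 'n \<Rightarrow> 'n tm \<Rightarrow> real" where
  "mean_berwald F m u \<omega> \<gamma> \<mu> z =
     (\<Sum>i\<in>UNIV. P_comp F u (berwald_connection F m u \<omega>) i i \<gamma> \<mu> z)"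

definition berwald_scalar :: "('n::finite tm \<Rightarrow> real) \<Rightarrow> 'n \<Rightarrow> ('n \<Rightarrow> 'n tm \<Rightarrow> real ^ 'n) \<Rightarrow>
    ('n \<Rightarrow> 'n \<Rightarrow> 'n tm form1) \<Rightarrow> 'n tm \<Rightarrow> real" where
  "berwald_scalar F m u \<omega> z = (\<Sum>\<gamma>\<in>- {m}. mean_berwald F m u \<omega> \<gamma> \<gamma> z)"

text \<open>For a Finsler structure, adapted frames exist near every direction and the Chern
  connection forms of an adapted frame exist and are unique. The vanishing of \<open>J\<close> and \<open>e\<close> does
  not depend on the frame; it is stated in all of them.\<close>

definition local_chern_frame :: "('m, real ^ 'n::finite) chart \<Rightarrow> ('n tm \<Rightarrow> real) \<Rightarrow>
    'n tm set \<Rightarrow> 'n \<Rightarrow> ('n \<Rightarrow> 'n tm \<Rightarrow> real ^ 'n) \<Rightarrow> ('n \<Rightarrow> 'n \<Rightarrow> 'n tm form1) \<Rightarrow> bool" where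
  "local_chern_frame c F W m u \<omega> \<longleftrightarrow>
     conic_open W \<and> W \<subseteq> chart_img c \<times> UNIV \<and> adapted_frame F W m u \<and> chern_connection F W m u \<omega>"

definition mean_landsberg_zero :: "('m, real ^ 'n::finite) chart set \<Rightarrow>
    (('m, real ^ 'n) chart \<Rightarrow> 'n tm \<Rightarrow> real) \<Rightarrow> bool" where
  "mean_landsberg_zero A F \<longleftrightarrow> (\<forall>c\<in>A. \<forall>W m u \<omega>. local_chern_frame c (F c) W m u \<omega> \<longrightarrow>
     (\<forall>z\<in>W. \<forall>\<gamma>\<in>- {m}. mean_landsberg (F c) m u \<omega> \<gamma> z = 0))"

definition berwald_scalar_zero :: "('m, real ^ 'n::finite) chart set \<Rightarrow>
    (('m, real ^ 'n) chart \<Rightarrow> 'n tm \<Rightarrow> real) \<Rightarrow> bool" where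
  "berwald_scalar_zero A F \<longleftrightarrow> (\<forall>c\<in>A. \<forall>W m u \<omega>. local_chern_frame c (F c) W m u \<omega> \<longrightarrow>
     (\<forall>z\<in>W. berwald_scalar (F c) m u \<omega> z = 0))"

section \<open>S-curvature\<close>

definition distortion :: "('n::finite tm \<Rightarrow> real) \<Rightarrow> (real ^ 'n \<Rightarrow> real) \<Rightarrow> 'n tm \<Rightarrow> real" where
  "distortion F \<sigma> z = ln (sqrt (det (g_mat F z)) / \<sigma> (fst z))"

definition reeb :: "('n::finite tm \<Rightarrow> real) \<Rightarrow> 'n tm \<Rightarrow> 'n tm" where
  "reeb F z = hlift F z ((1 / F z) *\<^sub>R snd z)"

definition S_curvature :: "('n::finite tm \<Rightarrow> real) \<Rightarrow> (real ^ 'n \<Rightarrow> real) \<Rightarrow> 'n tm \<Rightarrow> real" where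
  "S_curvature F \<sigma> z = dir_deriv (distortion F \<sigma>) z (reeb F z)"

definition S_curvature_zero :: "('m, real ^ 'n::finite) chart set \<Rightarrow>
    (('m, real ^ 'n) chart \<Rightarrow> 'n tm \<Rightarrow> real) \<Rightarrow> (('m, real ^ 'n) chart \<Rightarrow> real ^ 'n \<Rightarrow> real) \<Rightarrow> bool" where
  "S_curvature_zero A F \<sigma> \<longleftrightarrow>
     (\<forall>c\<in>A. \<forall>x\<in>chart_img c. \<forall>y. y \<noteq> 0 \<longrightarrow> S_curvature (F c) (\<sigma> c) (x, y) = 0)"

end

theory Submission
  imports Defs
begin

text \<open>In a chart put \<open>\<lambda> = ln \<surd>det g\<close>, let \<open>\<Pi> = \<partial>G\<^sup>m/\<partial>y\<^sup>m\<close> and let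
  \<open>h\<^sub>k = \<delta>\<lambda>/\<delta>x\<^sup>k\<close>. The almost metric condition gives the trace of the Chern connection
  forms as \<open>h\<^sub>k dx\<^sup>k - d\<lambda>\<close>, so the traces of the \<open>P\<close>-curvatures are vertical derivatives of
  the \<open>h\<^sub>k\<close>. Together with \<open>y\<^sup>k h\<^sub>k = \<Pi>\<close>, the condition \<open>J = 0\<close> becomes
  \<open>h\<^sub>k = \<partial>\<Pi>/\<partial>y\<^sup>k\<close>, and then \<open>e = 0\<close> becomes \<open>g\<^sup>k\<^sup>l \<partial>\<^sup>2\<Pi>/\<partial>y\<^sup>k\<partial>y\<^sup>l = 0\<close>. On each fibre this is
  the equality case of a mixed-volume inequality, and Alexandrov's integration by parts
  shows that \<open>\<Pi>\<close> is linear in \<open>y\<close>, so that the \<open>h\<^sub>k\<close> depend on \<open>x\<close> only.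

  The required density is \<open>\<sigma>(x) = max\<^sub>y \<surd>det g(x, y)\<close>: where the maximum is attained
  \<open>\<partial>\<lambda>/\<partial>y = 0\<close>, hence \<open>\<partial>\<lambda>/\<partial>x\<^sup>k = h\<^sub>k(x)\<close> is the same for all maximisers, and an
  envelope argument gives \<open>d ln \<sigma> = h\<^sub>k dx\<^sup>k\<close>. So \<open>\<sigma>\<close> is smooth, and the distortion
  \<open>\<lambda> - ln \<sigma>\<close> has vanishing horizontal derivatives.\<close>

section \<open>Calculus of smooth maps\<close>

text \<open>The hypotheses quantify over pairs of an adapted frame and its Chern forms and say
  nothing until such a pair is exhibited; hence the smooth Gram-Schmidt frames on the cones
  \<open>slit m\<close> and the explicit \<open>chern_form\<close>. Of the curvature only the trace
  enters: its quadratic part cancels and dd\<lambda> = 0, which leaves dh_k \<and> dx^k. The Berwald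
  trace differs from the Chern trace by J alone, so J = 0 is used in both conditions. On a fibre,
  the field det g g^-1 Hess \<Pi> g^-1 d\<Pi> has divergence det g |Hess \<Pi>|^2: the cofactor
  matrix is divergence free, and the terms with derivatives of g^-1 cancel since the Cartan tensor
  is totally symmetric and Hess \<Pi> is trace-free. Homogeneity makes the field tangent to the
  level sets of F, so a cut-off in F adds no term. A maximum is taken because it involves no choice:
  a change of chart shifts \<lambda> by the same constant ln |det| on a whole fibre, so the maxima
  form a density. The obstacle is differentiability, as maximisers need be neither unique nor smooth
  in x; the independence of h_k from y overcomes it.\<close>

lemma dir_deriv_eqI: "(f has_derivative f') (at z) \<Longrightarrow> dir_deriv f z v = f' v"
  by (metis frechet_derivative_at)

lemma dir_deriv_works: "f differentiable at z \<Longrightarrow> (f has_derivative dir_deriv f z) (at z)"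
  by (simp add: frechet_derivative_works)

lemma differentiable_cong_open:
  assumes "open S" "z \<in> S" "\<And>w. w \<in> S \<Longrightarrow> f w = g w" "f differentiable at z"
  shows "g differentiable at z"
proof -
  obtain f' where "(f has_derivative f') (at z)"
    using assms(4) by (auto simp: differentiable_def)
  then have "(g has_derivative f') (at z)"
    by (rule has_derivative_transform_within_open[OF _ assms(1-3)])
  then show ?thesis by (auto simp: differentiable_def)
qed

lemma dir_deriv_cong_open:
  assumes "open S" "z \<in> S" "\<And>w. w \<in> S \<Longrightarrow> f w = g w"
  shows "dir_deriv f z v = dir_deriv g z v"
proof (cases "f differentiable at z")
  case True
  then show ?thesis
    using frechet_derivative_transform_within_open[OF True assms(1,2)] assms(3) by auto
next
  case False
  \<comment> \<open>If neither function is differentiable, both derivative predicates are empty, and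
    \<open>frechet_derivative\<close> is the same choice from the same predicate.\<close>
  have "\<not> g differentiable at z"
    using False differentiable_cong_open[OF assms(1,2), of g f] assms(3) by auto
  with False have "(\<lambda>f'. (f has_derivative f') (at z)) = (\<lambda>f'. (g has_derivative f') (at z))"
    by (auto simp: differentiable_def)
  then show ?thesis
    unfolding frechet_derivative_def by simp
qed

lemma Ck_on_cong:
  assumes "open S" "\<And>z. z \<in> S \<Longrightarrow> f z = g z" "Ck_on k S f"
  shows "Ck_on k S g"
  using assms(2,3)
proof (induction k arbitrary: f g)
  case 0
  then show ?case by (auto cong: continuous_on_cong)
next
  case (Suc k)
  have "Ck_on k S (\<lambda>z. dir_deriv g z v)" for v
    by (rule Suc.IH[of "\<lambda>z. dir_deriv f z v"])
      (use Suc.prems dir_deriv_cong_open[OF assms(1), of _ f g] in auto)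
  moreover have "g differentiable at z" if "z \<in> S" for z
    using differentiable_cong_open[OF assms(1) that, of f g] Suc.prems that by auto
  ultimately show ?case by simp
qed

lemma Ck_on_Suc_D: "Ck_on (Suc k) S f \<Longrightarrow> Ck_on k S f"
proof (induction k arbitrary: f)
  case 0
  then show ?case
    by (auto intro!: continuous_at_imp_continuous_on differentiable_imp_continuous_within)
next
  case (Suc k)
  then show ?case by (metis Ck_on.simps(2))
qed

lemma Ck_on_subset: "Ck_on k S f \<Longrightarrow> T \<subseteq> S \<Longrightarrow> Ck_on k T f"
  by (induction k arbitrary: f) (auto intro: continuous_on_subset)

lemma Ck_on_const: "Ck_on k S (\<lambda>z. c)"
  by (induction k arbitrary: c) (simp_all add: frechet_derivative_const)

lemma Ck_on_SucI:
  assumes "open S" "\<And>z. z \<in> S \<Longrightarrow> (f has_derivative f' z) (at z)"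
    "\<And>v. Ck_on k S (\<lambda>z. f' z v)"
  shows "Ck_on (Suc k) S f"
proof -
  have "Ck_on k S (\<lambda>z. dir_deriv f z v)" for v
    by (rule Ck_on_cong[OF assms(1) _ assms(3)[of v]]) (use assms(2) dir_deriv_eqI in metis)
  moreover have "f differentiable at z" if "z \<in> S" for z
    using assms(2)[OF that] by (auto simp: differentiable_def)
  ultimately show ?thesis by simp
qed

lemma Ck_on_Suc_has_derivative:
  "Ck_on (Suc k) S f \<Longrightarrow> z \<in> S \<Longrightarrow> (f has_derivative dir_deriv f z) (at z)"
  by (auto intro: dir_deriv_works)

lemma Ck_on_bounded_linear_compose:
  assumes "bounded_linear L" "open S" "Ck_on k S f"
  shows "Ck_on k S (\<lambda>z. L (f z))"
  using assms(3)
proof (induction k arbitrary: f)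
  case 0
  then show ?case
    using assms(1) by (auto intro: bounded_linear.continuous_on)
next
  case (Suc k)
  show ?case
  proof (rule Ck_on_SucI[OF assms(2)])
    fix z assume "z \<in> S"
    show "((\<lambda>z. L (f z)) has_derivative (\<lambda>v. L (dir_deriv f z v))) (at z)"
      by (rule bounded_linear.has_derivative[OF assms(1) Ck_on_Suc_has_derivative[OF Suc.prems \<open>z \<in> S\<close>]])
  next
    fix v show "Ck_on k S (\<lambda>z. L (dir_deriv f z v))"
      using Suc by auto
  qed
qed

lemma Ck_on_add:
  assumes "open S" "Ck_on k S f" "Ck_on k S g"
  shows "Ck_on k S (\<lambda>z. f z + g z)"
  using assms(2,3)
proof (induction k arbitrary: f g)
  case 0
  then show ?case by (auto intro: continuous_intros)
next
  case (Suc k)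
  show ?case
  proof (rule Ck_on_SucI[OF assms(1)])
    fix z assume "z \<in> S"
    show "((\<lambda>z. f z + g z) has_derivative (\<lambda>v. dir_deriv f z v + dir_deriv g z v)) (at z)"
      by (intro has_derivative_add Ck_on_Suc_has_derivative[OF _ \<open>z \<in> S\<close>]) (use Suc.prems in auto)
  next
    fix v show "Ck_on k S (\<lambda>z. dir_deriv f z v + dir_deriv g z v)"
      using Suc by auto
  qed
qed

text \<open>The product rule gives a sum of values of \<open>B\<close> on maps of one order less, so
  a single induction covers both products and scalar multiples.\<close>

lemma Ck_on_bilinear:
  assumes "bounded_bilinear B" "open S" "Ck_on k S f" "Ck_on k S g"
  shows "Ck_on k S (\<lambda>z. B (f z) (g z))"
  using assms(3,4)
proof (induction k arbitrary: f g)
  case 0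
  then show ?case using assms(1) by (auto intro: bounded_bilinear.continuous_on)
next
  case (Suc k)
  show ?case
  proof (rule Ck_on_SucI[OF assms(2)])
    fix z assume "z \<in> S"
    show "((\<lambda>z. B (f z) (g z)) has_derivative
        (\<lambda>v. B (f z) (dir_deriv g z v) + B (dir_deriv f z v) (g z))) (at z)"
      by (intro bounded_bilinear.FDERIV[OF assms(1)] Ck_on_Suc_has_derivative[OF _ \<open>z \<in> S\<close>])
        (use Suc.prems in auto)
  next
    fix v show "Ck_on k S (\<lambda>z. B (f z) (dir_deriv g z v) + B (dir_deriv f z v) (g z))"
      using Suc.prems Ck_on_Suc_D[OF Suc.prems(1)] Ck_on_Suc_D[OF Suc.prems(2)]
      by (intro Ck_on_add[OF assms(2)] Suc.IH) auto
  qed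
qed

text \<open>The outer function has one real variable, so its derivative is multiplication by the
  value at 1 and the chain rule produces a product.\<close>

lemma Ck_on_real_compose:
  fixes h :: "real \<Rightarrow> real" and f :: "'a::real_normed_vector \<Rightarrow> real"
  assumes "open S" "Ck_on k T h" "Ck_on k S f" "f ` S \<subseteq> T"
  shows "Ck_on k S (\<lambda>z. h (f z))"
  using assms(2-4)
proof (induction k arbitrary: f h)
  case 0
  then show ?case by (auto intro: continuous_on_compose2)
next
  case (Suc k)
  show ?case
  proof (rule Ck_on_SucI[OF assms(1)])
    fix z assume "z \<in> S"
    have h: "(h has_derivative dir_deriv h (f z)) (at (f z))"
      using Suc.prems \<open>z \<in> S\<close> by (intro Ck_on_Suc_has_derivative) auto
    interpret H: bounded_linear "dir_deriv h (f z)"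
      using h by (rule has_derivative_bounded_linear)
    have "((\<lambda>z. h (f z)) has_derivative (\<lambda>v. dir_deriv h (f z) (dir_deriv f z v))) (at z)"
      using diff_chain_at[OF Ck_on_Suc_has_derivative[OF Suc.prems(2) \<open>z \<in> S\<close>] h]
      by (simp add: o_def)
    moreover have "dir_deriv h (f z) (dir_deriv f z v) = dir_deriv f z v * dir_deriv h (f z) 1" for v
      using H.scaleR[of "dir_deriv f z v" 1] by simp
    ultimately show "((\<lambda>z. h (f z)) has_derivative
        (\<lambda>v. dir_deriv f z v * dir_deriv h (f z) 1)) (at z)" by simp
  next
    fix v
    have "Ck_on k S (\<lambda>z. dir_deriv f z v)" "Ck_on k T (\<lambda>r. dir_deriv h r 1)"
      using Suc.prems by simp_all
    then show "Ck_on k S (\<lambda>z. dir_deriv f z v * dir_deriv h (f z) 1)"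
      using Ck_on_bilinear[OF bounded_bilinear_mult assms(1), of k "\<lambda>z. dir_deriv f z v"
          "\<lambda>z. dir_deriv h (f z) 1"]
        Suc.IH[of "\<lambda>r. dir_deriv h r 1" f, OF _ Ck_on_Suc_D[OF Suc.prems(2)] Suc.prems(3)]
      by blast
  qed
qed

section \<open>Closure properties of smooth maps\<close>

lemma smooth_on_cong:
  "open S \<Longrightarrow> (\<And>z. z \<in> S \<Longrightarrow> f z = g z) \<Longrightarrow> smooth_on S f \<Longrightarrow> smooth_on S g"
  unfolding smooth_on_def using Ck_on_cong by blast

lemma smooth_on_subset: "smooth_on S f \<Longrightarrow> T \<subseteq> S \<Longrightarrow> smooth_on T f"
  unfolding smooth_on_def using Ck_on_subset by blast

lemma smooth_on_differentiable: "smooth_on S f \<Longrightarrow> z \<in> S \<Longrightarrow> f differentiable at z"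
  unfolding smooth_on_def by (metis Ck_on.simps(2))

lemma smooth_on_has_derivative:
  "smooth_on S f \<Longrightarrow> z \<in> S \<Longrightarrow> (f has_derivative dir_deriv f z) (at z)"
  using smooth_on_differentiable dir_deriv_works by blast

lemma smooth_on_continuous: "smooth_on S f \<Longrightarrow> continuous_on S f"
  unfolding smooth_on_def by (metis Ck_on.simps(1))

lemma smooth_on_dir_deriv:
  "smooth_on S f \<Longrightarrow> smooth_on S (\<lambda>z. dir_deriv f z v)"
  unfolding smooth_on_def by (metis Ck_on.simps(2))

lemma smooth_onI_deriv:
  assumes "open S" "\<And>z. z \<in> S \<Longrightarrow> (f has_derivative f' z) (at z)"
    "\<And>v. smooth_on S (\<lambda>z. f' z v)"
  shows "smooth_on S f"
  unfolding smooth_on_def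
proof
  fix k
  have "Ck_on (Suc k) S f"
    using Ck_on_SucI[OF assms(1,2)] assms(3) by (auto simp: smooth_on_def)
  then show "Ck_on k S f" by (rule Ck_on_Suc_D)
qed

lemma smooth_on_const: "smooth_on S (\<lambda>z. c)"
  by (simp add: smooth_on_def Ck_on_const)

lemma smooth_on_add:
  "open S \<Longrightarrow> smooth_on S f \<Longrightarrow> smooth_on S g \<Longrightarrow> smooth_on S (\<lambda>z. f z + g z)"
  by (simp add: smooth_on_def Ck_on_add)

lemma smooth_on_bounded_linear_compose:
  "bounded_linear L \<Longrightarrow> open S \<Longrightarrow> smooth_on S f \<Longrightarrow> smooth_on S (\<lambda>z. L (f z))"
  by (simp add: smooth_on_def Ck_on_bounded_linear_compose)

lemma smooth_on_bilinear:
  "bounded_bilinear B \<Longrightarrow> open S \<Longrightarrow> smooth_on S f \<Longrightarrow> smooth_on S g \<Longrightarrow>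
    smooth_on S (\<lambda>z. B (f z) (g z))"
  by (simp add: smooth_on_def Ck_on_bilinear)

lemma smooth_on_mult:
  fixes f g :: "'a::real_normed_vector \<Rightarrow> real"
  shows "open S \<Longrightarrow> smooth_on S f \<Longrightarrow> smooth_on S g \<Longrightarrow> smooth_on S (\<lambda>z. f z * g z)"
  by (rule smooth_on_bilinear[OF bounded_bilinear_mult])

lemma smooth_on_scaleR:
  "open S \<Longrightarrow> smooth_on S f \<Longrightarrow> smooth_on S g \<Longrightarrow> smooth_on S (\<lambda>z. f z *\<^sub>R g z)"
  by (rule smooth_on_bilinear[OF bounded_bilinear_scaleR])

lemma smooth_on_uminus:
  "open S \<Longrightarrow> smooth_on S f \<Longrightarrow> smooth_on S (\<lambda>z. - f z)"
  by (rule smooth_on_bounded_linear_compose[OF bounded_linear_minus[OF bounded_linear_ident]])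

lemma smooth_on_diff:
  "open S \<Longrightarrow> smooth_on S f \<Longrightarrow> smooth_on S g \<Longrightarrow> smooth_on S (\<lambda>z. f z - g z)"
  using smooth_on_add[of S f "\<lambda>z. - g z"] smooth_on_uminus[of S g] by simp

lemma smooth_on_sum:
  assumes "open S" "\<And>i. i \<in> I \<Longrightarrow> smooth_on S (f i)"
  shows "smooth_on S (\<lambda>z. \<Sum>i\<in>I. f i z)"
  using assms(2)
proof (induction I rule: infinite_finite_induct)
  case (insert i I)
  then show ?case by (auto intro!: smooth_on_add assms(1))
qed (auto intro: smooth_on_const)

lemma smooth_on_prod:
  fixes f :: "'i \<Rightarrow> 'a::real_normed_vector \<Rightarrow> real"
  assumes "open S" "\<And>i. i \<in> I \<Longrightarrow> smooth_on S (f i)"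
  shows "smooth_on S (\<lambda>z. \<Prod>i\<in>I. f i z)"
  using assms(2)
proof (induction I rule: infinite_finite_induct)
  case (insert i I)
  then show ?case by (auto intro!: smooth_on_mult assms(1))
qed (auto intro: smooth_on_const)

lemma smooth_on_vec_nth:
  fixes f :: "'a::real_normed_vector \<Rightarrow> real ^ 'n::finite"
  shows "open S \<Longrightarrow> smooth_on S f \<Longrightarrow> smooth_on S (\<lambda>z. f z $ i)"
  by (rule smooth_on_bounded_linear_compose[OF bounded_linear_vec_nth])

lemma smooth_on_linear: "open S \<Longrightarrow> bounded_linear L \<Longrightarrow> smooth_on S L"
  by (rule smooth_onI_deriv[where f' = "\<lambda>_. L"])
    (auto intro: bounded_linear_imp_has_derivative smooth_on_const)

lemma smooth_on_snd: "open S \<Longrightarrow> smooth_on S snd"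
  by (rule smooth_on_linear[OF _ bounded_linear_snd])

lemma smooth_on_real_compose:
  fixes h :: "real \<Rightarrow> real"
  assumes "open S" "smooth_on T h" "smooth_on S f" "f ` S \<subseteq> T"
  shows "smooth_on S (\<lambda>z. h (f z))"
  unfolding smooth_on_def
proof
  show "Ck_on k S (\<lambda>z. h (f z))" for k
    by (rule Ck_on_real_compose[OF assms(1) _ _ assms(4)])
      (use assms(2,3) in \<open>simp_all add: smooth_on_def\<close>)
qed

lemma smooth_on_exp_real: "smooth_on UNIV (exp :: real \<Rightarrow> real)"
  unfolding smooth_on_def
proof
  fix k show "Ck_on k UNIV (exp :: real \<Rightarrow> real)"
  proof (induction k)
    case (Suc k)
    show ?case
    proof (rule Ck_on_SucI)
      show "((exp :: real \<Rightarrow> real) has_derivative (\<lambda>v. exp z * v)) (at z)" for z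
        using DERIV_exp[of z] by (simp add: has_field_derivative_def)
      show "Ck_on k UNIV (\<lambda>z::real. exp z * v)" for v :: real
        by (rule Ck_on_bilinear[OF bounded_bilinear_mult _ Suc.IH Ck_on_const]) simp
    qed auto
  qed (simp add: continuous_at_imp_continuous_on)
qed

lemma smooth_on_inverse_real: "smooth_on (- {0}) (inverse :: real \<Rightarrow> real)"
  unfolding smooth_on_def
proof
  fix k show "Ck_on k (- {0}) (inverse :: real \<Rightarrow> real)"
  proof (induction k)
    case (Suc k)
    show ?case
    proof (rule Ck_on_SucI)
      fix z :: real assume "z \<in> - {0}"
      then show "(inverse has_derivative (\<lambda>v. - (inverse z * v * inverse z))) (at z)"
        by (auto intro: has_derivative_inverse')
    next
      have "Ck_on k (- {0::real}) (\<lambda>z. (- v) * (inverse z * inverse z))" for v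
        by (rule Ck_on_bilinear[OF bounded_bilinear_mult _ Ck_on_const
            Ck_on_bilinear[OF bounded_bilinear_mult _ Suc.IH Suc.IH]]) auto
      then show "Ck_on k (- {0::real}) (\<lambda>z. - (inverse z * v * inverse z))" for v
        by (simp add: mult_ac)
    qed auto
  qed (use DERIV_isCont[OF DERIV_inverse] in \<open>auto intro!: continuous_at_imp_continuous_on\<close>)
qed

lemma smooth_on_ln_real: "smooth_on {0<..} (ln :: real \<Rightarrow> real)"
proof (rule smooth_onI_deriv)
  show "smooth_on {0<..} (\<lambda>z. inverse z * v)" for v :: real
    by (rule smooth_on_mult[OF _ smooth_on_subset[OF smooth_on_inverse_real] smooth_on_const]) auto
  show "(ln has_derivative (\<lambda>v. inverse z * v)) (at z)" if "z \<in> {0<..}" for z :: real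
    using that unfolding has_field_derivative_def[symmetric] by (intro DERIV_ln) simp
qed simp

lemma smooth_on_inverse:
  fixes f :: "'a::real_normed_vector \<Rightarrow> real"
  assumes "open S" "smooth_on S f" "\<And>z. z \<in> S \<Longrightarrow> f z \<noteq> 0"
  shows "smooth_on S (\<lambda>z. inverse (f z))"
proof -
  have "f ` S \<subseteq> - {0}" by (rule image_subsetI) (simp add: assms(3))
  then show ?thesis
    by (rule smooth_on_real_compose[OF assms(1) smooth_on_inverse_real assms(2)])
qed

lemma smooth_on_divide:
  fixes f :: "'a::real_normed_vector \<Rightarrow> real"
  assumes "open S" "smooth_on S f" "smooth_on S g" "\<And>z. z \<in> S \<Longrightarrow> g z \<noteq> 0"
  shows "smooth_on S (\<lambda>z. f z / g z)"
  unfolding divide_inverse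
  by (rule smooth_on_mult[OF assms(1,2) smooth_on_inverse[OF assms(1,3,4)]])

lemma smooth_on_ln:
  fixes f :: "'a::real_normed_vector \<Rightarrow> real"
  assumes "open S" "smooth_on S f" "\<And>z. z \<in> S \<Longrightarrow> f z > 0"
  shows "smooth_on S (\<lambda>z. ln (f z))"
proof -
  have "f ` S \<subseteq> {0<..}" by (rule image_subsetI) (simp add: assms(3))
  then show ?thesis
    by (rule smooth_on_real_compose[OF assms(1) smooth_on_ln_real assms(2)])
qed

lemma smooth_on_exp:
  fixes f :: "'a::real_normed_vector \<Rightarrow> real"
  assumes "open S" "smooth_on S f"
  shows "smooth_on S (\<lambda>z. exp (f z))"
  by (rule smooth_on_real_compose[OF assms(1) smooth_on_exp_real assms(2)]) blast

lemma smooth_on_sqrt: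
  fixes f :: "'a::real_normed_vector \<Rightarrow> real"
  assumes "open S" "smooth_on S f" "\<And>z. z \<in> S \<Longrightarrow> f z > 0"
  shows "smooth_on S (\<lambda>z. sqrt (f z))"
proof (rule smooth_on_cong[OF assms(1)])
  show "smooth_on S (\<lambda>z. exp (ln (f z) / 2))"
    apply (rule smooth_on_exp smooth_on_divide smooth_on_ln smooth_on_const | simp add: assms)+
    done
  show "exp (ln (f z) / 2) = sqrt (f z)" if "z \<in> S" for z
    using assms(3)[OF that] by (simp flip: ln_sqrt)
qed

lemma smooth_on_det:
  fixes M :: "'a::real_normed_vector \<Rightarrow> real ^ 'n ^ 'n"
  assumes "open S" "\<And>i j. smooth_on S (\<lambda>z. M z $ i $ j)"
  shows "smooth_on S (\<lambda>z. det (M z))"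
  unfolding det_def
  by (intro smooth_on_sum smooth_on_mult smooth_on_prod smooth_on_const assms)

lemma dir_deriv_linear: "f differentiable at z \<Longrightarrow> linear (dir_deriv f z)"
  by (meson dir_deriv_works has_derivative_bounded_linear bounded_linear.linear)

lemma dir_deriv_diff:
  "f differentiable at z \<Longrightarrow> g differentiable at z \<Longrightarrow>
    dir_deriv (\<lambda>z. f z - g z) z v = dir_deriv f z v - dir_deriv g z v"
  by (rule dir_deriv_eqI) (intro has_derivative_diff dir_deriv_works)

lemma dir_deriv_sum:
  "(\<And>i. i \<in> I \<Longrightarrow> f i differentiable at z) \<Longrightarrow>
    dir_deriv (\<lambda>z. \<Sum>i\<in>I. f i z) z v = (\<Sum>i\<in>I. dir_deriv (f i) z v)"
  by (rule dir_deriv_eqI) (intro has_derivative_sum dir_deriv_works)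

lemma dir_deriv_mult:
  fixes f g :: "'a::real_normed_vector \<Rightarrow> real"
  shows "f differentiable at z \<Longrightarrow> g differentiable at z \<Longrightarrow>
    dir_deriv (\<lambda>z. f z * g z) z v = f z * dir_deriv g z v + dir_deriv f z v * g z"
  by (rule dir_deriv_eqI) (intro has_derivative_mult dir_deriv_works)

lemma dir_deriv_const [simp]: "dir_deriv (\<lambda>z. c) z v = 0"
  by (simp add: frechet_derivative_const)

lemma dir_deriv_cmult:
  fixes f :: "'a::real_normed_vector \<Rightarrow> real"
  shows "f differentiable at z \<Longrightarrow> dir_deriv (\<lambda>z. c * f z) z v = c * dir_deriv f z v"
  using dir_deriv_mult[of "\<lambda>_. c" z f v] by simp

lemma dir_deriv_bounded_linear: "bounded_linear L \<Longrightarrow> dir_deriv L z v = L v"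
  by (rule dir_deriv_eqI) (rule bounded_linear_imp_has_derivative)

text \<open>A moving direction is expanded in the basis with smooth coefficients, which reduces it
  to the fixed directions in the definition of \<open>Ck_on\<close>.\<close>

lemma smooth_on_dir_deriv_field:
  fixes f :: "'a::euclidean_space \<Rightarrow> 'b::real_normed_vector"
  assumes "open S" "smooth_on S f" "smooth_on S w"
  shows "smooth_on S (\<lambda>z. dir_deriv f z (w z))"
proof (rule smooth_on_cong[OF assms(1)])
  show "smooth_on S (\<lambda>z. \<Sum>b\<in>Basis. (w z \<bullet> b) *\<^sub>R dir_deriv f z b)"
    by (intro smooth_on_sum smooth_on_scaleR smooth_on_dir_deriv assms
        smooth_on_bounded_linear_compose[OF bounded_linear_inner_left])
  fix z assume "z \<in> S"
  interpret linear "dir_deriv f z"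
    by (intro dir_deriv_linear smooth_on_differentiable[OF assms(2)] \<open>z \<in> S\<close>)
  have "dir_deriv f z (w z) = dir_deriv f z (\<Sum>b\<in>Basis. (w z \<bullet> b) *\<^sub>R b)"
    by (simp add: euclidean_representation)
  then show "(\<Sum>b\<in>Basis. (w z \<bullet> b) *\<^sub>R dir_deriv f z b) = dir_deriv f z (w z)"
    by (simp add: sum scaleR)
qed

subsection \<open>Symmetry of second derivatives\<close>

text \<open>The mean value theorem is applied twice: along \<open>v\<close> to the difference in
  direction \<open>w\<close>, then along \<open>w\<close> to the derivative in direction
  \<open>v\<close>.\<close>

lemma second_difference_mean_value:
  fixes f :: "'a::real_normed_vector \<Rightarrow> real"
  assumes f: "\<And>w. w \<in> ball z r \<Longrightarrow> f differentiable at w"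
    and f': "\<And>w. w \<in> ball z r \<Longrightarrow> (\<lambda>x. dir_deriv f x v) differentiable at w"
    and s: "0 < s" "s * (norm v + norm w) < r"
  shows "\<exists>a b. 0 < a \<and> a < s \<and> 0 < b \<and> b < s \<and>
    f (z + s *\<^sub>R v + s *\<^sub>R w) - f (z + s *\<^sub>R v) - f (z + s *\<^sub>R w) + f z =
    s * s * dir_deriv (\<lambda>x. dir_deriv f x v) (z + a *\<^sub>R v + b *\<^sub>R w) w"
proof -
  have in_ball: "z + a *\<^sub>R v + b *\<^sub>R w \<in> ball z r" if "0 \<le> a" "a \<le> s" "0 \<le> b" "b \<le> s" for a b
  proof -
    have "norm (a *\<^sub>R v + b *\<^sub>R w) \<le> a * norm v + b * norm w"
      using norm_triangle_ineq[of "a *\<^sub>R v" "b *\<^sub>R w"] that by simp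
    also have "\<dots> \<le> s * (norm v + norm w)"
      using that by (simp add: distrib_left add_mono mult_right_mono)
    finally have "norm (a *\<^sub>R v + b *\<^sub>R w) < r"
      using s(2) by simp
    moreover have "dist z (z + p) = norm p" for p
      by (simp add: dist_norm)
    ultimately have "dist z (z + (a *\<^sub>R v + b *\<^sub>R w)) < r"
      by simp
    then show ?thesis by (simp add: add.assoc)
  qed
  have chain: "((\<lambda>t. h (p + t *\<^sub>R q)) has_derivative (\<lambda>c. c * dir_deriv h (p + t *\<^sub>R q) q)) (at t)"
    if "h differentiable at (p + t *\<^sub>R q)" for h :: "'a \<Rightarrow> real" and p q t
  proof -
    have "((\<lambda>t. p + t *\<^sub>R q) has_derivative (\<lambda>c. c *\<^sub>R q)) (at t)"
      by (auto intro!: derivative_eq_intros)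
    from diff_chain_at[OF this dir_deriv_works[OF that]]
    show ?thesis
      using linear.scaleR[OF dir_deriv_linear[OF that]] by (simp add: o_def)
  qed
  define \<phi> where "\<phi> a = f (z + s *\<^sub>R w + a *\<^sub>R v) - f (z + a *\<^sub>R v)" for a
  have "(\<phi> has_real_derivative
      (dir_deriv f (z + s *\<^sub>R w + a *\<^sub>R v) v - dir_deriv f (z + a *\<^sub>R v) v)) (at a)"
    if "0 \<le> a" "a \<le> s" for a
  proof -
    have "z + s *\<^sub>R w + a *\<^sub>R v \<in> ball z r" "z + a *\<^sub>R v \<in> ball z r"
      using in_ball[of a s] in_ball[of a 0] that s(1) by (simp_all add: add_ac)
    note D = has_derivative_diff[OF chain[OF f[OF this(1)]] chain[OF f[OF this(2)]]]
    have eq: "(\<lambda>c. c * p - c * q) = (*) (p - q)" for p q :: real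
      by (simp add: fun_eq_iff algebra_simps)
    show ?thesis
      unfolding \<phi>_def has_field_derivative_def using D unfolding eq .
  qed
  from MVT2[OF s(1), of \<phi>, OF this]
  obtain a where a: "0 < a" "a < s"
    "\<phi> s - \<phi> 0 = s * (dir_deriv f (z + s *\<^sub>R w + a *\<^sub>R v) v - dir_deriv f (z + a *\<^sub>R v) v)"
    by auto
  have "((\<lambda>b. dir_deriv f (z + a *\<^sub>R v + b *\<^sub>R w) v) has_real_derivative
      (dir_deriv (\<lambda>x. dir_deriv f x v) (z + a *\<^sub>R v + b *\<^sub>R w) w)) (at b)"
    if "0 \<le> b" "b \<le> s" for b
  proof -
    have eq: "(\<lambda>c. c * p) = (*) p" for p :: real
      by (simp add: fun_eq_iff)
    have "z + a *\<^sub>R v + b *\<^sub>R w \<in> ball z r"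
      by (rule in_ball) (use that a(1,2) in auto)
    then show ?thesis
      using chain[OF f'] unfolding has_field_derivative_def eq by blast
  qed
  from MVT2[OF s(1), of "\<lambda>b. dir_deriv f (z + a *\<^sub>R v + b *\<^sub>R w) v", OF this]
  obtain b where b: "0 < b" "b < s"
    "dir_deriv f (z + a *\<^sub>R v + s *\<^sub>R w) v - dir_deriv f (z + a *\<^sub>R v) v =
      s * dir_deriv (\<lambda>x. dir_deriv f x v) (z + a *\<^sub>R v + b *\<^sub>R w) w"
    by auto
  have "\<phi> s - \<phi> 0 = s * (s * dir_deriv (\<lambda>x. dir_deriv f x v) (z + a *\<^sub>R v + b *\<^sub>R w) w)"
    using a(3) b(3) by (simp add: add_ac)
  then show ?thesis
    using a(1,2) b(1,2) by (intro exI[of _ a] exI[of _ b]) (simp add: \<phi>_def add_ac diff_diff_eq2)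
qed

text \<open>The second difference is symmetric in \<open>v\<close> and \<open>w\<close>; divided by
  the square of the step it tends to either mixed derivative, by their continuity.\<close>

lemma dir_deriv_commute:
  fixes f :: "'a::real_normed_vector \<Rightarrow> real"
  assumes "open S" "smooth_on S f" "z \<in> S"
  shows "dir_deriv (\<lambda>x. dir_deriv f x v) z w = dir_deriv (\<lambda>x. dir_deriv f x w) z v"
proof -
  obtain r where r: "r > 0" "ball z r \<subseteq> S"
    using assms open_contains_ball by metis
  \<comment> \<open>The extra 1 keeps \<open>K\<close> positive when both vectors vanish and makes
    the ball condition strict.\<close>
  define K where "K = norm v + norm w + 1"
  have K: "K > 0" by (simp add: K_def add_nonneg_pos)
  define s where "s n = r / K * inverse (real (Suc (Suc n)))" for n
  have s: "0 < s n" "s n * (norm v + norm w) < r" "s n * (norm w + norm v) < r" for n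
  proof -
    show "0 < s n" using r K by (simp add: s_def)
    have "s n * (norm v + norm w) < s n * K" using \<open>0 < s n\<close> by (simp add: K_def)
    also have "s n * K = r / real (Suc (Suc n))" using K by (simp add: s_def divide_inverse)
    also have "\<dots> \<le> r" using r by (simp add: field_simps)
    finally show "s n * (norm v + norm w) < r" "s n * (norm w + norm v) < r"
      by (auto simp: add.commute)
  qed
  have s0: "s \<longlonglongrightarrow> 0" unfolding s_def
    using tendsto_mult[OF tendsto_const LIMSEQ_Suc[OF LIMSEQ_inverse_real_of_nat], of "r / K"] by simp
  have main: "(\<lambda>n. (f (z + s n *\<^sub>R v + s n *\<^sub>R w) - f (z + s n *\<^sub>R v) - f (z + s n *\<^sub>R w) + f z)
      / (s n * s n)) \<longlonglongrightarrow> dir_deriv (\<lambda>x. dir_deriv f x v) z w"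
    if "\<And>n. s n * (norm v + norm w) < r" for v w
  proof -
    have diff: "f differentiable at x" "(\<lambda>x. dir_deriv f x v) differentiable at x" if "x \<in> ball z r" for x
      using that r(2) smooth_on_differentiable[OF assms(2), of x]
        smooth_on_differentiable[OF smooth_on_dir_deriv[OF assms(2)], of x v] by auto
    have "\<forall>n. \<exists>a b. 0 < a \<and> a < s n \<and> 0 < b \<and> b < s n \<and>
      f (z + s n *\<^sub>R v + s n *\<^sub>R w) - f (z + s n *\<^sub>R v) - f (z + s n *\<^sub>R w) + f z =
      s n * s n * dir_deriv (\<lambda>x. dir_deriv f x v) (z + a *\<^sub>R v + b *\<^sub>R w) w"
      by (intro allI second_difference_mean_value[OF diff s(1) that])
    then obtain a b where ab: "\<And>n. 0 < a n \<and> a n < s n \<and> 0 < b n \<and> b n < s n \<and>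
      f (z + s n *\<^sub>R v + s n *\<^sub>R w) - f (z + s n *\<^sub>R v) - f (z + s n *\<^sub>R w) + f z =
      s n * s n * dir_deriv (\<lambda>x. dir_deriv f x v) (z + a n *\<^sub>R v + b n *\<^sub>R w) w"
      by metis
    have "a \<longlonglongrightarrow> 0" "b \<longlonglongrightarrow> 0"
      using ab by (auto intro!: tendsto_sandwich[OF _ _ tendsto_const s0] always_eventually less_imp_le)
    then have "(\<lambda>n. z + a n *\<^sub>R v + b n *\<^sub>R w) \<longlonglongrightarrow> z + 0 *\<^sub>R v + 0 *\<^sub>R w"
      by (intro tendsto_intros)
    moreover have "isCont (\<lambda>x. dir_deriv (\<lambda>x. dir_deriv f x v) x w) z"
      using smooth_on_continuous[OF smooth_on_dir_deriv[OF smooth_on_dir_deriv[OF assms(2)]]]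
        assms(1,3) by (simp add: continuous_on_eq_continuous_at)
    ultimately have "(\<lambda>n. dir_deriv (\<lambda>x. dir_deriv f x v) (z + a n *\<^sub>R v + b n *\<^sub>R w) w)
        \<longlonglongrightarrow> dir_deriv (\<lambda>x. dir_deriv f x v) z w"
      by (auto intro: isCont_tendsto_compose)
    moreover have "dir_deriv (\<lambda>x. dir_deriv f x v) (z + a n *\<^sub>R v + b n *\<^sub>R w) w =
       (f (z + s n *\<^sub>R v + s n *\<^sub>R w) - f (z + s n *\<^sub>R v) - f (z + s n *\<^sub>R w) + f z) / (s n * s n)" for n
      using ab[of n] s(1)[of n] by simp
    ultimately show ?thesis by simp
  qed
  have "(\<lambda>n. (f (z + s n *\<^sub>R v + s n *\<^sub>R w) - f (z + s n *\<^sub>R v) - f (z + s n *\<^sub>R w) + f z)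
      / (s n * s n)) \<longlonglongrightarrow> dir_deriv (\<lambda>x. dir_deriv f x w) z v"
    using main[of w v] s(3) by (simp add: algebra_simps)
  with main[of v w] s(2) show ?thesis
    by (blast intro: LIMSEQ_unique)
qed

section \<open>Inverse matrices and Jacobi's formula\<close>

lemma matrix_inv_right_left:
  fixes A :: "real ^ 'n ^ 'n"
  assumes "invertible A"
  shows "A ** matrix_inv A = mat 1" "matrix_inv A ** A = mat 1"
  using someI_ex[OF assms[unfolded invertible_def]] unfolding matrix_inv_def by auto

lemma matrix_mult_entry_sum:
  fixes A :: "real ^ 'n ^ 'm"
  assumes "A ** B = C"
  shows "(\<Sum>k\<in>UNIV. A $ i $ k * B $ k $ j) = C $ i $ j"
  using assms by (auto simp: matrix_matrix_mult_def)

text \<open>Cramer's rule. It exhibits the entries of the inverse as quotients of determinants, from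
  which their smooth dependence follows.\<close>

lemma matrix_inv_entry:
  fixes A :: "real ^ 'n ^ 'n"
  assumes "det A \<noteq> 0"
  shows "matrix_inv A $ k $ l = det (\<chi> i j. if j = k then axis l 1 $ i else A $ i $ j) / det A"
proof -
  have "invertible A" using assms by (simp add: invertible_det_nz)
  then have "A *v (matrix_inv A *v axis l 1) = axis l 1"
    by (simp add: matrix_vector_mul_assoc matrix_inv_right_left)
  note eq = this
  have "det (\<chi> i j. if j = k then axis l 1 $ i else A $ i $ j) = (matrix_inv A *v axis l 1) $ k * det A"
    using cramer_lemma[of k A "matrix_inv A *v axis l 1"] unfolding eq .
  moreover have "(matrix_inv A *v axis l 1) $ k = matrix_inv A $ k $ l"
    by (simp add: matrix_vector_mult_basis column_def)
  ultimately show ?thesis using assms by simp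
qed

lemma matrix_inv_symmetric:
  fixes A :: "real ^ 'n ^ 'n"
  assumes "invertible A" "transpose A = A"
  shows "matrix_inv A $ i $ j = matrix_inv A $ j $ i"
proof -
  let ?H = "matrix_inv A"
  note H = matrix_inv_right_left[OF assms(1)]
  have "transpose ?H ** A = transpose (A ** ?H)"
    by (simp add: matrix_transpose_mul assms(2))
  then have "transpose ?H ** A = mat 1" by (simp add: H)
  have "transpose ?H = transpose ?H ** (A ** ?H)" by (simp add: H)
  also have "\<dots> = (transpose ?H ** A) ** ?H" by (rule matrix_mul_assoc)
  also have "\<dots> = ?H" by (simp add: \<open>transpose ?H ** A = mat 1\<close>)
  finally have "transpose ?H $ i $ j = ?H $ i $ j" by simp
  then show ?thesis by (simp add: transpose_def)
qed

lemma smooth_on_matrix_inv: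
  fixes M :: "'a::real_normed_vector \<Rightarrow> real ^ 'n ^ 'n"
  assumes "open S" "\<And>i j. smooth_on S (\<lambda>z. M z $ i $ j)" "\<And>z. z \<in> S \<Longrightarrow> det (M z) \<noteq> 0"
  shows "smooth_on S (\<lambda>z. matrix_inv (M z) $ k $ l)"
proof (rule smooth_on_cong[OF assms(1)])
  have "smooth_on S (\<lambda>z. (\<chi> i j. if j = k then axis l 1 $ i else M z $ i $ j) $ i $ j)" for i j
    using assms(2)[of i j] by (cases "j = k") (simp_all add: smooth_on_const)
  then show "smooth_on S (\<lambda>z. det (\<chi> i j. if j = k then axis l 1 $ i else M z $ i $ j) / det (M z))"
    by (intro smooth_on_divide smooth_on_det assms)
  show "det (\<chi> i j. if j = k then axis l 1 $ i else M z $ i $ j) / det (M z) = matrix_inv (M z) $ k $ l"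
    if "z \<in> S" for z
    using matrix_inv_entry[OF assms(3)[OF that]] by simp
qed

text \<open>In the derivative of the Leibniz expansion one factor is removed from each product. A
  permutation other than the identity still leaves an off-diagonal factor, which is 0 at the
  identity matrix.\<close>

lemma permutes_UNIV_two_moved:
  fixes p :: "'n::finite \<Rightarrow> 'n"
  assumes "p permutes UNIV" "p \<noteq> id"
  shows "\<exists>j. j \<noteq> i \<and> p j \<noteq> j"
proof (rule ccontr)
  assume "\<not> ?thesis"
  then have fixed: "p j = j" if "j \<noteq> i" for j using that by auto
  have "p i = i"
  proof (rule ccontr)
    assume "p i \<noteq> i"
    then have "p (p i) = p i" by (rule fixed)
    then show False using \<open>p i \<noteq> i\<close> assms(1) by (metis permutes_inj injD)
  qed
  with fixed have "p = id" by (metis eq_id_iff)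
  with assms(2) show False by simp
qed

lemma has_derivative_det_at_mat_1:
  fixes C :: "'a::real_normed_vector \<Rightarrow> real ^ 'n ^ 'n"
  assumes C: "\<And>i j. ((\<lambda>z. C z $ i $ j) has_derivative C' i j) (at z)" and "C z = mat 1"
  shows "((\<lambda>z. det (C z)) has_derivative (\<lambda>v. \<Sum>i\<in>UNIV. C' i i v)) (at z)"
proof -
  let ?P = "{p. p permutes (UNIV :: 'n set)}"
  let ?t = "\<lambda>p v. of_int (sign p) * (\<Sum>i\<in>UNIV. C' i (p i) v * (\<Prod>j\<in>UNIV - {i}. C z $ j $ p j))"
  have "((\<lambda>z. det (C z)) has_derivative (\<lambda>v. \<Sum>p\<in>?P. ?t p v)) (at z)"
    unfolding det_def by (intro has_derivative_sum has_derivative_mult_right has_derivative_prod C)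
  moreover have "(\<Sum>p\<in>?P. ?t p v) = (\<Sum>i\<in>UNIV. C' i i v)" for v
  proof -
    have "?t p v = 0" if "p \<in> ?P - {id}" for p
    proof -
      have "(\<Prod>j\<in>UNIV - {i}. C z $ j $ p j) = 0" for i
      proof -
        have "p permutes UNIV" "p \<noteq> id" using that by blast+
        then obtain j where "j \<noteq> i" "p j \<noteq> j"
          using permutes_UNIV_two_moved[of p i] by blast
        then have "C z $ j $ p j = 0" by (simp add: assms(2) mat_def)
        with \<open>j \<noteq> i\<close> show ?thesis by (auto intro!: prod_zero)
      qed
      then show ?thesis by (simp only: mult_zero_right sum.neutral_const)
    qed
    then have "(\<Sum>p\<in>?P. ?t p v) = ?t id v"
      by (subst sum.mono_neutral_right[of ?P "{id}"]) (auto simp: permutes_id)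
    also have "(\<Prod>j\<in>UNIV - {i}. C z $ j $ id j) = 1" for i
      by (rule prod.neutral) (simp add: assms(2) mat_def)
    then have "?t id v = (\<Sum>i\<in>UNIV. C' i i v)"
      by (simp add: sign_id)
    finally show ?thesis .
  qed
  ultimately show ?thesis by simp
qed

text \<open>Multiplication by the inverse of \<open>G z\<close> reduces the formula to a matrix
  function that is the identity at \<open>z\<close>, where the derivative of the determinant is the
  trace.\<close>

lemma dir_deriv_det:
  fixes G :: "'a::real_normed_vector \<Rightarrow> real ^ 'n ^ 'n"
  assumes G: "\<And>i j. (\<lambda>z. G z $ i $ j) differentiable at z" and "det (G z) \<noteq> 0"
  shows "dir_deriv (\<lambda>z. det (G z)) z v =
    det (G z) * (\<Sum>i\<in>UNIV. \<Sum>j\<in>UNIV. matrix_inv (G z) $ i $ j * dir_deriv (\<lambda>z. G z $ j $ i) z v)"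
proof -
  let ?H = "matrix_inv (G z)"
  have inv: "invertible (G z)" using assms(2) by (simp add: invertible_det_nz)
  have eq: "det (G w) = det (G z) * det (?H ** G w)" for w
    using matrix_inv_right_left(1)[OF inv]
    by (metis det_mul matrix_mul_assoc matrix_mul_lid)
  have "((\<lambda>w. det (?H ** G w)) has_derivative
      (\<lambda>v. \<Sum>i\<in>UNIV. \<Sum>j\<in>UNIV. ?H $ i $ j * dir_deriv (\<lambda>z. G z $ j $ i) z v)) (at z)"
  proof (rule has_derivative_det_at_mat_1[where
        C' = "\<lambda>i k v. \<Sum>j\<in>UNIV. ?H $ i $ j * dir_deriv (\<lambda>z. G z $ j $ k) z v"])
    show "((\<lambda>w. (?H ** G w) $ i $ k) has_derivative
      (\<lambda>v. \<Sum>j\<in>UNIV. ?H $ i $ j * dir_deriv (\<lambda>z. G z $ j $ k) z v)) (at z)" for i k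
      unfolding matrix_matrix_mult_def
      by simp (intro has_derivative_sum has_derivative_mult_right dir_deriv_works G)
  qed (rule matrix_inv_right_left(2)[OF inv])
  then have "((\<lambda>w. det (G w)) has_derivative
      (\<lambda>v. det (G z) * (\<Sum>i\<in>UNIV. \<Sum>j\<in>UNIV. ?H $ i $ j * dir_deriv (\<lambda>z. G z $ j $ i) z v))) (at z)"
    by (subst eq) (rule has_derivative_mult_right)
  then show ?thesis by (rule dir_deriv_eqI)
qed

text \<open>All matrices on the segment to the identity are positive definite, hence invertible, so
  the determinant keeps the sign it has at the identity.\<close>

lemma det_pos_of_positive_definite:
  fixes A :: "real ^ 'n ^ 'n"
  assumes "\<And>v. v \<noteq> 0 \<Longrightarrow> v \<bullet> (A *v v) > 0"
  shows "det A > 0"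
proof (rule ccontr)
  assume neg: "\<not> det A > 0"
  define B where "B t = (1 - t) *\<^sub>R mat 1 + t *\<^sub>R A" for t
  have Bv: "B t *v v = (1 - t) *\<^sub>R v + t *\<^sub>R (A *v v)" for t v
    by (simp add: B_def matrix_vector_mult_add_rdistrib flip: scaleR_matrix_vector_assoc)
  have nz: "det (B t) \<noteq> 0" if "0 \<le> t" "t \<le> 1" for t
  proof
    assume "det (B t) = 0"
    then have "\<not> invertible (B t)" by (simp add: invertible_det_nz)
    then obtain v where v: "v \<noteq> 0" "B t *v v = 0"
      by (metis invertible_left_inverse matrix_left_invertible_ker)
    then have "0 = v \<bullet> (B t *v v)" by simp
    also have "\<dots> = (1 - t) * (v \<bullet> v) + t * (v \<bullet> (A *v v))"
      by (simp add: Bv inner_add_right)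
    also have "\<dots> > 0"
    proof (cases "t = 1")
      case False
      then have "(1 - t) * (v \<bullet> v) > 0" using that v by simp
      moreover have "t * (v \<bullet> (A *v v)) \<ge> 0" using that assms[OF v(1)] by simp
      ultimately show ?thesis by simp
    qed (use assms[OF v(1)] in simp)
    finally show False by simp
  qed
  have "continuous_on {0..1} (\<lambda>t. det (B t))"
    unfolding det_def B_def by (simp, intro continuous_intros)
  moreover have "B 0 = mat 1" "B 1 = A"
    by (simp_all add: B_def)
  moreover have "det A \<le> 0" using neg by simp
  ultimately obtain t where "0 \<le> t" "t \<le> 1" "det (B t) = 0"
    using IVT2'[of "\<lambda>t. det (B t)" 1 0 0] by auto
  with nz show False by blast
qed

section \<open>Homogeneous functions on the slit tangent bundle\<close>

lemma dir_deriv_sum_mult: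
  fixes f g :: "'i \<Rightarrow> 'a::real_normed_vector \<Rightarrow> real"
  assumes "\<And>i. i \<in> I \<Longrightarrow> f i differentiable at z" "\<And>i. i \<in> I \<Longrightarrow> g i differentiable at z"
  shows "dir_deriv (\<lambda>z. \<Sum>i\<in>I. f i z * g i z) z v =
    (\<Sum>i\<in>I. f i z * dir_deriv (g i) z v + dir_deriv (f i) z v * g i z)"
proof -
  have "(\<lambda>z. f i z * g i z) differentiable at z" if "i \<in> I" for i
    using assms[OF that] by (rule differentiable_mult)
  then have "dir_deriv (\<lambda>z. \<Sum>i\<in>I. f i z * g i z) z v = (\<Sum>i\<in>I. dir_deriv (\<lambda>z. f i z * g i z) z v)"
    by (rule dir_deriv_sum)
  then show ?thesis using assms by (simp add: dir_deriv_mult)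
qed

lemma d_x_fun: "d_x i f = (\<lambda>z. dir_deriv f z (axis i 1, 0))"
  by (simp add: fun_eq_iff d_x_def)

lemma d_y_fun: "d_y i f = (\<lambda>z. dir_deriv f z (0, axis i 1))"
  by (simp add: fun_eq_iff d_y_def)

lemma smooth_on_d_x: "smooth_on T f \<Longrightarrow> smooth_on T (d_x i f)"
  unfolding d_x_fun by (rule smooth_on_dir_deriv)

lemma smooth_on_d_y: "smooth_on T f \<Longrightarrow> smooth_on T (d_y i f)"
  unfolding d_y_fun by (rule smooth_on_dir_deriv)

lemma d_y_cong_open:
  "open T \<Longrightarrow> z \<in> T \<Longrightarrow> (\<And>w. w \<in> T \<Longrightarrow> f w = g w) \<Longrightarrow> d_y i f z = d_y i g z"
  unfolding d_y_def by (rule dir_deriv_cong_open)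

lemma d_x_cong_open:
  "open T \<Longrightarrow> z \<in> T \<Longrightarrow> (\<And>w. w \<in> T \<Longrightarrow> f w = g w) \<Longrightarrow> d_x i f z = d_x i g z"
  unfolding d_x_def by (rule dir_deriv_cong_open)

lemma d_y_commute:
  "open T \<Longrightarrow> smooth_on T f \<Longrightarrow> z \<in> T \<Longrightarrow> d_y i (d_y j f) z = d_y j (d_y i f) z"
  unfolding d_y_fun by (rule dir_deriv_commute)

lemma d_x_d_y_commute:
  "open T \<Longrightarrow> smooth_on T f \<Longrightarrow> z \<in> T \<Longrightarrow> d_x i (d_y j f) z = d_y j (d_x i f) z"
  unfolding d_y_fun d_x_fun by (rule dir_deriv_commute)

lemma dir_deriv_tm:
  fixes f :: "'n::finite tm \<Rightarrow> real"
  assumes "f differentiable at z"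
  shows "dir_deriv f z V = (\<Sum>i\<in>UNIV. fst V $ i * d_x i f z) + (\<Sum>i\<in>UNIV. snd V $ i * d_y i f z)"
proof -
  interpret linear "dir_deriv f z" by (rule dir_deriv_linear[OF assms])
  have V: "V = (\<Sum>i\<in>UNIV. fst V $ i *\<^sub>R (axis i 1, 0)) + (\<Sum>i\<in>UNIV. snd V $ i *\<^sub>R (0, axis i 1))"
  proof (rule prod_eqI)
    have *: "(\<Sum>i\<in>UNIV. v $ i *\<^sub>R axis i 1) = v" for v :: "real ^ 'n"
      using basis_expansion[of v] by (simp add: scalar_mult_eq_scaleR)
    show "fst V = fst ((\<Sum>i\<in>UNIV. fst V $ i *\<^sub>R (axis i 1, 0 :: real ^ 'n)) +
        (\<Sum>i\<in>UNIV. snd V $ i *\<^sub>R (0 :: real ^ 'n, axis i 1)))"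
      by (simp add: fst_sum *)
    show "snd V = snd ((\<Sum>i\<in>UNIV. fst V $ i *\<^sub>R (axis i 1, 0 :: real ^ 'n)) +
        (\<Sum>i\<in>UNIV. snd V $ i *\<^sub>R (0 :: real ^ 'n, axis i 1)))"
      by (simp add: snd_sum *)
  qed
  have "dir_deriv f z V = dir_deriv f z
    ((\<Sum>i\<in>UNIV. fst V $ i *\<^sub>R (axis i 1, 0)) + (\<Sum>i\<in>UNIV. snd V $ i *\<^sub>R (0, axis i 1)))"
    using V by simp
  then show ?thesis
    by (simp only: add sum scaleR d_x_def d_y_def real_scaleR_def)
qed

text \<open>The degree is an integer because vertical derivatives lower it, down to -1 for the
  Hessian of a function of degree 1.\<close>

definition homog_on :: "'n::finite tm set \<Rightarrow> int \<Rightarrow> ('n tm \<Rightarrow> 'b::real_normed_vector) \<Rightarrow> bool" where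
  "homog_on T r f \<longleftrightarrow> (\<forall>x y t. (x, y) \<in> T \<longrightarrow> t > 0 \<longrightarrow> f (x, t *\<^sub>R y) = (t powi r) *\<^sub>R f (x, y))"

lemma homog_onD: "homog_on T r f \<Longrightarrow> (x, y) \<in> T \<Longrightarrow> t > 0 \<Longrightarrow> f (x, t *\<^sub>R y) = (t powi r) *\<^sub>R f (x, y)"
  by (simp add: homog_on_def)

lemma conic_openD:
  assumes "conic_open T"
  shows "open T" "(x, y) \<in> T \<Longrightarrow> t > 0 \<Longrightarrow> (x, t *\<^sub>R y) \<in> T" "(x, y) \<in> T \<Longrightarrow> y \<noteq> 0"
  using assms by (auto simp: conic_open_def)

text \<open>The homogeneity relation is differentiated through the fibre dilation \<open>D\<close>;
  the chain rule rescales the vertical part of the direction as well.\<close>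

lemma homog_on_dir_deriv:
  fixes f :: "'n::finite tm \<Rightarrow> 'b::real_normed_vector"
  assumes T: "conic_open T" and f: "homog_on T r f" "smooth_on T f" and z: "(x, y) \<in> T" "t > 0"
  shows "dir_deriv f (x, t *\<^sub>R y) (a, t *\<^sub>R b) = (t powi r) *\<^sub>R dir_deriv f (x, y) (a, b)"
proof -
  define D :: "'n tm \<Rightarrow> 'n tm" where "D = (\<lambda>z. (fst z, t *\<^sub>R snd z))"
  have D: "bounded_linear D"
    unfolding D_def by (intro bounded_linear_intros)
  have "(f has_derivative dir_deriv f (D (x, y))) (at (D (x, y)))"
    using smooth_on_has_derivative[OF f(2)] conic_openD(2)[OF T z] by (simp add: D_def)
  from diff_chain_at[OF bounded_linear_imp_has_derivative[OF D] this]
  have "dir_deriv (\<lambda>z. f (D z)) (x, y) (a, b) = dir_deriv f (D (x, y)) (D (a, b))"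
    by (intro dir_deriv_eqI) (simp add: o_def)
  moreover have "dir_deriv (\<lambda>z. f (D z)) (x, y) (a, b) = dir_deriv (\<lambda>z. (t powi r) *\<^sub>R f z) (x, y) (a, b)"
    by (rule dir_deriv_cong_open[OF conic_openD(1)[OF T] z(1)])
      (use homog_onD[OF f(1) _ z(2)] in \<open>auto simp: D_def\<close>)
  moreover have "dir_deriv (\<lambda>z. (t powi r) *\<^sub>R f z) (x, y) (a, b) = (t powi r) *\<^sub>R dir_deriv f (x, y) (a, b)"
    by (rule dir_deriv_eqI, rule has_derivative_scaleR_right, rule smooth_on_has_derivative[OF f(2) z(1)])
  ultimately show ?thesis by (simp add: D_def)
qed

lemma homog_on_d_x:
  assumes "conic_open T" "homog_on T r f" "smooth_on T f"
  shows "homog_on T r (d_x i f)"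
  unfolding homog_on_def
proof (intro allI impI)
  fix x y t assume "(x, y) \<in> T" "(t::real) > 0"
  from homog_on_dir_deriv[OF assms this, of "axis i 1" 0]
  show "d_x i f (x, t *\<^sub>R y) = (t powi r) *\<^sub>R d_x i f (x, y)" by (simp add: d_x_def)
qed

lemma homog_on_d_y:
  assumes "conic_open T" "homog_on T r f" "smooth_on T f"
  shows "homog_on T (r - 1) (d_y i f)"
  unfolding homog_on_def
proof (intro allI impI)
  fix x y t assume xy: "(x, y) \<in> T" "(t::real) > 0"
  interpret linear "dir_deriv f (x, y)"
    by (rule dir_deriv_linear[OF smooth_on_differentiable[OF assms(3) xy(1)]])
  have "d_y i f (x, t *\<^sub>R y) = dir_deriv f (x, t *\<^sub>R y) (0, t *\<^sub>R (inverse t *\<^sub>R axis i 1))"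
    using xy(2) by (simp add: d_y_def)
  also have "\<dots> = (t powi r) * dir_deriv f (x, y) (0, inverse t *\<^sub>R axis i 1)"
    using homog_on_dir_deriv[OF assms xy, of 0 "inverse t *\<^sub>R axis i 1"]
    by (simp only: scaleR_zero_right real_scaleR_def)
  also have "(0, inverse t *\<^sub>R axis i 1) = inverse t *\<^sub>R (0 :: real ^ 'a, axis i 1)"
    by simp
  also have "dir_deriv f (x, y) \<dots> = inverse t * d_y i f (x, y)"
    by (simp only: scaleR d_y_def real_scaleR_def)
  also have "t powi r * (inverse t * d_y i f (x, y)) = (t powi (r - 1)) *\<^sub>R d_y i f (x, y)"
    using xy(2) by (simp add: power_int_diff divide_inverse)
  finally show "d_y i f (x, t *\<^sub>R y) = (t powi (r - 1)) *\<^sub>R d_y i f (x, y)" .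
qed

lemma homog_on_euler:
  fixes f :: "'n::finite tm \<Rightarrow> 'b::real_normed_vector"
  assumes T: "conic_open T" and f: "homog_on T r f" "smooth_on T f" and z: "(x, y) \<in> T"
  shows "dir_deriv f (x, y) (0, y) = of_int r *\<^sub>R f (x, y)"
proof -
  have "((\<lambda>s. (x, s *\<^sub>R y)) has_derivative (\<lambda>s. (0, s *\<^sub>R y))) (at (1::real))"
    by (intro has_derivative_Pair has_derivative_const) (auto intro!: derivative_eq_intros)
  from diff_chain_at[OF this, of f "dir_deriv f (x, y)"]
  have "((\<lambda>s. f (x, s *\<^sub>R y)) has_derivative (\<lambda>s. dir_deriv f (x, y) (0, s *\<^sub>R y))) (at (1::real))"
    using smooth_on_has_derivative[OF f(2) z] by (simp add: o_def)
  from dir_deriv_eqI[OF this, of 1]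
  have "dir_deriv (\<lambda>s. f (x, s *\<^sub>R y)) (1::real) 1 = dir_deriv f (x, y) (0, y)"
    by simp
  moreover have "dir_deriv (\<lambda>s. f (x, s *\<^sub>R y)) (1::real) 1 =
      dir_deriv (\<lambda>s. (s powi r) *\<^sub>R f (x, y)) (1::real) 1"
    by (rule dir_deriv_cong_open[of "{0<..}"]) (use homog_onD[OF f(1) z] in auto)
  moreover have "((\<lambda>s::real. s powi r) has_real_derivative of_int r) (at 1)"
    by (auto intro!: derivative_eq_intros)
  then have "((\<lambda>s. (s powi r) *\<^sub>R f (x, y)) has_derivative (\<lambda>s. (of_int r * s) *\<^sub>R f (x, y))) (at (1::real))"
    unfolding has_field_derivative_def by (rule has_derivative_scaleR_left)
  from dir_deriv_eqI[OF this, of 1]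
  have "dir_deriv (\<lambda>s. (s powi r) *\<^sub>R f (x, y)) (1::real) 1 = of_int r *\<^sub>R f (x, y)"
    by simp
  ultimately show ?thesis by simp
qed

lemma homog_on_euler_sum:
  fixes f :: "'n::finite tm \<Rightarrow> real"
  assumes T: "conic_open T" and f: "homog_on T r f" "smooth_on T f" and z: "z \<in> T"
  shows "(\<Sum>k\<in>UNIV. snd z $ k * d_y k f z) = of_int r * f z"
  using homog_on_euler[OF T f, of "fst z" "snd z"] z
    dir_deriv_tm[OF smooth_on_differentiable[OF f(2) z], of "(0, snd z)"] by simp

lemma homog_on_mult:
  fixes f g :: "'n::finite tm \<Rightarrow> real"
  assumes "homog_on T r f" "homog_on T s g" "r + s = q"
  shows "homog_on T q (\<lambda>z. f z * g z)"
  using assms unfolding homog_on_def by (auto simp: power_int_add)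

lemma homog_on_sum:
  "(\<And>i. i \<in> I \<Longrightarrow> homog_on T r (f i)) \<Longrightarrow> homog_on T r (\<lambda>z. \<Sum>i\<in>I. f i z)"
  unfolding homog_on_def by (auto simp: scaleR_sum_right intro!: sum.cong)

lemma homog_on_diff:
  "homog_on T r f \<Longrightarrow> homog_on T r g \<Longrightarrow> homog_on T r (\<lambda>z. f z - g z)"
  unfolding homog_on_def by (auto simp: scaleR_diff_right)

lemma homog_on_add:
  "homog_on T r f \<Longrightarrow> homog_on T r g \<Longrightarrow> homog_on T r (\<lambda>z. f z + g z)"
  unfolding homog_on_def by (auto simp: scaleR_add_right)

lemma homog_on_cmult:
  fixes f :: "'n::finite tm \<Rightarrow> real"
  shows "homog_on T r f \<Longrightarrow> homog_on T r (\<lambda>z. c * f z)"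
  unfolding homog_on_def by (auto simp: mult.left_commute)

lemma homog_on_snd: "homog_on T 1 (\<lambda>z::'n::finite tm. snd z $ k)"
  by (simp add: homog_on_def)

lemma smooth_on_snd_nth: "open T \<Longrightarrow> smooth_on T (\<lambda>z::'n::finite tm. snd z $ k)"
  by (intro smooth_on_vec_nth smooth_on_snd)

lemma d_y_snd: "d_y j (\<lambda>z. snd z $ k) z = (if j = k then 1 else 0)"
proof -
  have "bounded_linear (\<lambda>z :: 'a tm. snd z $ k)"
    by (rule bounded_linear_compose[OF bounded_linear_vec_nth bounded_linear_snd])
  then show ?thesis by (simp add: d_y_def dir_deriv_bounded_linear axis_def)
qed

section \<open>Local geometry of a Finsler structure\<close>

text \<open>\<open>S\<close> stands for the image of one chart; compatibility between charts enters
  only through \<open>exp_rho_transform\<close>.\<close>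

locale finsler_chart =
  fixes S :: "(real ^ 'n::finite) set" and F :: "'n tm \<Rightarrow> real"
  assumes open_S: "open S"
    and F_cont: "continuous_on (S \<times> UNIV) F"
    and F_smooth: "smooth_on (S \<times> (- {0})) F"
    and F_nonneg: "x \<in> S \<Longrightarrow> F (x, y) \<ge> 0"
    and F_scale: "x \<in> S \<Longrightarrow> t > 0 \<Longrightarrow> F (x, t *\<^sub>R y) = t * F (x, y)"
    and pos_def: "x \<in> S \<Longrightarrow> y \<noteq> 0 \<Longrightarrow> v \<noteq> 0 \<Longrightarrow> v \<bullet> (g_mat F (x, y) *v v) > 0"
begin

abbreviation "T \<equiv> S \<times> (- {0 :: real ^ 'n})"

abbreviation "E \<equiv> F_sq F"

abbreviation "g i j z \<equiv> g_mat F z $ i $ j"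

abbreviation "gi i j z \<equiv> matrix_inv (g_mat F z) $ i $ j"

text \<open>\<open>lam\<close>, \<open>h\<close> and \<open>trN\<close> are the \<lambda>, the h_k
  and the \<Pi> of the overview; \<open>del k\<close> is the horizontal derivation
  \<delta>/\<delta>x^k.\<close>

definition "lam z = ln (det (g_mat F z)) / 2"

definition "del k f z = d_x k f z - (\<Sum>r\<in>UNIV. N_coeff F r k z * d_y r f z)"

definition "h k = del k lam"

definition "trN z = (\<Sum>m\<in>UNIV. N_coeff F m m z)"

lemma conic_T: "conic_open T"
proof -
  have "open T" by (intro open_Times open_S open_Compl) auto
  then show ?thesis by (auto simp: conic_open_def)
qed

lemma open_T: "open T"
  using conic_T by (rule conic_openD)

lemma F_homog: "homog_on T 1 F"
  using F_scale by (auto simp: homog_on_def)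

lemma E_smooth: "smooth_on T E"
proof -
  have "E = (\<lambda>z. F z * F z)" by (simp add: fun_eq_iff F_sq_def power2_eq_square)
  then show ?thesis by (simp add: smooth_on_mult open_T F_smooth)
qed

lemma E_homog: "homog_on T 2 E"
  using F_scale by (auto simp: homog_on_def F_sq_def power_mult_distrib)

lemma g_eq: "g i j z = 1/2 * d_y j (d_y i E) z"
  by (simp add: g_mat_def)

lemma g_smooth: "smooth_on T (g i j)"
  unfolding g_eq by (intro smooth_on_mult smooth_on_const smooth_on_d_y E_smooth open_T)

lemma g_homog: "homog_on T 0 (g i j)"
proof -
  have "homog_on T (2 - 1 - 1) (d_y j (d_y i E))"
    by (intro homog_on_d_y conic_T E_smooth E_homog smooth_on_d_y)
  then show ?thesis unfolding g_eq by (intro homog_on_cmult) simp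
qed

lemma g_mat_scale: "z \<in> T \<Longrightarrow> t > 0 \<Longrightarrow> g_mat F (fst z, t *\<^sub>R snd z) = g_mat F z"
  using homog_onD[OF g_homog, of "fst z" "snd z" t] by (simp add: vec_eq_iff mem_Times_iff)

lemma g_sym: "z \<in> T \<Longrightarrow> g i j z = g j i z"
  unfolding g_eq using d_y_commute[OF open_T E_smooth] by simp

lemma g_transpose: "z \<in> T \<Longrightarrow> transpose (g_mat F z) = g_mat F z"
  using g_sym by (simp add: transpose_def vec_eq_iff)

lemma det_g_pos: "z \<in> T \<Longrightarrow> det (g_mat F z) > 0"
  by (cases z) (auto intro!: det_pos_of_positive_definite pos_def)

lemma invertible_g: "z \<in> T \<Longrightarrow> invertible (g_mat F z)"
  using det_g_pos[of z] by (simp add: invertible_det_nz)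

lemma g_gi: "z \<in> T \<Longrightarrow> (\<Sum>k\<in>UNIV. g i k z * gi k j z) = (if i = j then 1 else 0)"
  using matrix_mult_entry_sum[OF matrix_inv_right_left(1)[OF invertible_g]] by (simp add: mat_def)

lemma gi_g: "z \<in> T \<Longrightarrow> (\<Sum>k\<in>UNIV. gi i k z * g k j z) = (if i = j then 1 else 0)"
  using matrix_mult_entry_sum[OF matrix_inv_right_left(2)[OF invertible_g]] by (simp add: mat_def)

lemma gi_sym: "z \<in> T \<Longrightarrow> gi i j z = gi j i z"
  by (rule matrix_inv_symmetric[OF invertible_g g_transpose])

lemma gi_smooth: "smooth_on T (gi i j)"
  using det_g_pos by (intro smooth_on_matrix_inv open_T g_smooth) force

lemma gi_homog: "homog_on T 0 (gi i j)"
  using g_mat_scale by (fastforce simp: homog_on_def)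

lemma det_g_smooth: "smooth_on T (\<lambda>z. det (g_mat F z))"
  by (intro smooth_on_det open_T g_smooth)

lemma lam_smooth: "smooth_on T lam"
proof -
  have "lam = (\<lambda>z. ln (det (g_mat F z)) / 2)" by (simp add: lam_def fun_eq_iff)
  then show ?thesis
    using det_g_pos by (auto intro!: smooth_on_divide smooth_on_ln smooth_on_const det_g_smooth open_T)
qed

lemma lam_homog: "homog_on T 0 lam"
  using g_mat_scale by (fastforce simp: homog_on_def lam_def)

lemma dir_deriv_lam:
  assumes "z \<in> T"
  shows "dir_deriv lam z v = 1/2 * (\<Sum>i\<in>UNIV. \<Sum>j\<in>UNIV. gi i j z * dir_deriv (g j i) z v)"
proof -
  have "((\<lambda>z. ln (det (g_mat F z)) / 2) has_derivative
      (\<lambda>v. inverse (det (g_mat F z)) * dir_deriv (\<lambda>z. det (g_mat F z)) z v / 2)) (at z)"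
    using has_derivative_divide[OF diff_chain_at[OF smooth_on_has_derivative[OF det_g_smooth assms]
        DERIV_ln[OF det_g_pos[OF assms], unfolded has_field_derivative_def]] has_derivative_const[of 2]]
    by (simp add: o_def)
  then have "dir_deriv lam z v = inverse (det (g_mat F z)) * dir_deriv (\<lambda>z. det (g_mat F z)) z v / 2"
    unfolding lam_def[abs_def] by (rule dir_deriv_eqI)
  moreover have "dir_deriv (\<lambda>z. det (g_mat F z)) z v = det (g_mat F z) *
      (\<Sum>i\<in>UNIV. \<Sum>j\<in>UNIV. gi i j z * dir_deriv (g j i) z v)"
    using det_g_pos[OF assms] smooth_on_differentiable[OF g_smooth assms]
    by (intro dir_deriv_det) auto
  ultimately show ?thesis using det_g_pos[OF assms] by simp
qed

lemma d_y_g: "z \<in> T \<Longrightarrow> d_y k (g i j) z = 1/2 * d_y k (d_y j (d_y i E)) z"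
  unfolding g_eq d_y_def[of k]
  by (intro dir_deriv_cmult smooth_on_differentiable[OF smooth_on_d_y[OF smooth_on_d_y[OF E_smooth]]])

text \<open>The total symmetry of the Cartan tensor, as third derivatives of F^2 commute. The
  cancellations in \<open>sum_y_h\<close> and \<open>divergence_X\<close> rest on it.\<close>

lemma d_y_g_sym:
  assumes "z \<in> T"
  shows "d_y k (g i j) z = d_y j (g i k) z" "d_y k (g i j) z = d_y k (g j i) z"
proof -
  show "d_y k (g i j) z = d_y j (g i k) z"
    unfolding d_y_g[OF assms] using d_y_commute[OF open_T smooth_on_d_y[OF E_smooth] assms] by simp
  show "d_y k (g i j) z = d_y k (g j i) z"
    by (rule d_y_cong_open[OF open_T assms g_sym])
qed

lemma g_y: "z \<in> T \<Longrightarrow> (\<Sum>j\<in>UNIV. g i j z * snd z $ j) = 1/2 * d_y i E z"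
  using homog_on_euler_sum[OF conic_T homog_on_d_y[OF conic_T E_homog E_smooth, of i]
      smooth_on_d_y[OF E_smooth]]
  unfolding g_eq by (simp add: mult.commute flip: sum_divide_distrib)

lemma F_sq_eq: "z \<in> T \<Longrightarrow> snd z \<bullet> (g_mat F z *v snd z) = E z"
  using homog_on_euler_sum[OF conic_T E_homog E_smooth]
  by (simp add: inner_vec_def matrix_vector_mult_def g_y flip: sum_divide_distrib)

text \<open>F^2 = g(y, y) by Euler's relation and g is positive definite; the structure itself
  provides only F \<ge> 0.\<close>

lemma F_pos: "z \<in> T \<Longrightarrow> F z > 0"
  using F_sq_eq[of z] pos_def[of "fst z" "snd z" "snd z"] F_nonneg[of "fst z" "snd z"]
  by (auto simp: F_sq_def less_le)

section \<open>The spray, the nonlinear connection and horizontal derivatives\<close>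

lemma spray_fun: "spray F i = (\<lambda>z. 1/4 * (\<Sum>l\<in>UNIV. gi i l z *
     ((\<Sum>k\<in>UNIV. d_y l (d_x k E) z * snd z $ k) - d_x l E z)))"
  by (simp add: spray_def fun_eq_iff)

lemma spray_smooth: "smooth_on T (spray F i)"
  unfolding spray_fun
  by (intro smooth_on_mult smooth_on_const smooth_on_sum smooth_on_diff gi_smooth
      smooth_on_d_y smooth_on_d_x smooth_on_snd_nth E_smooth open_T)

lemma spray_homog: "homog_on T 2 (spray F i)"
proof -
  have "homog_on T 2 (\<lambda>z. gi i l z *
     ((\<Sum>k\<in>UNIV. d_y l (d_x k E) z * snd z $ k) - d_x l E z))" for l
  proof (rule homog_on_mult[OF gi_homog])
    have 1: "homog_on T (2 - 1) (d_y l (d_x k E))" for k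
      by (intro homog_on_d_y homog_on_d_x conic_T E_homog E_smooth smooth_on_d_x)
    have "homog_on T 2 (\<lambda>z. d_y l (d_x k E) z * snd z $ k)" for k
      by (rule homog_on_mult[OF 1 homog_on_snd]) simp
    then show "homog_on T 2 (\<lambda>z. (\<Sum>k\<in>UNIV. d_y l (d_x k E) z * snd z $ k) - d_x l E z)"
      by (intro homog_on_diff homog_on_sum homog_on_d_x conic_T E_homog E_smooth)
  qed simp
  then show ?thesis
    unfolding spray_fun by (intro homog_on_cmult homog_on_sum)
qed

lemma N_fun: "N_coeff F i k = d_y k (spray F i)"
  by (simp add: N_coeff_def fun_eq_iff)

lemma N_smooth: "smooth_on T (N_coeff F i k)"
  unfolding N_fun by (intro smooth_on_d_y spray_smooth)

lemma N_homog: "homog_on T 1 (N_coeff F i k)"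
  using homog_on_d_y[OF conic_T spray_homog spray_smooth] by (simp add: N_fun)

lemma N_y: "z \<in> T \<Longrightarrow> (\<Sum>k\<in>UNIV. snd z $ k * N_coeff F i k z) = 2 * spray F i z"
  using homog_on_euler_sum[OF conic_T spray_homog spray_smooth] by (simp add: N_fun)

lemma trN_smooth: "smooth_on T trN"
  unfolding trN_def[abs_def] by (intro smooth_on_sum N_smooth open_T)

lemma trN_homog: "homog_on T 1 trN"
  unfolding trN_def[abs_def] by (intro homog_on_sum N_homog)

lemma dir_deriv_del:
  assumes f: "smooth_on T f" and z: "z \<in> T"
  shows "dir_deriv f z V = (\<Sum>k\<in>UNIV. del k f z * fst V $ k) + (\<Sum>k\<in>UNIV. d_y k f z * delta_y F k z V)"
proof -
  have "(\<Sum>k\<in>UNIV. d_y k f z * (\<Sum>l\<in>UNIV. N_coeff F k l z * fst V $ l)) =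
     (\<Sum>l\<in>UNIV. (\<Sum>k\<in>UNIV. N_coeff F k l z * d_y k f z) * fst V $ l)"
    unfolding sum_distrib_left sum_distrib_right by (subst sum.swap) (simp add: mult_ac)
  then show ?thesis
    unfolding dir_deriv_tm[OF smooth_on_differentiable[OF f z]]
    by (simp add: delta_y_def del_def distrib_left left_diff_distrib right_diff_distrib
        sum.distrib sum_subtractf mult.commute)
qed

lemma del_smooth: "smooth_on T f \<Longrightarrow> smooth_on T (del k f)"
  unfolding del_def[abs_def]
  by (intro smooth_on_diff smooth_on_sum smooth_on_mult smooth_on_d_x smooth_on_d_y N_smooth open_T)

lemma del_homog:
  assumes "smooth_on T f" "homog_on T 0 f"
  shows "homog_on T 0 (del k f)"
proof -
  have "homog_on T 0 (\<lambda>z. N_coeff F r k z * d_y r f z)" for r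
    by (rule homog_on_mult[OF N_homog homog_on_d_y[OF conic_T assms(2,1)]]) simp
  then show ?thesis
    unfolding del_def[abs_def] by (intro homog_on_diff homog_on_sum homog_on_d_x conic_T assms)
qed

lemma h_smooth: "smooth_on T (h k)"
  unfolding h_def by (intro del_smooth lam_smooth)

lemma h_homog: "homog_on T 0 (h k)"
  unfolding h_def by (intro del_homog lam_smooth lam_homog)

lemma d_y_lam:
  assumes "z \<in> T"
  shows "(\<Sum>i\<in>UNIV. \<Sum>j\<in>UNIV. gi i j z * d_y k (g j i) z) = 2 * d_y k lam z"
  by (simp add: d_y_def dir_deriv_lam[OF assms])

lemma d_x_lam:
  assumes "z \<in> T"
  shows "(\<Sum>i\<in>UNIV. \<Sum>j\<in>UNIV. gi i j z * d_x k (g j i) z) = 2 * d_x k lam z"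
  by (simp add: d_x_def dir_deriv_lam[OF assms])

text \<open>The definition of the spray with its index lowered; in this form it can be
  differentiated in y without derivatives of the inverse matrix.\<close>

lemma g_spray:
  assumes "z \<in> T"
  shows "(\<Sum>i\<in>UNIV. g l i z * spray F i z) =
    1/4 * ((\<Sum>k\<in>UNIV. snd z $ k * d_y l (d_x k E) z) - d_x l E z)"
proof -
  define B where "B l = 1/4 * ((\<Sum>k\<in>UNIV. snd z $ k * d_y l (d_x k E) z) - d_x l E z)" for l
  have "spray F i z = (\<Sum>k\<in>UNIV. gi i k z * B k)" for i
    by (simp add: spray_def B_def sum_distrib_left mult.commute mult.left_commute)
  then have "(\<Sum>i\<in>UNIV. g l i z * spray F i z) = (\<Sum>i\<in>UNIV. \<Sum>k\<in>UNIV. g l i z * gi i k z * B k)"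
    by (simp add: sum_distrib_left mult.assoc)
  also have "\<dots> = (\<Sum>k\<in>UNIV. (\<Sum>i\<in>UNIV. g l i z * gi i k z) * B k)"
    by (subst sum.swap) (simp add: sum_distrib_right)
  also have "\<dots> = B l"
    by (simp add: g_gi[OF assms] if_distrib[of "\<lambda>c. c * _"] cong: if_cong)
  finally show ?thesis by (simp only: B_def)
qed

lemma d_x_g: "z \<in> T \<Longrightarrow> d_x k (g i j) z = 1/2 * d_y j (d_y i (d_x k E)) z"
proof -
  assume z: "z \<in> T"
  have "d_x k (g i j) z = 1/2 * d_x k (d_y j (d_y i E)) z"
    unfolding g_eq d_x_def[of k] using smooth_on_differentiable[OF _ z] E_smooth
    by (intro dir_deriv_cmult) (auto intro: smooth_on_d_y)
  also have "d_x k (d_y j (d_y i E)) z = d_y j (d_x k (d_y i E)) z"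
    by (intro d_x_d_y_commute[OF open_T _ z] smooth_on_d_y E_smooth)
  also have "\<dots> = d_y j (d_y i (d_x k E)) z"
    by (rule d_y_cong_open[OF open_T z d_x_d_y_commute[OF open_T E_smooth]])
  finally show ?thesis .
qed

text \<open>The Euler--Lagrange identity \<open>\<G>(ln \<surd>det g) = \<partial>G\<^sup>m/\<partial>y\<^sup>m\<close>, the trace of the
  \<open>y\<close>-derivative of the equation defining the spray.\<close>

lemma sum_y_h:
  assumes z: "z \<in> T"
  shows "(\<Sum>k\<in>UNIV. snd z $ k * h k z) = trN z"
proof -
  note diff = smooth_on_differentiable[OF _ z]
  \<comment> \<open>The y^j derivative of \<open>g_spray\<close>. The derivative of the factor y^k
    yields the first of the two mixed derivatives of \<open>E\<close>.\<close>
  have *: "(\<Sum>i\<in>UNIV. g l i z * N_coeff F i j z + d_y j (g l i) z * spray F i z) =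
    1/4 * ((\<Sum>k\<in>UNIV. snd z $ k * (2 * d_x k (g l j) z))
      + d_y l (d_x j E) z - d_y j (d_x l E) z)" for j l
  proof -
    have "d_y j (\<lambda>z. \<Sum>i\<in>UNIV. g l i z * spray F i z) z =
        d_y j (\<lambda>z. 1/4 * ((\<Sum>k\<in>UNIV. snd z $ k * d_y l (d_x k E) z) - d_x l E z)) z"
      by (rule d_y_cong_open[OF open_T z g_spray])
    moreover have "d_y j (\<lambda>z. \<Sum>i\<in>UNIV. g l i z * spray F i z) z =
        (\<Sum>i\<in>UNIV. g l i z * N_coeff F i j z + d_y j (g l i) z * spray F i z)"
      unfolding d_y_def N_coeff_def
      by (rule dir_deriv_sum_mult) (use diff g_smooth spray_smooth in blast)+
    moreover have "d_y j (\<lambda>z. 1/4 * ((\<Sum>k\<in>UNIV. snd z $ k * d_y l (d_x k E) z) - d_x l E z)) z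
       = 1/4 * ((\<Sum>k\<in>UNIV. snd z $ k * d_y j (d_y l (d_x k E)) z + d_y j (\<lambda>z. snd z $ k) z * d_y l (d_x k E) z)
           - d_y j (d_x l E) z)"
    proof -
      have s: "smooth_on T (\<lambda>z. \<Sum>k\<in>UNIV. snd z $ k * d_y l (d_x k E) z)"
        by (intro smooth_on_sum smooth_on_mult smooth_on_snd_nth smooth_on_d_y smooth_on_d_x E_smooth open_T)
      have s2: "smooth_on T (\<lambda>z. (\<Sum>k\<in>UNIV. snd z $ k * d_y l (d_x k E) z) - d_x l E z)"
        by (intro smooth_on_diff s smooth_on_d_x E_smooth open_T)
      have "d_y j (\<lambda>z. \<Sum>k\<in>UNIV. snd z $ k * d_y l (d_x k E) z) z =
        (\<Sum>k\<in>UNIV. snd z $ k * d_y j (d_y l (d_x k E)) z + d_y j (\<lambda>z. snd z $ k) z * d_y l (d_x k E) z)"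
        unfolding d_y_def[of j]
        by (rule dir_deriv_sum_mult)
          (use diff smooth_on_snd_nth[OF open_T] smooth_on_d_y smooth_on_d_x E_smooth in blast)+
      moreover have "d_y j (\<lambda>z. (\<Sum>k\<in>UNIV. snd z $ k * d_y l (d_x k E) z) - d_x l E z) z =
         d_y j (\<lambda>z. \<Sum>k\<in>UNIV. snd z $ k * d_y l (d_x k E) z) z - d_y j (d_x l E) z"
        unfolding d_y_def[of j]
        by (rule dir_deriv_diff) (use diff s smooth_on_d_x E_smooth in blast)+
      moreover have "d_y j (\<lambda>z. 1/4 * ((\<Sum>k\<in>UNIV. snd z $ k * d_y l (d_x k E) z) - d_x l E z)) z
        = 1/4 * d_y j (\<lambda>z. (\<Sum>k\<in>UNIV. snd z $ k * d_y l (d_x k E) z) - d_x l E z) z"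
        unfolding d_y_def[of j] by (rule dir_deriv_cmult[OF diff[OF s2]])
      ultimately show ?thesis by simp
    qed
    ultimately show ?thesis
      by (simp add: d_x_g[OF z] d_y_snd sum.distrib if_distrib[of "\<lambda>c. c * _"] cong: if_cong)
  qed
  have "(\<Sum>j\<in>UNIV. \<Sum>l\<in>UNIV. gi j l z * (\<Sum>i\<in>UNIV. g l i z * N_coeff F i j z)) =
      (\<Sum>j\<in>UNIV. \<Sum>i\<in>UNIV. (\<Sum>l\<in>UNIV. gi j l z * g l i z) * N_coeff F i j z)"
    by (simp add: sum_distrib_left sum_distrib_right mult.assoc) (intro sum.cong refl sum.swap)
  also have "\<dots> = trN z"
    by (simp add: gi_g[OF z] trN_def if_distrib[of "\<lambda>c. c * _"] cong: if_cong)
  finally have 1: "(\<Sum>j\<in>UNIV. \<Sum>l\<in>UNIV. gi j l z * (\<Sum>i\<in>UNIV. g l i z * N_coeff F i j z)) = trN z" .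
  \<comment> \<open>Total symmetry moves the differentiation index onto the spray, so that the
    contraction with g^-1 becomes a derivative of \<lambda>.\<close>
  have "(\<Sum>j\<in>UNIV. \<Sum>l\<in>UNIV. gi j l z * (\<Sum>i\<in>UNIV. d_y j (g l i) z * spray F i z)) =
      (\<Sum>i\<in>UNIV. (\<Sum>j\<in>UNIV. \<Sum>l\<in>UNIV. gi j l z * d_y i (g l j) z) * spray F i z)"
  proof -
    have "(\<Sum>j\<in>UNIV. \<Sum>l\<in>UNIV. gi j l z * (\<Sum>i\<in>UNIV. d_y j (g l i) z * spray F i z)) =
      (\<Sum>j\<in>UNIV. \<Sum>l\<in>UNIV. \<Sum>i\<in>UNIV. gi j l z * d_y i (g l j) z * spray F i z)"
      by (simp add: sum_distrib_left mult.assoc d_y_g_sym(1)[OF z, of _ _ ])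
    also have "\<dots> = (\<Sum>j\<in>UNIV. \<Sum>i\<in>UNIV. \<Sum>l\<in>UNIV. gi j l z * d_y i (g l j) z * spray F i z)"
      by (intro sum.cong refl sum.swap)
    also have "\<dots> = (\<Sum>i\<in>UNIV. \<Sum>j\<in>UNIV. \<Sum>l\<in>UNIV. gi j l z * d_y i (g l j) z * spray F i z)"
      by (rule sum.swap)
    finally show ?thesis by (simp add: sum_distrib_right)
  qed
  then have 2: "(\<Sum>j\<in>UNIV. \<Sum>l\<in>UNIV. gi j l z * (\<Sum>i\<in>UNIV. d_y j (g l i) z * spray F i z)) =
      2 * (\<Sum>i\<in>UNIV. d_y i lam z * spray F i z)"
    by (simp add: d_y_lam[OF z] sum_distrib_left mult.assoc)
  have "(\<Sum>j\<in>UNIV. \<Sum>l\<in>UNIV. gi j l z * (\<Sum>k\<in>UNIV. snd z $ k * (2 * d_x k (g l j) z))) =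
      (\<Sum>j\<in>UNIV. \<Sum>l\<in>UNIV. \<Sum>k\<in>UNIV. 2 * snd z $ k * (gi j l z * d_x k (g l j) z))"
    by (simp add: sum_distrib_left mult_ac)
  also have "\<dots> = (\<Sum>j\<in>UNIV. \<Sum>k\<in>UNIV. \<Sum>l\<in>UNIV. 2 * snd z $ k * (gi j l z * d_x k (g l j) z))"
    by (intro sum.cong refl sum.swap)
  also have "\<dots> = (\<Sum>k\<in>UNIV. \<Sum>j\<in>UNIV. \<Sum>l\<in>UNIV. 2 * snd z $ k * (gi j l z * d_x k (g l j) z))"
    by (rule sum.swap)
  also have "\<dots> = 4 * (\<Sum>k\<in>UNIV. snd z $ k * d_x k lam z)"
    unfolding sum_distrib_left[symmetric] d_x_lam[OF z]
    by (simp add: sum_distrib_left mult_ac)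
  finally have 3: "(\<Sum>j\<in>UNIV. \<Sum>l\<in>UNIV. gi j l z * (\<Sum>k\<in>UNIV. snd z $ k * (2 * d_x k (g l j) z))) =
     4 * (\<Sum>k\<in>UNIV. snd z $ k * d_x k lam z)" .
  \<comment> \<open>The two mixed derivatives of \<open>E\<close> agree after contraction with the
    symmetric g^-1 and therefore cancel.\<close>
  have "(\<Sum>j\<in>UNIV. \<Sum>l\<in>UNIV. gi j l z * d_y l (d_x j E) z) =
      (\<Sum>l\<in>UNIV. \<Sum>j\<in>UNIV. gi l j z * d_y l (d_x j E) z)"
    by (subst sum.swap) (simp add: gi_sym[OF z])
  then have 4: "(\<Sum>j\<in>UNIV. \<Sum>l\<in>UNIV. gi j l z * d_y l (d_x j E) z) =
      (\<Sum>j\<in>UNIV. \<Sum>l\<in>UNIV. gi j l z * d_y j (d_x l E) z)" .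
  have "trN z + 2 * (\<Sum>i\<in>UNIV. d_y i lam z * spray F i z) =
     (\<Sum>j\<in>UNIV. \<Sum>l\<in>UNIV. gi j l z *
       (\<Sum>i\<in>UNIV. g l i z * N_coeff F i j z + d_y j (g l i) z * spray F i z))"
    unfolding 1[symmetric] 2[symmetric] by (simp add: sum.distrib distrib_left)
  also have "\<dots> = (\<Sum>k\<in>UNIV. snd z $ k * d_x k lam z)"
  proof -
    have "(\<Sum>j\<in>UNIV. \<Sum>l\<in>UNIV. gi j l z *
       (\<Sum>i\<in>UNIV. g l i z * N_coeff F i j z + d_y j (g l i) z * spray F i z)) =
      1/4 * ((\<Sum>j\<in>UNIV. \<Sum>l\<in>UNIV. gi j l z * (\<Sum>k\<in>UNIV. snd z $ k * (2 * d_x k (g l j) z)))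
       + (\<Sum>j\<in>UNIV. \<Sum>l\<in>UNIV. gi j l z * d_y l (d_x j E) z)
       - (\<Sum>j\<in>UNIV. \<Sum>l\<in>UNIV. gi j l z * d_y j (d_x l E) z))"
    proof -
      have eq: "p * (1/4 * (a + b - c)) = 1/4 * (p * a) + 1/4 * (p * b) - 1/4 * (p * c)"
        "1/4 * a + 1/4 * b - 1/4 * c = 1/4 * (a + b - c)" for p a b c :: real
        by (simp_all add: field_simps)
      show ?thesis
        unfolding *
        unfolding eq(1) sum.distrib sum_subtractf sum_distrib_left[symmetric] by (rule eq(2))
    qed
    then show ?thesis unfolding 3 4 by simp
  qed
  finally have main: "trN z + 2 * (\<Sum>i\<in>UNIV. d_y i lam z * spray F i z) = (\<Sum>k\<in>UNIV. snd z $ k * d_x k lam z)" .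
  \<comment> \<open>Since the spray has degree 2, the N-part of y^k h_k is exactly the spray term in
    \<open>main\<close>.\<close>
  have "(\<Sum>k\<in>UNIV. snd z $ k * (\<Sum>m\<in>UNIV. N_coeff F m k z * d_y m lam z)) =
      (\<Sum>m\<in>UNIV. (\<Sum>k\<in>UNIV. snd z $ k * N_coeff F m k z) * d_y m lam z)"
    by (simp add: sum_distrib_left sum_distrib_right mult.assoc) (rule sum.swap)
  also have "\<dots> = 2 * (\<Sum>i\<in>UNIV. d_y i lam z * spray F i z)"
    by (simp add: N_y[OF z] sum_distrib_left mult_ac)
  finally show ?thesis
    using main by (simp add: h_def del_def right_diff_distrib sum_subtractf)
qed

end

section \<open>The traces of the curvature forms\<close>

lemma smooth_on_Pair:
  assumes "open S" "smooth_on S f" "smooth_on S g"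
  shows "smooth_on S (\<lambda>z. (f z, g z))"
proof -
  have "smooth_on S (\<lambda>z. (f z, 0) + (0, g z))"
    by (intro smooth_on_add assms
        smooth_on_bounded_linear_compose[of "\<lambda>a. (a, 0)", OF _ assms(1,2)]
        smooth_on_bounded_linear_compose[of "\<lambda>b. (0, b)", OF _ assms(1,3)]
        bounded_linear_Pair bounded_linear_ident bounded_linear_zero)
  then show ?thesis by simp
qed

lemma smooth_on_vec_lambda:
  fixes f :: "'n::finite \<Rightarrow> 'a::real_normed_vector \<Rightarrow> real"
  assumes "open S" "\<And>i. smooth_on S (f i)"
  shows "smooth_on S (\<lambda>z. \<chi> i. f i z)"
proof -
  have "smooth_on S (\<lambda>z. \<Sum>i\<in>UNIV. f i z *\<^sub>R axis i (1::real))"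
    by (intro smooth_on_sum smooth_on_scaleR smooth_on_const assms)
  moreover have "(\<Sum>i\<in>UNIV. f i z *\<^sub>R axis i 1) = (\<chi> i. f i z)" for z
    using basis_expansion[of "\<chi> i. f i z"] by (simp add: scalar_mult_eq_scaleR)
  ultimately show ?thesis by simp
qed

lemma smooth_form1_onD:
  assumes "smooth_form1_on S \<theta>"
  shows "z \<in> S \<Longrightarrow> linear (\<theta> z)" "smooth_on S (\<lambda>z. \<theta> z v)"
  using assms by (auto simp: smooth_form1_on_def)

lemma linear_euclidean_expansion:
  fixes L :: "'a::euclidean_space \<Rightarrow> real"
  assumes "linear L"
  shows "L w = (\<Sum>b\<in>Basis. (w \<bullet> b) * L b)"
proof -
  have "L w = L (\<Sum>b\<in>Basis. (w \<bullet> b) *\<^sub>R b)" by (simp add: euclidean_representation)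
  then show ?thesis by (simp add: linear_sum[OF assms] linear_scale[OF assms])
qed

lemma smooth_on_form_apply:
  fixes \<theta> :: "'a::euclidean_space form1"
  assumes "open S" "smooth_form1_on S \<theta>" "smooth_on S w"
  shows "smooth_on S (\<lambda>z. \<theta> z (w z))"
proof (rule smooth_on_cong[OF assms(1)])
  show "smooth_on S (\<lambda>z. \<Sum>b\<in>Basis. (w z \<bullet> b) * \<theta> z b)"
    by (intro smooth_on_sum smooth_on_mult assms smooth_form1_onD(2)
        smooth_on_bounded_linear_compose[OF bounded_linear_inner_left])
  show "(\<Sum>b\<in>Basis. (w z \<bullet> b) * \<theta> z b) = \<theta> z (w z)" if "z \<in> S" for z
    using linear_euclidean_expansion[OF smooth_form1_onD(1)[OF assms(2) that], of "w z"] by simp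
qed

lemma smooth_on_form_dir_deriv:
  fixes \<theta> :: "'a::euclidean_space form1"
  assumes "open S" "smooth_form1_on S \<theta>" "smooth_on S v" "smooth_on S w"
  shows "smooth_on S (\<lambda>z. dir_deriv (\<lambda>z'. \<theta> z' (w z)) z (v z))"
proof (rule smooth_on_cong[OF assms(1)])
  show "smooth_on S (\<lambda>z. \<Sum>b\<in>Basis. (w z \<bullet> b) * dir_deriv (\<lambda>z'. \<theta> z' b) z (v z))"
    by (intro smooth_on_sum smooth_on_mult assms smooth_form1_onD(2) smooth_on_dir_deriv_field
        smooth_on_bounded_linear_compose[OF bounded_linear_inner_left])
  fix z assume z: "z \<in> S"
  have d: "(\<lambda>z'. \<theta> z' b) differentiable at z" for b
    by (rule smooth_on_differentiable[OF smooth_form1_onD(2)[OF assms(2)] z])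
  have "dir_deriv (\<lambda>z'. \<theta> z' (w z)) z (v z) = dir_deriv (\<lambda>z'. \<Sum>b\<in>Basis. (w z \<bullet> b) * \<theta> z' b) z (v z)"
    by (rule dir_deriv_cong_open[OF assms(1) z])
      (rule linear_euclidean_expansion[OF smooth_form1_onD(1)[OF assms(2)]])
  also have "\<dots> = (\<Sum>b\<in>Basis. dir_deriv (\<lambda>z'. (w z \<bullet> b) * \<theta> z' b) z (v z))"
    by (rule dir_deriv_sum) (intro differentiable_mult differentiable_const d)
  also have "\<dots> = (\<Sum>b\<in>Basis. (w z \<bullet> b) * dir_deriv (\<lambda>z'. \<theta> z' b) z (v z))"
    by (intro sum.cong refl dir_deriv_cmult d)
  finally show "(\<Sum>b\<in>Basis. (w z \<bullet> b) * dir_deriv (\<lambda>z'. \<theta> z' b) z (v z)) =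
    dir_deriv (\<lambda>z'. \<theta> z' (w z)) z (v z)" by simp
qed

lemma smooth_on_ext_d:
  fixes \<theta> :: "'a::euclidean_space form1"
  assumes "open S" "smooth_form1_on S \<theta>" "smooth_on S v" "smooth_on S w"
  shows "smooth_on S (\<lambda>z. ext_d \<theta> z (v z) (w z))"
  unfolding ext_d_def by (intro smooth_on_diff smooth_on_form_dir_deriv assms)

lemma smooth_on_curvature_form:
  fixes \<omega> :: "'n::finite \<Rightarrow> 'n \<Rightarrow> 'n tm form1"
  assumes "open S" "\<And>i j. smooth_form1_on S (\<omega> i j)" "smooth_on S v" "smooth_on S w"
  shows "smooth_on S (\<lambda>z. curvature_form \<omega> i j z (v z) (w z))"
  unfolding curvature_form_def wedge_def
  by (intro smooth_on_diff smooth_on_sum smooth_on_mult smooth_on_ext_d smooth_on_form_apply assms)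

text \<open>The quadratic terms cancel in the trace: exchanging the two summation indices reverses
  the sign of the wedge product.\<close>

lemma trace_curvature_form:
  fixes \<omega> :: "'n::finite \<Rightarrow> 'n \<Rightarrow> 'n tm form1"
  assumes "\<And>i v. (\<lambda>z. \<omega> i i z v) differentiable at z"
  shows "(\<Sum>i\<in>UNIV. curvature_form \<omega> i i z v w) = ext_d (\<lambda>z v. \<Sum>i\<in>UNIV. \<omega> i i z v) z v w"
proof -
  have "(\<Sum>i\<in>UNIV. \<Sum>k\<in>UNIV. \<omega> k i z w * \<omega> i k z v) = (\<Sum>i\<in>UNIV. \<Sum>k\<in>UNIV. \<omega> k i z v * \<omega> i k z w)"
    by (subst sum.swap) (simp add: mult.commute)
  then have "(\<Sum>i\<in>UNIV. \<Sum>k\<in>UNIV. wedge (\<omega> k i) (\<omega> i k) z v w) = 0"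
    by (simp add: wedge_def sum_subtractf)
  then have "(\<Sum>i\<in>UNIV. curvature_form \<omega> i i z v w) = (\<Sum>i\<in>UNIV. ext_d (\<omega> i i) z v w)"
    by (simp add: curvature_form_def sum_subtractf)
  also have "\<dots> = ext_d (\<lambda>z v. \<Sum>i\<in>UNIV. \<omega> i i z v) z v w"
    by (simp add: ext_d_def sum_subtractf dir_deriv_sum[OF assms])
  finally show ?thesis .
qed

lemma ext_d_cong_open:
  assumes "open S" "z \<in> S" "\<And>z v. z \<in> S \<Longrightarrow> \<theta> z v = \<eta> z v"
  shows "ext_d \<theta> z v w = ext_d \<eta> z v w"
  unfolding ext_d_def
  using dir_deriv_cong_open[OF assms(1,2), of "\<lambda>z. \<theta> z _" "\<lambda>z. \<eta> z _"] assms(3) by simp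

lemma sum_delta_mult [simp]:
  fixes f :: "'n::finite \<Rightarrow> real"
  shows "(\<Sum>k\<in>UNIV. (if i = k then 1 else 0) * f k) = f i" "(\<Sum>k\<in>UNIV. (if k = i then 1 else 0) * f k) = f i"
    "(\<Sum>k\<in>UNIV. f k * (if i = k then 1 else 0)) = f i" "(\<Sum>k\<in>UNIV. f k * (if k = i then 1 else 0)) = f i"
  by (simp_all add: if_distrib[of "\<lambda>c. c * _"] if_distrib[of "\<lambda>c. _ * c"] cong: if_cong)

lemma sum_triple_swap:
  fixes f :: "'a::finite \<Rightarrow> 'b::finite \<Rightarrow> 'c::finite \<Rightarrow> real"
  shows "(\<Sum>i\<in>UNIV. \<Sum>p\<in>UNIV. \<Sum>q\<in>UNIV. f i p q) = (\<Sum>p\<in>UNIV. \<Sum>q\<in>UNIV. \<Sum>i\<in>UNIV. f i p q)"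
  by (subst sum.swap) (intro sum.cong refl sum.swap)

section \<open>Algebra of an adapted frame\<close>

locale finsler_frame = finsler_chart S F for S :: "(real ^ 'n::finite) set" and F :: "'n tm \<Rightarrow> real" +
  fixes W :: "'n tm set" and m :: 'n and u :: "'n \<Rightarrow> 'n tm \<Rightarrow> real ^ 'n"
  assumes conic_W: "conic_open W" and W_sub: "W \<subseteq> S \<times> UNIV" and frame: "adapted_frame F W m u"
begin

lemma open_W: "open W" using conic_W by (rule conic_openD)

lemma W_T: "W \<subseteq> T"
  using conic_W W_sub by (auto simp: conic_open_def)

lemma WT: "z \<in> W \<Longrightarrow> z \<in> T" using W_T by auto

lemma F_nz: "z \<in> W \<Longrightarrow> F z \<noteq> 0" by (drule WT, drule F_pos) simp

lemma smooth_W: "smooth_on T f \<Longrightarrow> smooth_on W f"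
  by (rule smooth_on_subset[OF _ W_T])

lemma u_smooth: "smooth_on W (u i)"
  using frame by (simp add: adapted_frame_def)

lemma u_m: "z \<in> W \<Longrightarrow> u m z = (1 / F z) *\<^sub>R snd z"
  using frame by (simp add: adapted_frame_def)

lemma u_orth: "z \<in> W \<Longrightarrow> (\<Sum>p\<in>UNIV. \<Sum>q\<in>UNIV. u i z $ p * g p q z * u j z $ q) = (if i = j then 1 else 0)"
  using frame by (simp add: adapted_frame_def inner_vec_def matrix_vector_mult_def sum_distrib_left mult.assoc)

abbreviation "U i j z \<equiv> u_inv u z $ i $ j"

lemma U_u: "z \<in> W \<Longrightarrow> (\<Sum>j\<in>UNIV. U i j z * u k z $ j) = (if i = k then 1 else 0)"
  by (rule u_inv_u[OF frame])

lemma u_U: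
  assumes "z \<in> W"
  shows "(\<Sum>i\<in>UNIV. u i z $ p * U i q z) = (if p = q then 1 else 0)"
proof -
  let ?M = "(\<chi> j i. u i z $ j) :: real ^ 'n ^ 'n"
  have "u_inv u z ** ?M = mat 1"
    by (simp add: vec_eq_iff matrix_matrix_mult_def U_u[OF assms] mat_def)
  then have "?M ** u_inv u z = mat 1" by (simp add: matrix_left_right_inverse)
  from matrix_mult_entry_sum[OF this, of p q] show ?thesis by (simp add: mat_def)
qed

text \<open>Orthonormality turns the inversion of the frame matrix into lowering an index with g, so
  the coframe is smooth.\<close>

lemma U_eq:
  assumes "z \<in> W"
  shows "U i q z = (\<Sum>p\<in>UNIV. u i z $ p * g p q z)"
proof -
  have "(\<Sum>p\<in>UNIV. u i z $ p * g p q z) = (\<Sum>p\<in>UNIV. \<Sum>r\<in>UNIV. u i z $ p * g p r z * (\<Sum>j\<in>UNIV. u j z $ r * U j q z))"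
    by (simp add: u_U[OF assms])
  also have "\<dots> = (\<Sum>p\<in>UNIV. \<Sum>r\<in>UNIV. \<Sum>j\<in>UNIV. u i z $ p * g p r z * u j z $ r * U j q z)"
    by (simp add: sum_distrib_left mult.assoc)
  also have "\<dots> = (\<Sum>j\<in>UNIV. (\<Sum>p\<in>UNIV. \<Sum>r\<in>UNIV. u i z $ p * g p r z * u j z $ r) * U j q z)"
    unfolding sum_distrib_right by (rule sum_triple_swap[symmetric])
  also have "\<dots> = U i q z" by (simp add: u_orth[OF assms])
  finally show ?thesis by simp
qed

lemma U_smooth: "smooth_on W (U i q)"
proof (rule smooth_on_cong[OF open_W])
  show "smooth_on W (\<lambda>z. \<Sum>p\<in>UNIV. u i z $ p * g p q z)"
    by (intro smooth_on_sum smooth_on_mult smooth_on_vec_nth u_smooth smooth_W g_smooth open_W)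
qed (simp add: U_eq)

text \<open>The dual form of orthonormality; it converts sums over frame indices into contractions
  with g^-1.\<close>

lemma sum_u_u:
  assumes "z \<in> W"
  shows "(\<Sum>i\<in>UNIV. u i z $ p * u i z $ q) = gi p q z"
proof -
  have *: "(\<Sum>r\<in>UNIV. (\<Sum>i\<in>UNIV. u i z $ p * u i z $ r) * g r s z) = (if p = s then 1 else 0)" for s
  proof -
    have "(\<Sum>r\<in>UNIV. (\<Sum>i\<in>UNIV. u i z $ p * u i z $ r) * g r s z) = (\<Sum>i\<in>UNIV. u i z $ p * U i s z)"
      unfolding U_eq[OF assms] sum_distrib_left sum_distrib_right
      by (subst sum.swap) (simp add: mult.assoc)
    then show ?thesis by (simp add: u_U[OF assms])
  qed
  have "(\<Sum>i\<in>UNIV. u i z $ p * u i z $ q) =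
      (\<Sum>r\<in>UNIV. (\<Sum>i\<in>UNIV. u i z $ p * u i z $ r) * (\<Sum>s\<in>UNIV. g r s z * gi s q z))"
    by (simp add: g_gi[OF WT[OF assms]])
  also have "\<dots> = (\<Sum>s\<in>UNIV. (\<Sum>r\<in>UNIV. (\<Sum>i\<in>UNIV. u i z $ p * u i z $ r) * g r s z) * gi s q z)"
    unfolding sum_distrib_left sum_distrib_right
    by (subst sum.swap) (simp add: mult.assoc sum_distrib_left sum_distrib_right)
  also have "\<dots> = gi p q z" by (simp add: *)
  finally show ?thesis .
qed

lemma frame_h_smooth: "smooth_on W (frame_h F u k)"
  unfolding frame_h_def[abs_def] hlift_def
  by (intro smooth_on_Pair smooth_on_vec_lambda smooth_on_uminus smooth_on_sum smooth_on_mult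
      smooth_on_vec_nth u_smooth smooth_W N_smooth open_W)

lemma frame_v_smooth: "smooth_on W (frame_v F u k)"
  unfolding frame_v_def[abs_def]
  by (intro smooth_on_Pair smooth_on_uminus smooth_on_scaleR smooth_on_const u_smooth smooth_W F_smooth open_W)

lemma coframe_h_smooth: "smooth_on W (\<lambda>z. coframe_h u i z v)"
  unfolding coframe_h_def by (intro smooth_on_sum smooth_on_mult U_smooth smooth_on_const open_W)

lemma cartan_eq: "z \<in> T \<Longrightarrow> cartan F p q k z = 1/2 * F z * d_y k (g p q) z"
  by (simp add: cartan_def d_y_g)

lemma sum_gi_cartan:
  assumes "z \<in> W"
  shows "(\<Sum>p\<in>UNIV. \<Sum>q\<in>UNIV. gi p q z * cartan F p q k z) = F z * d_y k lam z"
proof -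
  note z = WT[OF assms]
  have eq: "cartan F p q k z = 1/2 * F z * d_y k (g q p) z" for p q
    unfolding cartan_eq[OF z] d_y_g_sym(2)[OF z, of k p q] ..
  have "(\<Sum>p\<in>UNIV. \<Sum>q\<in>UNIV. gi p q z * cartan F p q k z) =
      1/2 * F z * (\<Sum>p\<in>UNIV. \<Sum>q\<in>UNIV. gi p q z * d_y k (g q p) z)"
    unfolding eq sum_distrib_left by (simp add: mult_ac)
  then show ?thesis by (simp add: d_y_lam[OF z])
qed

text \<open>Summation over the frame contracts the Cartan tensor with g^-1, which by Jacobi's
  formula is F times the vertical derivative of \<lambda>.\<close>

lemma trace_H_coeff:
  assumes "z \<in> W"
  shows "(\<Sum>i\<in>UNIV. H_coeff F u i i \<gamma> z) = - F z * (\<Sum>k\<in>UNIV. d_y k lam z * u \<gamma> z $ k)"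
proof -
  have "(\<Sum>i\<in>UNIV. H_coeff F u i i \<gamma> z) =
    - (\<Sum>i\<in>UNIV. \<Sum>p\<in>UNIV. \<Sum>q\<in>UNIV. u i z $ p * u i z $ q * (\<Sum>k\<in>UNIV. cartan F p q k z * u \<gamma> z $ k))"
    by (simp add: H_coeff_def sum_negf sum_distrib_left mult_ac)
  also have "\<dots> = - (\<Sum>p\<in>UNIV. \<Sum>q\<in>UNIV. gi p q z * (\<Sum>k\<in>UNIV. cartan F p q k z * u \<gamma> z $ k))"
    unfolding sum_triple_swap[of "\<lambda>i p q. u i z $ p * u i z $ q * _ p q"] sum_distrib_right[symmetric]
      sum_u_u[OF assms] ..
  also have "\<dots> = - (\<Sum>k\<in>UNIV. (\<Sum>p\<in>UNIV. \<Sum>q\<in>UNIV. gi p q z * cartan F p q k z) * u \<gamma> z $ k)"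
    unfolding sum_distrib_left sum_distrib_right mult.assoc by (subst sum_triple_swap[symmetric]) simp
  finally show ?thesis
    by (simp add: sum_gi_cartan[OF assms] sum_distrib_left mult.assoc sum_negf)
qed

text \<open>\<lambda> has degree 0, so its radial derivative vanishes. This extends the sum over
  \<gamma> \<noteq> m in the trace to all frame indices.\<close>

lemma lam_u_m: "z \<in> W \<Longrightarrow> (\<Sum>k\<in>UNIV. d_y k lam z * u m z $ k) = 0"
  using homog_on_euler_sum[OF conic_T lam_homog lam_smooth WT]
  by (simp add: u_m mult.commute flip: sum_divide_distrib)

definition "trace_form z V = (\<Sum>l\<in>UNIV. h l z * fst V $ l) - dir_deriv lam z V" for V :: "'n tm"

text \<open>The trace of the connection form is fixed by the almost metric condition alone: it is
  \<open>- I\<^sub>k \<delta>y\<^sup>k\<close> with \<open>I\<^sub>k = \<partial>\<^sub>k ln \<surd>det g\<close> the mean Cartan form.\<close>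

lemma trace_chern_connection:
  assumes "chern_connection F W m u \<omega>" "z \<in> W"
  shows "(\<Sum>i\<in>UNIV. \<omega> i i z V) = trace_form z V"
proof -
  have "\<omega> i i z V + \<omega> i i z V = - 2 * (\<Sum>\<gamma>\<in>- {m}. H_coeff F u i i \<gamma> z * coframe_v F u \<gamma> z V)" for i
    using assms by (simp only: chern_connection_def)
  then have "\<omega> i i z V = - (\<Sum>\<gamma>\<in>- {m}. H_coeff F u i i \<gamma> z * coframe_v F u \<gamma> z V)" for i
    by (simp add: algebra_simps)
  then have "(\<Sum>i\<in>UNIV. \<omega> i i z V) = - (\<Sum>i\<in>UNIV. \<Sum>\<gamma>\<in>- {m}. H_coeff F u i i \<gamma> z * coframe_v F u \<gamma> z V)"
    by (simp add: sum_negf)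
  also have "\<dots> = - (\<Sum>\<gamma>\<in>- {m}. (\<Sum>i\<in>UNIV. H_coeff F u i i \<gamma> z) * coframe_v F u \<gamma> z V)"
    by (subst sum.swap) (simp add: sum_distrib_right)
  also have "\<dots> = - (\<Sum>\<gamma>\<in>- {m}. (\<Sum>k\<in>UNIV. d_y k lam z * u \<gamma> z $ k) * (\<Sum>j\<in>UNIV. U \<gamma> j z * delta_y F j z V))"
    unfolding trace_H_coeff[OF assms(2)] coframe_v_def using F_nz[OF assms(2)] by simp
  also have "\<dots> = - (\<Sum>\<gamma>\<in>UNIV. (\<Sum>k\<in>UNIV. d_y k lam z * u \<gamma> z $ k) * (\<Sum>j\<in>UNIV. U \<gamma> j z * delta_y F j z V))"
    using lam_u_m[OF assms(2)] by (subst sum.mono_neutral_left[of UNIV "- {m}"]) auto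
  also have "\<dots> = - (\<Sum>\<gamma>\<in>UNIV. \<Sum>k\<in>UNIV. \<Sum>j\<in>UNIV. u \<gamma> z $ k * U \<gamma> j z * (d_y k lam z * delta_y F j z V))"
    by (simp add: sum_product mult_ac)
  also have "\<dots> = - (\<Sum>k\<in>UNIV. \<Sum>j\<in>UNIV. (if k = j then 1 else 0) * (d_y k lam z * delta_y F j z V))"
    unfolding sum_triple_swap[of "\<lambda>\<gamma> k j. u \<gamma> z $ k * U \<gamma> j z * _ k j"] sum_distrib_right[symmetric]
      u_U[OF assms(2)] ..
  also have "\<dots> = - (\<Sum>k\<in>UNIV. d_y k lam z * delta_y F k z V)"
    by simp
  finally show ?thesis
    by (simp add: dir_deriv_del[OF lam_smooth WT[OF assms(2)]] trace_form_def h_def)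
qed

text \<open>The second derivatives of \<lambda> cancel, which leaves dh_l \<and> dx^l.\<close>

lemma ext_d_trace_form:
  assumes "z \<in> W"
  shows "ext_d trace_form z V V' =
    (\<Sum>l\<in>UNIV. dir_deriv (h l) z V * fst V' $ l) - (\<Sum>l\<in>UNIV. dir_deriv (h l) z V' * fst V $ l)"
proof -
  note z = WT[OF assms]
  have "dir_deriv (\<lambda>z'. trace_form z' w) z v =
      (\<Sum>l\<in>UNIV. dir_deriv (h l) z v * fst w $ l) - dir_deriv (\<lambda>z'. dir_deriv lam z' w) z v" for v w
  proof -
    have s: "smooth_on T (\<lambda>z. \<Sum>l\<in>UNIV. h l z * fst w $ l)"
      by (intro smooth_on_sum smooth_on_mult h_smooth smooth_on_const open_T)
    have "dir_deriv (\<lambda>z'. trace_form z' w) z v =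
      dir_deriv (\<lambda>z. \<Sum>l\<in>UNIV. h l z * fst w $ l) z v - dir_deriv (\<lambda>z'. dir_deriv lam z' w) z v"
      unfolding trace_form_def
      by (rule dir_deriv_diff) (intro smooth_on_differentiable[OF _ z] s smooth_on_dir_deriv lam_smooth)+
    then show ?thesis
      using smooth_on_differentiable[OF h_smooth z] by (subst (asm) dir_deriv_sum_mult) auto
  qed
  then show ?thesis
    unfolding ext_d_def using dir_deriv_commute[OF open_T lam_smooth z, of V V'] by simp
qed

text \<open>Stated for any family with trace \<open>trace_form\<close>, since it serves the Chern
  forms and, once J = 0, the Berwald forms. On a horizontal and a vertical vector only the vertical
  derivatives of the h_l survive.\<close>

lemma trace_P_comp:
  assumes "\<And>z V. z \<in> W \<Longrightarrow> (\<Sum>i\<in>UNIV. \<omega> i i z V) = trace_form z V"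
    and "\<And>i v. (\<lambda>z. \<omega> i i z v) differentiable at z" and "z \<in> W"
  shows "(\<Sum>i\<in>UNIV. P_comp F u \<omega> i i k \<gamma> z) =
    F z * (\<Sum>l\<in>UNIV. u k z $ l * dir_deriv (h l) z (0, u \<gamma> z))"
proof -
  have "(\<Sum>i\<in>UNIV. P_comp F u \<omega> i i k \<gamma> z) = ext_d trace_form z (frame_h F u k z) (frame_v F u \<gamma> z)"
    unfolding P_comp_def trace_curvature_form[OF assms(2)]
    by (rule ext_d_cong_open[OF open_W assms(3,1)])
  moreover have "dir_deriv (h l) z (0, - (F z *\<^sub>R u \<gamma> z)) = - F z * dir_deriv (h l) z (0, u \<gamma> z)" for l
  proof -
    have "(0, - (F z *\<^sub>R u \<gamma> z)) = (- F z) *\<^sub>R (0 :: real ^ 'n, u \<gamma> z)" by simp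
    then show ?thesis
      using linear_scale[OF dir_deriv_linear[OF smooth_on_differentiable[OF h_smooth WT[OF assms(3)]]]]
      by (simp only: real_scaleR_def)
  qed
  ultimately show ?thesis
    by (simp add: ext_d_trace_form[OF assms(3)] frame_h_def hlift_def frame_v_def sum_negf
        sum_distrib_left mult_ac)
qed

lemma chern_connection_smooth: "chern_connection F W m u \<omega> \<Longrightarrow> smooth_form1_on W (\<omega> i j)"
  by (simp add: chern_connection_def form1_on_SM_def)

lemma landsberg_smooth:
  assumes "chern_connection F W m u \<omega>"
  shows "smooth_on W (landsberg F m u \<omega> i j \<alpha>)"
  unfolding landsberg_def[abs_def] P_comp_def
  by (intro smooth_on_uminus smooth_on_curvature_form chern_connection_smooth[OF assms]
      frame_h_smooth frame_v_smooth open_W)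

lemma h_vertical_radial:
  assumes "z \<in> W"
  shows "dir_deriv (h l) z (0, u m z) = 0"
proof -
  have "(0, u m z) = (1 / F z) *\<^sub>R (0 :: real ^ 'n, snd z)" by (simp add: u_m[OF assms])
  moreover have "dir_deriv (h l) z (0, snd z) = 0"
    using homog_on_euler[OF conic_T h_homog h_smooth, of "fst z" "snd z"] WT[OF assms] by simp
  ultimately show ?thesis
    using linear_scale[OF dir_deriv_linear[OF smooth_on_differentiable[OF h_smooth WT[OF assms]]]]
    by (metis scaleR_zero_right)
qed

text \<open>For the frame index m the horizontal vector lies over y/F, so J = 0 kills y^l dh_l in
  the directions u_\<gamma> with \<gamma> \<noteq> m. Degree 0 of h_l supplies the radial direction,
  and together these span the fibre.\<close>

lemma mean_landsberg_consequence:
  assumes chern: "chern_connection F W m u \<omega>" and z: "z \<in> W"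
    and J: "\<And>\<gamma>. \<gamma> \<noteq> m \<Longrightarrow> mean_landsberg F m u \<omega> \<gamma> z = 0"
  shows "(\<Sum>l\<in>UNIV. snd z $ l * d_y k (h l) z) = 0"
proof -
  have "(\<Sum>l\<in>UNIV. u m z $ l * dir_deriv (h l) z (0, u \<gamma> z)) = 0" for \<gamma>
  proof (cases "\<gamma> = m")
    case False
    have "(\<lambda>z. \<omega> i i z v) differentiable at z" for i v
      by (rule smooth_on_differentiable[OF smooth_form1_onD(2)[OF chern_connection_smooth[OF chern]] z])
    from trace_P_comp[where \<omega> = \<omega>, OF trace_chern_connection[OF chern] this z, of m \<gamma>] J[OF False] F_nz[OF z]
    show ?thesis by (simp add: mean_landsberg_def)
  qed (simp add: h_vertical_radial[OF z])
  then have *: "(\<Sum>l\<in>UNIV. snd z $ l * dir_deriv (h l) z (0, u \<gamma> z)) = 0" for \<gamma>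
    using F_nz[OF z] by (simp add: u_m[OF z] flip: sum_divide_distrib)
  have "(0, axis k 1) = (\<Sum>\<gamma>\<in>UNIV. U \<gamma> k z *\<^sub>R (0 :: real ^ 'n, u \<gamma> z))"
  proof (rule prod_eqI)
    have "(\<Sum>\<gamma>\<in>UNIV. U \<gamma> k z * u \<gamma> z $ p) = axis k 1 $ p" for p
      using u_U[OF z, of p k] by (simp add: axis_def mult.commute eq_commute)
    then show "snd (0, axis k 1) = snd (\<Sum>\<gamma>\<in>UNIV. U \<gamma> k z *\<^sub>R (0 :: real ^ 'n, u \<gamma> z))"
      by (simp add: snd_sum vec_eq_iff)
  qed (simp add: fst_sum)
  note axis = this
  have "d_y k (h l) z = (\<Sum>\<gamma>\<in>UNIV. U \<gamma> k z * dir_deriv (h l) z (0, u \<gamma> z))" for l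
  proof -
    note L = dir_deriv_linear[OF smooth_on_differentiable[OF h_smooth WT[OF z]]]
    show ?thesis
      unfolding d_y_def axis by (simp only: linear_sum[OF L] linear_scale[OF L] real_scaleR_def)
  qed
  then have "(\<Sum>l\<in>UNIV. snd z $ l * d_y k (h l) z) =
      (\<Sum>\<gamma>\<in>UNIV. U \<gamma> k z * (\<Sum>l\<in>UNIV. snd z $ l * dir_deriv (h l) z (0, u \<gamma> z)))"
    unfolding sum_distrib_left by (subst sum.swap) (simp add: sum_distrib_left mult_ac)
  then show ?thesis by (simp add: *)
qed

text \<open>J has to vanish on all of \<open>W\<close> and not only at \<open>z\<close>: the Berwald
  trace must agree with \<open>trace_form\<close> on an open set before it is differentiated. Then e
  is F times the g-trace of the vertical derivatives of the h_l.\<close>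

lemma berwald_scalar_consequence:
  assumes chern: "chern_connection F W m u \<omega>" and z: "z \<in> W"
    and J: "\<And>\<gamma> z. z \<in> W \<Longrightarrow> \<gamma> \<noteq> m \<Longrightarrow> mean_landsberg F m u \<omega> \<gamma> z = 0"
    and e: "berwald_scalar F m u \<omega> z = 0"
  shows "(\<Sum>k\<in>UNIV. \<Sum>l\<in>UNIV. gi k l z * d_y k (h l) z) = 0"
proof -
  let ?B = "berwald_connection F m u \<omega>"
  have diff: "(\<lambda>z. ?B i i z v) differentiable at z" for i v
  proof -
    have "smooth_on W (\<lambda>z. ?B i i z v)"
      unfolding berwald_connection_def
      by (intro smooth_on_diff smooth_on_sum smooth_on_mult landsberg_smooth[OF chern] coframe_h_smooth
          smooth_form1_onD(2)[OF chern_connection_smooth[OF chern]] open_W)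
    then show ?thesis by (rule smooth_on_differentiable[OF _ z])
  qed
  have tr: "(\<Sum>i\<in>UNIV. ?B i i z V) = trace_form z V" if "z \<in> W" for z V
  proof -
    have "(\<Sum>i\<in>UNIV. \<Sum>\<alpha>\<in>- {m}. landsberg F m u \<omega> i i \<alpha> z * coframe_h u \<alpha> z V) =
      (\<Sum>\<alpha>\<in>- {m}. mean_landsberg F m u \<omega> \<alpha> z * coframe_h u \<alpha> z V)"
      by (subst sum.swap) (simp add: landsberg_def mean_landsberg_def sum_negf sum_distrib_right)
    also have "\<dots> = 0" using J[OF that] by simp
    finally show ?thesis
      using trace_chern_connection[OF chern that] by (simp add: berwald_connection_def sum_subtractf)
  qed
  have "(\<Sum>\<gamma>\<in>- {m}. F z * (\<Sum>l\<in>UNIV. u \<gamma> z $ l * dir_deriv (h l) z (0, u \<gamma> z))) = 0"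
    using e trace_P_comp[where \<omega> = ?B, OF tr diff z] by (simp add: berwald_scalar_def mean_berwald_def)
  then have "(\<Sum>\<gamma>\<in>- {m}. \<Sum>l\<in>UNIV. u \<gamma> z $ l * dir_deriv (h l) z (0, u \<gamma> z)) = 0"
    using F_nz[OF z] by (simp flip: sum_distrib_left)
  \<comment> \<open>The added term \<gamma> = m is a radial derivative of functions of degree
    0.\<close>
  moreover have "(\<Sum>\<gamma>\<in>- {m}. \<Sum>l\<in>UNIV. u \<gamma> z $ l * dir_deriv (h l) z (0, u \<gamma> z)) =
      (\<Sum>\<gamma>\<in>UNIV. \<Sum>l\<in>UNIV. u \<gamma> z $ l * dir_deriv (h l) z (0, u \<gamma> z))"
    by (rule sum.mono_neutral_left) (auto simp: h_vertical_radial[OF z])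
  moreover have "dir_deriv (h l) z (0, u \<gamma> z) = (\<Sum>k\<in>UNIV. u \<gamma> z $ k * d_y k (h l) z)" for l \<gamma>
    using dir_deriv_tm[OF smooth_on_differentiable[OF h_smooth WT[OF z]], of l "(0, u \<gamma> z)"] by simp
  ultimately have "0 = (\<Sum>\<gamma>\<in>UNIV. \<Sum>l\<in>UNIV. \<Sum>k\<in>UNIV. u \<gamma> z $ k * u \<gamma> z $ l * d_y k (h l) z)"
    by (simp add: sum_distrib_left mult_ac)
  also have "\<dots> = (\<Sum>l\<in>UNIV. \<Sum>k\<in>UNIV. gi k l z * d_y k (h l) z)"
    unfolding sum_triple_swap[of "\<lambda>\<gamma> l k. u \<gamma> z $ k * u \<gamma> z $ l * _ k l"] sum_distrib_right[symmetric]
      sum_u_u[OF z] ..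
  finally show ?thesis by (subst sum.swap) simp
qed

end

section \<open>Existence of adapted frames and of the Chern connection\<close>

context finsler_chart
begin

text \<open>Where y^m \<noteq> 0, the vector y and the coordinate vectors other than the m-th form a
  basis, so Gram-Schmidt is smooth on the whole cone. The cones cover the slit tangent bundle as m
  varies.\<close>

definition "slit m = S \<times> {y :: real ^ 'n. y $ m \<noteq> 0}"

lemma conic_slit: "conic_open (slit m)"
proof -
  have "{y :: real ^ 'n. y $ m \<noteq> 0} = (\<lambda>y. y $ m) -` (- {0})" by auto
  moreover have "open ((\<lambda>y :: real ^ 'n. y $ m) -` (- {0}))"
    by (intro open_vimage open_Compl continuous_intros closed_singleton)
  ultimately have "open {y :: real ^ 'n. y $ m \<noteq> 0}" by simp
  then have "open (slit m)" unfolding slit_def by (intro open_Times open_S)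
  then show ?thesis by (auto simp: conic_open_def slit_def)
qed

lemma slit_T: "slit m \<subseteq> T"
  by (auto simp: slit_def)

definition "gform z a b = a \<bullet> (g_mat F z *v b)"

lemma gform_sum: "gform z a b = (\<Sum>p\<in>UNIV. \<Sum>q\<in>UNIV. a $ p * g p q z * b $ q)"
  by (simp add: gform_def inner_vec_def matrix_vector_mult_def sum_distrib_left mult.assoc)

lemma gform_linear: "linear (\<lambda>a. gform z a b)"
  unfolding gform_def by (intro linearI) (simp_all add: inner_add_left)

lemma gform_sym: "z \<in> T \<Longrightarrow> gform z a b = gform z b a"
  unfolding gform_sum by (subst sum.swap) (simp add: g_sym[of z _ _] mult_ac)

lemma gform_pos: "z \<in> T \<Longrightarrow> a \<noteq> 0 \<Longrightarrow> gform z a a > 0"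
  unfolding gform_def by (cases z) (auto intro: pos_def)

lemma gform_smooth:
  assumes "open W" "W \<subseteq> T" "smooth_on W a" "smooth_on W b"
  shows "smooth_on W (\<lambda>z. gform z (a z) (b z))"
  unfolding gform_sum
  by (intro smooth_on_sum smooth_on_mult smooth_on_vec_nth assms smooth_on_subset[OF g_smooth])

lemma gform_scale:
  assumes "W \<subseteq> T" "homog_on W 0 a" "homog_on W 0 b"
  shows "homog_on W 0 (\<lambda>z. gform z (a z) (b z))"
  unfolding homog_on_def
proof (intro allI impI)
  fix x y and t :: real assume xy: "(x, y) \<in> W" "t > 0"
  then have "g_mat F (x, t *\<^sub>R y) = g_mat F (x, y)"
    using g_mat_scale[of "(x, y)" t] assms(1) by auto
  moreover have "a (x, t *\<^sub>R y) = a (x, y)" "b (x, t *\<^sub>R y) = b (x, y)"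
    using homog_onD[OF assms(2) xy] homog_onD[OF assms(3) xy] by simp_all
  ultimately show "gform (x, t *\<^sub>R y) (a (x, t *\<^sub>R y)) (b (x, t *\<^sub>R y)) =
      (t powi 0) *\<^sub>R gform (x, y) (a (x, y)) (b (x, y))"
    by (simp add: gform_def)
qed

definition partial_frame :: "'n \<Rightarrow> 'n set \<Rightarrow> ('n \<Rightarrow> 'n tm \<Rightarrow> real ^ 'n) \<Rightarrow> bool" where
  "partial_frame m I u \<longleftrightarrow>
     (\<forall>i\<in>I. smooth_on (slit m) (u i) \<and> homog_on (slit m) 0 (u i)) \<and>
     (\<forall>z\<in>slit m. \<forall>i\<in>I. \<forall>j\<in>I. gform z (u i z) (u j z) = (if i = j then 1 else 0)) \<and>
     (\<forall>z\<in>slit m. u m z = (1 / F z) *\<^sub>R snd z) \<and>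
     (\<forall>z\<in>slit m. \<forall>i\<in>I. \<forall>k\<in>- I. u i z $ k * snd z $ m = u i z $ m * snd z $ k)"

text \<open>Gram--Schmidt for \<open>y/F\<close> and the coordinate vectors other than the \<open>m\<close>-th. The last clause
  of \<open>partial_frame\<close> says that the vectors found so far lie in the span of \<open>y\<close> and of
  the coordinate vectors already used, so that the next step does not produce \<open>0\<close>.\<close>

lemma partial_frame_exists:
  assumes "finite I" "m \<notin> I"
  shows "\<exists>u. partial_frame m (insert m I) u"
  using assms
proof (induction I)
  case empty
  have op: "open (slit m)" using conic_slit by (rule conic_openD)
  define u where "u = (\<lambda>(i::'n) z. (1 / F z) *\<^sub>R snd z)"
  have F: "F z > 0" if "z \<in> slit m" for z using F_pos slit_T that by blast
  have "smooth_on (slit m) (\<lambda>z. (1 / F z) *\<^sub>R snd z)"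
    using F by (intro smooth_on_scaleR smooth_on_divide smooth_on_const smooth_on_snd op
        smooth_on_subset[OF F_smooth slit_T]) force
  moreover have "homog_on (slit m) 0 (\<lambda>z. (1 / F z) *\<^sub>R snd z)"
    using homog_onD[OF F_homog] slit_T by (fastforce simp: homog_on_def)
  moreover have "gform z ((1 / F z) *\<^sub>R snd z) ((1 / F z) *\<^sub>R snd z) = 1" if "z \<in> slit m" for z
  proof -
    have "z \<in> T" using slit_T that by blast
    from F_sq_eq[OF this] F[OF that] show ?thesis
      by (simp add: gform_def matrix_vector_mult_scaleR F_sq_def power2_eq_square)
  qed
  ultimately have "partial_frame m {m} u"
    by (simp add: partial_frame_def u_def)
  then show ?case by auto
next
  case (insert j I)
  then obtain u where u: "partial_frame m (insert m I) u" by auto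
  let ?I = "insert m I" and ?W = "slit m"
  have j: "j \<notin> ?I" "j \<noteq> m" using insert by auto
  have fin: "finite ?I" using insert by simp
  have op: "open ?W" using conic_slit by (rule conic_openD)
  have us: "smooth_on ?W (u i)" "homog_on ?W 0 (u i)" if "i \<in> ?I" for i
    using u that by (auto simp: partial_frame_def)
  have uo: "gform z (u i z) (u k z) = (if i = k then 1 else 0)" if "z \<in> ?W" "i \<in> ?I" "k \<in> ?I" for z i k
    using u that unfolding partial_frame_def by blast
  have um: "u m z = (1 / F z) *\<^sub>R snd z" if "z \<in> ?W" for z
    using u that by (simp add: partial_frame_def)
  have uc: "u i z $ k * snd z $ m = u i z $ m * snd z $ k" if "z \<in> ?W" "i \<in> ?I" "k \<notin> ?I" for z i k
    using u that unfolding partial_frame_def by blast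
  define e :: "real ^ 'n" where "e = axis j 1"
  define v where "v z = e - (\<Sum>i\<in>?I. gform z e (u i z) *\<^sub>R u i z)" for z
  have v_smooth: "smooth_on ?W v"
    unfolding v_def[abs_def]
    by (intro smooth_on_diff smooth_on_sum smooth_on_scaleR smooth_on_const gform_smooth slit_T us op)
  have he: "homog_on ?W 0 (\<lambda>z. e)" by (simp add: homog_on_def)
  have v_homog: "homog_on ?W 0 v"
    unfolding homog_on_def
  proof (intro allI impI)
    fix x y and t :: real assume xy: "(x, y) \<in> ?W" "t > 0"
    have "gform (x, t *\<^sub>R y) e (u i (x, t *\<^sub>R y)) = gform (x, y) e (u i (x, y))"
      "u i (x, t *\<^sub>R y) = u i (x, y)" if "i \<in> ?I" for i
      using homog_onD[OF gform_scale[OF slit_T he us(2)[OF that]] xy] homog_onD[OF us(2)[OF that] xy]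
      by simp_all
    then show "v (x, t *\<^sub>R y) = (t powi 0) *\<^sub>R v (x, y)" by (simp add: v_def)
  qed
  have uv: "gform z (v z) (u k z) = 0" if z: "z \<in> ?W" and k: "k \<in> ?I" for z k
  proof -
    have "gform z (v z) (u k z) = gform z e (u k z) - (\<Sum>i\<in>?I. gform z e (u i z) * gform z (u i z) (u k z))"
      unfolding v_def
      by (simp only: linear_diff[OF gform_linear] linear_sum[OF gform_linear]
          linear_scale[OF gform_linear] real_scaleR_def)
    also have "(\<Sum>i\<in>?I. gform z e (u i z) * gform z (u i z) (u k z)) =
        (\<Sum>i\<in>?I. if i = k then gform z e (u i z) else 0)"
      by (rule sum.cong) (use uo[OF z _ k] in auto)
    also have "\<dots> = gform z e (u k z)" using k fin by (simp add: sum.delta)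
    finally show ?thesis by simp
  qed
  have vc: "v z $ k * snd z $ m = v z $ m * snd z $ k" if z: "z \<in> ?W" and k: "k \<notin> insert j ?I" for z k
  proof -
    have "(\<Sum>i\<in>?I. gform z e (u i z) * u i z $ k) * snd z $ m = (\<Sum>i\<in>?I. gform z e (u i z) * u i z $ m) * snd z $ k"
      unfolding sum_distrib_right by (rule sum.cong) (use uc[OF z] k in \<open>auto simp: mult.assoc\<close>)
    then show ?thesis using k j by (simp add: v_def e_def axis_def left_diff_distrib)
  qed
  have v_nz: "v z \<noteq> 0" if z: "z \<in> ?W" for z
  proof
    assume "v z = 0"
    then have e: "e = (\<Sum>i\<in>?I. gform z e (u i z) *\<^sub>R u i z)" by (simp add: v_def)
    have comp: "e $ k = (\<Sum>i\<in>?I. gform z e (u i z) * u i z $ k)" for k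
      by (subst e) simp
    \<comment> \<open>The relation satisfied by each u_i passes to their combination
      \<open>e\<close>; for the j-th coordinate vector it reads y^m = 0.\<close>
    have "e $ j * snd z $ m = e $ m * snd z $ j"
      unfolding comp sum_distrib_right by (rule sum.cong) (use uc[OF z _ j(1)] in \<open>auto simp: mult.assoc\<close>)
    then show False using z j by (auto simp: e_def axis_def slit_def)
  qed
  define w where "w z = (1 / sqrt (gform z (v z) (v z))) *\<^sub>R v z" for z
  have vv: "gform z (v z) (v z) > 0" if "z \<in> ?W" for z
    using gform_pos[of z "v z"] v_nz[OF that] slit_T that by blast
  have w_smooth: "smooth_on ?W w"
    unfolding w_def[abs_def]
  proof (intro smooth_on_scaleR smooth_on_divide smooth_on_sqrt smooth_on_const gform_smooth slit_T v_smooth op)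
    fix z assume "z \<in> ?W"
    from vv[OF this] show "gform z (v z) (v z) > 0" "sqrt (gform z (v z) (v z)) \<noteq> 0" by simp_all
  qed
  have w_homog: "homog_on ?W 0 w"
    unfolding homog_on_def
  proof (intro allI impI)
    fix x y and t :: real assume xy: "(x, y) \<in> ?W" "t > 0"
    show "w (x, t *\<^sub>R y) = (t powi 0) *\<^sub>R w (x, y)"
      using homog_onD[OF gform_scale[OF slit_T v_homog v_homog] xy] homog_onD[OF v_homog xy]
      by (simp add: w_def)
  qed
  have ww: "gform z (w z) (w z) = 1" if "z \<in> ?W" for z
    using vv[OF that] unfolding w_def gform_def by (simp add: matrix_vector_mult_scaleR)
  have wu: "gform z (w z) (u k z) = 0" if "z \<in> ?W" "k \<in> ?I" for z k
    unfolding w_def linear_scale[OF gform_linear] uv[OF that] by simp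
  have uw: "gform z (u k z) (w z) = 0" if "z \<in> ?W" "k \<in> ?I" for z k
    using wu[OF that] gform_sym[OF subsetD[OF slit_T that(1)], of "w z" "u k z"] by simp
  have wc: "w z $ k * snd z $ m = w z $ m * snd z $ k" if "z \<in> ?W" "k \<notin> insert j ?I" for z k
    using vc[OF that] by (simp add: w_def)
  have "partial_frame m (insert m (insert j I)) (u(j := w))"
    unfolding partial_frame_def
  proof (intro conjI ballI)
    fix i assume "i \<in> insert m (insert j I)"
    then show "smooth_on ?W ((u(j := w)) i)" "homog_on ?W 0 ((u(j := w)) i)"
      using us w_smooth w_homog by auto
  next
    fix z i k assume z: "z \<in> ?W" and "i \<in> insert m (insert j I)" "k \<in> insert m (insert j I)"
    then consider "i = j" "k = j" | "i = j" "k \<in> ?I" | "i \<in> ?I" "k = j" | "i \<in> ?I" "k \<in> ?I" by auto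
    then show "gform z ((u(j := w)) i z) ((u(j := w)) k z) = (if i = k then 1 else 0)"
      using j(1) ww[OF z] wu[OF z] uw[OF z] uo[OF z] by cases auto
  next
    fix z assume "z \<in> ?W"
    then show "(u(j := w)) m z = (1 / F z) *\<^sub>R snd z" using um j(2) by simp
  next
    fix z i k assume z: "z \<in> ?W" and "i \<in> insert m (insert j I)" and "k \<in> - insert m (insert j I)"
    then show "(u(j := w)) i z $ k * snd z $ m = (u(j := w)) i z $ m * snd z $ k"
      using wc[OF z] uc[OF z] by (cases "i = j") auto
  qed
  then show ?case by blast
qed

lemma adapted_frame_exists: "\<exists>u. adapted_frame F (slit m) m u"
proof -
  have "insert m (- {m}) = UNIV" by auto
  then obtain u where u: "partial_frame m UNIV u"
    using partial_frame_exists[of "- {m}" m] by auto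
  have "u i (x, t *\<^sub>R y) = u i (x, y)" if "(x, y) \<in> slit m" "t > 0" for i x y t
  proof -
    have "homog_on (slit m) 0 (u i)" using u by (simp add: partial_frame_def)
    from homog_onD[OF this that] show ?thesis by simp
  qed
  then have "adapted_frame F (slit m) m u"
    using u by (auto simp: adapted_frame_def partial_frame_def gform_def)
  then show ?thesis by blast
qed

text \<open>Christoffel symbols of the first kind with horizontal derivatives in place of partial
  ones: the Chern connection coefficients with the upper index lowered into the first slot.\<close>

definition "gam l q k z = 1/2 * (del q (g l k) z + del k (g l q) z - del l (g q k) z)"

lemma gam_smooth: "smooth_on T (gam l q k)"
  unfolding gam_def[abs_def]
  by (intro smooth_on_mult smooth_on_const smooth_on_diff smooth_on_add del_smooth g_smooth open_T)

lemma gam_homog: "homog_on T 0 (gam l q k)"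
  unfolding gam_def[abs_def]
  by (intro homog_on_cmult homog_on_diff homog_on_add del_homog g_smooth g_homog)

lemma del_g_sym: "z \<in> T \<Longrightarrow> del k (g i j) z = del k (g j i) z"
proof -
  assume z: "z \<in> T"
  have "d_x k (g i j) z = d_x k (g j i) z"
    by (rule d_x_cong_open[OF open_T z g_sym])
  moreover have "d_y r (g i j) z = d_y r (g j i) z" for r
    by (rule d_y_g_sym(2)[OF z])
  ultimately show ?thesis by (simp add: del_def)
qed

lemma gam_sym: "z \<in> T \<Longrightarrow> gam l q k z = gam l k q z"
  unfolding gam_def using del_g_sym[of z l q k] by simp

lemma gam_metric: "z \<in> T \<Longrightarrow> gam l q k z + gam q l k z = del k (g l q) z"
  unfolding gam_def using del_g_sym[of z k q l] by (simp add: field_simps)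

end

section \<open>The Chern connection forms of a given frame\<close>

context finsler_frame
begin

text \<open>The inhomogeneous term u^-1 du of a change of frame.\<close>

definition "A_form i j z V = (\<Sum>p\<in>UNIV. U i p z * dir_deriv (u j) z V $ p)"

text \<open>The tensorial part. By \<open>U_eq\<close> the inverse frame matrix is u g, so its
  contraction with the raised Christoffel symbol is u contracted with \<open>gam\<close>.\<close>

definition "B_form i j z V =
  (\<Sum>l\<in>UNIV. \<Sum>q\<in>UNIV. \<Sum>k\<in>UNIV. u i z $ l * u j z $ q * gam l q k z * fst V $ k)" for V :: "'n tm"

text \<open>The Levi-Civita-type formula for the Chern connection, transformed to the frame \<open>u\<close>.\<close>

definition "chern_form i j z V = A_form i j z V + B_form i j z V"

lemma u_homog: "homog_on W 0 (u i)"
  using frame by (simp add: adapted_frame_def homog_on_def)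

lemma u_diff: "z \<in> W \<Longrightarrow> u i differentiable at z"
  by (rule smooth_on_differentiable[OF u_smooth])

lemma U_diff: "z \<in> W \<Longrightarrow> (U i p) differentiable at z"
  by (rule smooth_on_differentiable[OF U_smooth])

lemma dir_deriv_u_nth: "z \<in> W \<Longrightarrow> dir_deriv (\<lambda>z. u i z $ p) z V = dir_deriv (u i) z V $ p"
  by (rule dir_deriv_eqI) (intro bounded_linear.has_derivative[OF bounded_linear_vec_nth] dir_deriv_works u_diff)

lemma u_nth_diff: "z \<in> W \<Longrightarrow> (\<lambda>z. u i z $ p) differentiable at z"
  by (rule smooth_on_differentiable[OF smooth_on_vec_nth[OF open_W u_smooth]])

lemma chern_form_linear:
  assumes "z \<in> W"
  shows "linear (chern_form i j z)"
proof (rule linearI)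
  interpret linear "dir_deriv (u j) z" by (rule dir_deriv_linear[OF u_diff[OF assms]])
  show "chern_form i j z (V + V') = chern_form i j z V + chern_form i j z V'" for V V'
    by (simp add: chern_form_def A_form_def B_form_def add distrib_left sum.distrib)
  show "chern_form i j z (c *\<^sub>R V) = c *\<^sub>R chern_form i j z V" for c V
    by (simp add: chern_form_def A_form_def B_form_def scale distrib_left sum_distrib_left mult_ac)
qed

lemma chern_form_smooth: "smooth_on W (\<lambda>z. chern_form i j z V)"
  unfolding chern_form_def A_form_def B_form_def
  by (intro smooth_on_add smooth_on_sum smooth_on_mult smooth_on_vec_nth smooth_on_dir_deriv
      smooth_on_const U_smooth u_smooth smooth_W gam_smooth open_W)

lemma chern_form_on_SM: "form1_on_SM W (chern_form i j)"
  unfolding form1_on_SM_def smooth_form1_on_def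
proof (intro conjI ballI allI impI chern_form_linear chern_form_smooth)
  fix x y assume xy: "(x, y) \<in> W"
  have "dir_deriv (u j) (x, y) (0, y) = 0"
    using homog_on_euler[OF conic_W u_homog u_smooth xy] by simp
  then show "chern_form i j (x, y) (0, y) = 0"
    by (simp add: chern_form_def A_form_def B_form_def)
  fix t :: real and a b assume t: "t > 0"
  have u: "u i (x, t *\<^sub>R y) = u i (x, y)" for i
    using homog_onD[OF u_homog xy t] by simp
  have "U i p (x, t *\<^sub>R y) = U i p (x, y)" for i p
    by (simp add: u_inv_def u)
  moreover have "dir_deriv (u j) (x, t *\<^sub>R y) (a, t *\<^sub>R b) = dir_deriv (u j) (x, y) (a, b)"
    using homog_on_dir_deriv[OF conic_W u_homog u_smooth xy t] by simp
  moreover have "gam l q k (x, t *\<^sub>R y) = gam l q k (x, y)" for l q k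
    using homog_onD[OF gam_homog WT[OF xy] t] by simp
  ultimately show "chern_form i j (x, t *\<^sub>R y) (a, t *\<^sub>R b) = chern_form i j (x, y) (a, b)"
    by (simp add: chern_form_def A_form_def B_form_def u)
qed

lemma sum_coframe_u:
  assumes "z \<in> W"
  shows "(\<Sum>k\<in>UNIV. coframe_h u k z V * u k z $ j) = fst V $ j"
proof -
  have "(\<Sum>k\<in>UNIV. coframe_h u k z V * u k z $ j) = (\<Sum>l\<in>UNIV. (\<Sum>k\<in>UNIV. u k z $ j * U k l z) * fst V $ l)"
    unfolding coframe_h_def sum_distrib_right by (subst sum.swap) (simp add: mult_ac)
  then show ?thesis by (simp add: u_U[OF assms])
qed

text \<open>Differentiating the constant product of the frame matrix and its inverse expresses the
  derivative of the inverse through \<open>A_form\<close>; thus \<open>A_form\<close> alone already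
  produces the exterior derivative of the coframe.\<close>

lemma dir_deriv_coframe_h:
  assumes z: "z \<in> W"
  shows "dir_deriv (\<lambda>z'. coframe_h u i z' w) z v = - (\<Sum>k\<in>UNIV. A_form i k z v * coframe_h u k z w)"
proof -
  have UU: "(\<Sum>j\<in>UNIV. dir_deriv (U i j) z v * u k z $ j) = - A_form i k z v" for k
  proof -
    have "dir_deriv (\<lambda>z. \<Sum>j\<in>UNIV. U i j z * u k z $ j) z v = dir_deriv (\<lambda>z. if i = k then 1 else 0) z v"
      by (rule dir_deriv_cong_open[OF open_W z U_u])
    moreover have "dir_deriv (\<lambda>z. \<Sum>j\<in>UNIV. U i j z * u k z $ j) z v =
        (\<Sum>j\<in>UNIV. U i j z * dir_deriv (\<lambda>z. u k z $ j) z v + dir_deriv (U i j) z v * u k z $ j)"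
      by (intro dir_deriv_sum_mult U_diff u_nth_diff z)
    ultimately show ?thesis
      by (simp add: dir_deriv_u_nth[OF z] A_form_def sum.distrib)
  qed
  have "dir_deriv (\<lambda>z'. coframe_h u i z' w) z v =
      (\<Sum>j\<in>UNIV. U i j z * dir_deriv (\<lambda>z. fst w $ j) z v + dir_deriv (U i j) z v * fst w $ j)"
    unfolding coframe_h_def by (intro dir_deriv_sum_mult U_diff differentiable_const z)
  also have "\<dots> = (\<Sum>j\<in>UNIV. dir_deriv (U i j) z v * (\<Sum>k\<in>UNIV. coframe_h u k z w * u k z $ j))"
    by (simp add: sum_coframe_u[OF z])
  also have "\<dots> = (\<Sum>k\<in>UNIV. (\<Sum>j\<in>UNIV. dir_deriv (U i j) z v * u k z $ j) * coframe_h u k z w)"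
    unfolding sum_distrib_left sum_distrib_right by (subst sum.swap) (simp add: mult_ac)
  also have "\<dots> = - (\<Sum>k\<in>UNIV. A_form i k z v * coframe_h u k z w)"
    by (simp add: UU sum_negf)
  finally show ?thesis .
qed

lemma sum_coframe_B:
  assumes "z \<in> W"
  shows "(\<Sum>j\<in>UNIV. coframe_h u j z V * B_form i j z V') =
    (\<Sum>l\<in>UNIV. \<Sum>q\<in>UNIV. \<Sum>k\<in>UNIV. u i z $ l * gam l q k z * fst V $ q * fst V' $ k)"
proof -
  have "(\<Sum>j\<in>UNIV. coframe_h u j z V * B_form i j z V') =
    (\<Sum>j\<in>UNIV. \<Sum>l\<in>UNIV. \<Sum>q\<in>UNIV. coframe_h u j z V * u j z $ q * (\<Sum>k\<in>UNIV. u i z $ l * gam l q k z * fst V' $ k))"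
    by (simp add: B_form_def sum_distrib_left mult_ac)
  also have "\<dots> = (\<Sum>l\<in>UNIV. \<Sum>q\<in>UNIV. fst V $ q * (\<Sum>k\<in>UNIV. u i z $ l * gam l q k z * fst V' $ k))"
    unfolding sum_triple_swap[of "\<lambda>j l q. coframe_h u j z V * u j z $ q * _ l q"] sum_distrib_right[symmetric]
      sum_coframe_u[OF assms] ..
  finally show ?thesis by (simp add: sum_distrib_left mult_ac)
qed

text \<open>The contribution of \<open>B_form\<close> is symmetric in the two vectors, as
  \<open>gam\<close> is symmetric in its last two indices, so the wedge product removes it.\<close>

lemma chern_form_torsion:
  assumes z: "z \<in> W"
  shows "ext_d (coframe_h u i) z V V' = (\<Sum>j\<in>UNIV. wedge (coframe_h u j) (chern_form i j) z V V')"
proof -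
  have "(\<Sum>j\<in>UNIV. coframe_h u j z V * B_form i j z V') = (\<Sum>j\<in>UNIV. coframe_h u j z V' * B_form i j z V)"
    unfolding sum_coframe_B[OF z]
    by (rule sum.cong[OF refl], subst sum.swap) (simp add: gam_sym[OF WT[OF z]] mult_ac)
  then have "(\<Sum>j\<in>UNIV. wedge (coframe_h u j) (chern_form i j) z V V') =
     (\<Sum>j\<in>UNIV. coframe_h u j z V * A_form i j z V') - (\<Sum>j\<in>UNIV. coframe_h u j z V' * A_form i j z V)"
    by (simp add: wedge_def chern_form_def distrib_left sum.distrib sum_subtractf)
  then show ?thesis
    unfolding ext_d_def dir_deriv_coframe_h[OF z] by (simp add: mult.commute)
qed

text \<open>This is the derivative of the constant function g(u_i, u_j).\<close>

lemma A_form_metric: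
  assumes z: "z \<in> W"
  shows "A_form i j z V + A_form j i z V =
    - (\<Sum>p\<in>UNIV. \<Sum>q\<in>UNIV. u i z $ p * u j z $ q * dir_deriv (g p q) z V)"
proof -
  have gd: "(g p q) differentiable at z" for p q
    by (rule smooth_on_differentiable[OF g_smooth WT[OF z]])
  have "dir_deriv (\<lambda>z. \<Sum>p\<in>UNIV. \<Sum>q\<in>UNIV. u i z $ p * g p q z * u j z $ q) z V =
      dir_deriv (\<lambda>z. if i = j then 1 else 0) z V"
    by (rule dir_deriv_cong_open[OF open_W z u_orth])
  also have "\<dots> = 0" by simp
  finally have "0 = dir_deriv (\<lambda>z. \<Sum>p\<in>UNIV. \<Sum>q\<in>UNIV. u i z $ p * g p q z * u j z $ q) z V" by simp
  also have "\<dots> = (\<Sum>p\<in>UNIV. dir_deriv (\<lambda>z. \<Sum>q\<in>UNIV. u i z $ p * g p q z * u j z $ q) z V)"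
    by (rule dir_deriv_sum) (intro differentiable_sum ballI differentiable_mult u_nth_diff gd z finite)
  also have "\<dots> = (\<Sum>p\<in>UNIV. \<Sum>q\<in>UNIV. u i z $ p * g p q z * dir_deriv (u j) z V $ q +
      (u i z $ p * dir_deriv (g p q) z V + dir_deriv (u i) z V $ p * g p q z) * u j z $ q)"
    by (simp add: dir_deriv_sum_mult dir_deriv_mult u_nth_diff gd z differentiable_mult dir_deriv_u_nth[OF z])
  also have "\<dots> = (\<Sum>p\<in>UNIV. \<Sum>q\<in>UNIV. u i z $ p * g p q z * dir_deriv (u j) z V $ q) +
      (\<Sum>p\<in>UNIV. \<Sum>q\<in>UNIV. u i z $ p * u j z $ q * dir_deriv (g p q) z V) +
      (\<Sum>p\<in>UNIV. \<Sum>q\<in>UNIV. dir_deriv (u i) z V $ p * g p q z * u j z $ q)"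
    by (simp add: distrib_right distrib_left sum.distrib mult_ac)
  also have "(\<Sum>p\<in>UNIV. \<Sum>q\<in>UNIV. u i z $ p * g p q z * dir_deriv (u j) z V $ q) = A_form i j z V"
    unfolding A_form_def U_eq[OF z] sum_distrib_right by (rule sum.swap)
  also have "(\<Sum>p\<in>UNIV. \<Sum>q\<in>UNIV. dir_deriv (u i) z V $ p * g p q z * u j z $ q) = A_form j i z V"
    unfolding A_form_def U_eq[OF z] sum_distrib_right
    by (simp add: g_sym[OF WT[OF z], of _ _] mult_ac)
  finally show ?thesis by simp
qed

lemma B_form_metric:
  assumes z: "z \<in> W"
  shows "B_form i j z V + B_form j i z V =
    (\<Sum>p\<in>UNIV. \<Sum>q\<in>UNIV. u i z $ p * u j z $ q * (\<Sum>k\<in>UNIV. del k (g p q) z * fst V $ k))"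
proof -
  have "B_form j i z V = (\<Sum>p\<in>UNIV. \<Sum>q\<in>UNIV. \<Sum>k\<in>UNIV. u i z $ p * u j z $ q * gam q p k z * fst V $ k)"
    unfolding B_form_def by (subst sum.swap) (simp add: mult_ac)
  moreover have "B_form i j z V = (\<Sum>p\<in>UNIV. \<Sum>q\<in>UNIV. \<Sum>k\<in>UNIV. u i z $ p * u j z $ q * gam p q k z * fst V $ k)"
    by (simp add: B_form_def)
  ultimately have "B_form i j z V + B_form j i z V =
    (\<Sum>p\<in>UNIV. \<Sum>q\<in>UNIV. \<Sum>k\<in>UNIV. u i z $ p * u j z $ q * (gam p q k z + gam q p k z) * fst V $ k)"
    by (simp add: sum.distrib distrib_left distrib_right)
  then show ?thesis
    unfolding gam_metric[OF WT[OF z]] by (simp add: sum_distrib_left mult_ac)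
qed

text \<open>g has degree 0, so the Cartan tensor annihilates y. Hence the index m, whose
  \<open>coframe_v\<close> does not annihilate the radial field, can be added to the sum in
  \<open>sum_H_coframe\<close>.\<close>

lemma H_coeff_m:
  assumes z: "z \<in> W"
  shows "H_coeff F u i j m z = 0"
proof -
  have "(\<Sum>k\<in>UNIV. cartan F p q k z * u m z $ k) = 0" for p q
    using homog_on_euler_sum[OF conic_T g_homog g_smooth WT[OF z], of p q] F_nz[OF z]
    by (simp add: cartan_eq[OF WT[OF z]] u_m[OF z] mult_ac flip: sum_divide_distrib)
  moreover have "H_coeff F u i j m z =
    - (\<Sum>p\<in>UNIV. \<Sum>q\<in>UNIV. u i z $ p * u j z $ q * (\<Sum>k\<in>UNIV. cartan F p q k z * u m z $ k))"
    by (simp add: H_coeff_def sum_distrib_left mult_ac)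
  ultimately show ?thesis by simp
qed

lemma sum_H_coframe:
  assumes z: "z \<in> W"
  shows "2 * (\<Sum>\<gamma>\<in>- {m}. H_coeff F u i j \<gamma> z * coframe_v F u \<gamma> z V) =
    (\<Sum>p\<in>UNIV. \<Sum>q\<in>UNIV. u i z $ p * u j z $ q * (\<Sum>k\<in>UNIV. d_y k (g p q) z * delta_y F k z V))"
proof -
  have cv: "(\<Sum>\<gamma>\<in>UNIV. u \<gamma> z $ k * coframe_v F u \<gamma> z V) = - (1 / F z) * delta_y F k z V" for k
  proof -
    have "(\<Sum>\<gamma>\<in>UNIV. u \<gamma> z $ k * coframe_v F u \<gamma> z V) =
        - (1 / F z) * (\<Sum>j\<in>UNIV. (\<Sum>\<gamma>\<in>UNIV. u \<gamma> z $ k * U \<gamma> j z) * delta_y F j z V)"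
      unfolding coframe_v_def sum_distrib_left sum_distrib_right
      by (subst sum.swap) (simp add: mult_ac)
    then show ?thesis by (simp add: u_U[OF z])
  qed
  have "(\<Sum>\<gamma>\<in>- {m}. H_coeff F u i j \<gamma> z * coframe_v F u \<gamma> z V) =
      (\<Sum>\<gamma>\<in>UNIV. H_coeff F u i j \<gamma> z * coframe_v F u \<gamma> z V)"
    by (rule sum.mono_neutral_left) (auto simp: H_coeff_m[OF z])
  also have "\<dots> = - (\<Sum>\<gamma>\<in>UNIV. \<Sum>p\<in>UNIV. \<Sum>q\<in>UNIV. u i z $ p * u j z $ q *
      (\<Sum>k\<in>UNIV. cartan F p q k z * (u \<gamma> z $ k * coframe_v F u \<gamma> z V)))"
    by (simp add: H_coeff_def sum_distrib_left sum_distrib_right sum_negf mult_ac)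
  also have "\<dots> = - (\<Sum>p\<in>UNIV. \<Sum>q\<in>UNIV. u i z $ p * u j z $ q *
      (\<Sum>k\<in>UNIV. cartan F p q k z * (\<Sum>\<gamma>\<in>UNIV. u \<gamma> z $ k * coframe_v F u \<gamma> z V)))"
  proof -
    have "(\<Sum>\<gamma>\<in>UNIV. \<Sum>k\<in>UNIV. cartan F p q k z * (u \<gamma> z $ k * coframe_v F u \<gamma> z V)) =
       (\<Sum>k\<in>UNIV. cartan F p q k z * (\<Sum>\<gamma>\<in>UNIV. u \<gamma> z $ k * coframe_v F u \<gamma> z V))" for p q
      unfolding sum_distrib_left by (rule sum.swap)
    then show ?thesis
      unfolding sum_triple_swap[of "\<lambda>\<gamma> p q. u i z $ p * u j z $ q * (\<Sum>k\<in>UNIV. cartan F p q k z * (u \<gamma> z $ k * coframe_v F u \<gamma> z V))"]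
      by (simp flip: sum_distrib_left)
  qed
  finally show ?thesis
    unfolding cv cartan_eq[OF WT[OF z]] using F_nz[OF z]
    by (simp add: sum_distrib_left sum_negf mult_ac)
qed

text \<open>The derivative of g splits into a horizontal and a vertical part. \<open>B_form\<close>
  compensates the horizontal one; the vertical one is left over and is the Cartan term of the almost
  metric condition.\<close>

lemma chern_connection_chern_form: "chern_connection F W m u chern_form"
  unfolding chern_connection_def
proof (intro conjI ballI allI chern_form_on_SM chern_form_torsion)
  fix z i j V assume z: "z \<in> W"
  have "chern_form i j z V + chern_form j i z V =
      (A_form i j z V + A_form j i z V) + (B_form i j z V + B_form j i z V)"
    by (simp add: chern_form_def)
  also have "\<dots> = - (\<Sum>p\<in>UNIV. \<Sum>q\<in>UNIV. u i z $ p * u j z $ q * (\<Sum>k\<in>UNIV. d_y k (g p q) z * delta_y F k z V))"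
    unfolding A_form_metric[OF z] B_form_metric[OF z] dir_deriv_del[OF g_smooth WT[OF z]]
    by (simp add: distrib_left sum.distrib)
  also have "\<dots> = - 2 * (\<Sum>\<gamma>\<in>- {m}. H_coeff F u i j \<gamma> z * coframe_v F u \<gamma> z V)"
    using sum_H_coframe[OF z, of i j V] by simp
  finally show "chern_form i j z V + chern_form j i z V =
    - 2 * (\<Sum>\<gamma>\<in>- {m}. H_coeff F u i j \<gamma> z * coframe_v F u \<gamma> z V)" .
qed

end

section \<open>Rigidity on the fibres\<close>

subsection \<open>Integrals of derivatives of compactly supported functions\<close>

text \<open>Translation along \<open>v\<close> leaves the integral of \<open>p\<close> unchanged, so
  the derivative under the integral sign is 0. The box has a margin of 1 around the support, which
  for norm v \<le> 1 and |t| < 1 keeps every translate inside.\<close>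

lemma integral_dir_deriv_eq_0:
  fixes p :: "'a::euclidean_space \<Rightarrow> real"
  assumes diff: "\<And>y. p differentiable at y"
    and cont: "continuous_on UNIV (\<lambda>y. dir_deriv p y v)"
    and supp: "\<And>y. norm y \<ge> R \<Longrightarrow> p y = 0"
    and v: "norm v \<le> 1"
  shows "integral (cbox (- ((R + 1) *\<^sub>R One)) ((R + 1) *\<^sub>R One)) (\<lambda>y. dir_deriv p y v) = 0"
proof -
  define a where "a = - ((R + 1) *\<^sub>R (One :: 'a))"
  define b where "b = (R + 1) *\<^sub>R (One :: 'a)"
  define U where "U = {- 1 <..< 1 :: real}"
  have p_cont: "continuous_on UNIV p"
    using diff by (simp add: continuous_at_imp_continuous_on differentiable_imp_continuous_within)
  have inK: "y \<in> cbox a b" if "norm y < R + 1" for y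
  proof -
    have "\<bar>y \<bullet> i\<bar> < R + 1" if "i \<in> Basis" for i
      using Basis_le_norm[OF that, of y] \<open>norm y < R + 1\<close> by linarith
    then show ?thesis by (fastforce simp: mem_box a_def b_def abs_less_iff)
  qed
  define I where "I t = integral (cbox a b) (\<lambda>y. p (y + t *\<^sub>R v))" for t
  have I_const: "I t = integral UNIV p" if "t \<in> U" for t
  proof -
    have tv: "norm (t *\<^sub>R v) < 1"
    proof -
      have "norm (t *\<^sub>R v) \<le> \<bar>t\<bar>" using v by (simp add: mult_left_le)
      also have "\<dots> < 1" using that by (auto simp: U_def)
      finally show ?thesis .
    qed
    have out: "p (y + t *\<^sub>R v) = 0" if "y \<notin> cbox a b" for y
    proof (rule supp)
      have "norm y \<ge> R + 1" using inK[of y] that by force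
      then show "norm (y + t *\<^sub>R v) \<ge> R"
        using norm_triangle_ineq2[of y "- (t *\<^sub>R v)"] tv by simp
    qed
    have out2: "p (y + t *\<^sub>R v) = 0" if "y \<notin> cbox (a - t *\<^sub>R v) (b - t *\<^sub>R v)" for y
    proof (rule supp)
      have "y + t *\<^sub>R v \<notin> cbox a b"
        using that by (auto simp: mem_box algebra_simps)
      then show "norm (y + t *\<^sub>R v) \<ge> R" using inK[of "y + t *\<^sub>R v"] by force
    qed
    have out3: "p y = 0" if "y \<notin> cbox a b" for y
    proof (rule supp)
      show "norm y \<ge> R" using inK[of y] that by force
    qed
    have "I t = integral UNIV (\<lambda>y. if y \<in> cbox a b then p (y + t *\<^sub>R v) else 0)"
      unfolding I_def by (rule integral_restrict_UNIV[symmetric])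
    \<comment> \<open>Both boxes contain the support of the translate; the shifted one is the one
      that the change of variables carries back to the original box.\<close>
    also have "\<dots> = integral UNIV (\<lambda>y. if y \<in> cbox (a - t *\<^sub>R v) (b - t *\<^sub>R v) then p (y + t *\<^sub>R v) else 0)"
      using out out2 by (intro arg_cong[of _ _ "integral UNIV"]) auto
    also have "\<dots> = integral (cbox (a - t *\<^sub>R v) (b - t *\<^sub>R v)) (\<lambda>y. p (y + t *\<^sub>R v))"
      by (rule integral_restrict_UNIV)
    also have "\<dots> = integral (cbox a b) p" by (rule integral_shift_cbox)
    also have "\<dots> = integral UNIV (\<lambda>y. if y \<in> cbox a b then p y else 0)"
      by (rule integral_restrict_UNIV[symmetric])
    also have "\<dots> = integral UNIV p"
      using out3 by (intro arg_cong[of _ _ "integral UNIV"]) auto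
    finally show ?thesis .
  qed
  have D0: "(I has_real_derivative integral (cbox a b) (\<lambda>y. dir_deriv p (y + 0 *\<^sub>R v) v)) (at 0 within U)"
    unfolding I_def
  proof (rule leibniz_rule_field_derivative)
    fix t y
    have "((\<lambda>t. y + t *\<^sub>R v) has_derivative (\<lambda>s. s *\<^sub>R v)) (at t)"
      by (auto intro!: derivative_eq_intros)
    from diff_chain_at[OF this dir_deriv_works[OF diff]]
    have "((\<lambda>t. p (y + t *\<^sub>R v)) has_derivative (\<lambda>s. s * dir_deriv p (y + t *\<^sub>R v) v)) (at t)"
      by (simp add: o_def linear_scale[OF dir_deriv_linear[OF diff]])
    moreover have "(\<lambda>s. s * c) = (*) c" for c :: real by (simp add: fun_eq_iff)
    ultimately have "((\<lambda>t. p (y + t *\<^sub>R v)) has_real_derivative dir_deriv p (y + t *\<^sub>R v) v) (at t)"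
      by (simp add: has_field_derivative_def)
    then show "((\<lambda>t. p (y + t *\<^sub>R v)) has_real_derivative dir_deriv p (y + t *\<^sub>R v) v) (at t within U)"
      by (rule has_field_derivative_at_within)
  next
    show "(\<lambda>y. p (y + t *\<^sub>R v)) integrable_on cbox a b" for t
      by (intro integrable_continuous continuous_on_compose2[OF p_cont] continuous_intros) auto
    have "continuous_on (U \<times> cbox a b) (\<lambda>q. dir_deriv p (snd q + fst q *\<^sub>R v) v)"
      by (intro continuous_on_compose2[OF cont] continuous_intros) auto
    then show "continuous_on (U \<times> cbox a b) (\<lambda>(t, y). dir_deriv p (y + t *\<^sub>R v) v)"
      by (simp add: case_prod_unfold)
  qed (auto simp: U_def)
  have U: "open U" "0 \<in> U" by (auto simp: U_def)
  from D0 have D: "(I has_real_derivative integral (cbox a b) (\<lambda>y. dir_deriv p y v)) (at 0)"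
    unfolding at_within_open[OF U(2,1)] scaleR_zero_left add_0_right .
  have "integral (cbox a b) (\<lambda>y. dir_deriv p y v) = 0"
  proof (rule DERIV_local_const[OF D, of 1])
    show "\<forall>t. \<bar>0 - t\<bar> < 1 \<longrightarrow> I 0 = I t"
    proof (intro allI impI)
      fix t :: real assume "\<bar>0 - t\<bar> < 1"
      then have "t \<in> U" "0 \<in> U" by (auto simp: U_def abs_less_iff)
      then show "I 0 = I t" by (simp only: I_const)
    qed
  qed simp
  then show ?thesis by (simp add: a_def b_def)
qed

text \<open>A profile for functions of F^2, supported in [1, 2], so that its pull-back to a fibre
  has compact support away from the origin. Squaring the positive part makes it C^1, enough for one
  integration by parts.\<close>

definition bump :: "real \<Rightarrow> real" where
  "bump e = (max 0 ((e - 1) * (2 - e)))\<^sup>2"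

definition bump' :: "real \<Rightarrow> real" where
  "bump' e = 2 * max 0 ((e - 1) * (2 - e)) * (3 - 2 * e)"

lemma has_derivative_max_0_power2:
  "((\<lambda>s. (max 0 s)\<^sup>2) has_real_derivative 2 * max 0 s) (at (s::real))"
proof -
  consider "s > 0" | "s < 0" | "s = 0" by linarith
  then show ?thesis
  proof cases
    case 1
    have "((\<lambda>s. s\<^sup>2) has_real_derivative 2 * max 0 s) (at s)"
      using 1 by (auto intro!: derivative_eq_intros)
    then show ?thesis
      by (rule DERIV_cong_ev[OF refl _ refl, THEN iffD1, rotated])
        (use eventually_nhds_in_open[of "{0<..}" s] 1 in \<open>auto elim!: eventually_mono\<close>)
  next
    case 2
    have "((\<lambda>s. 0) has_real_derivative 2 * max 0 s) (at s)"
      using 2 by simp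
    then show ?thesis
      by (rule DERIV_cong_ev[OF refl _ refl, THEN iffD1, rotated])
        (use eventually_nhds_in_open[of "{..<0}" s] 2 in \<open>auto elim!: eventually_mono\<close>)
  next
    case 3
    have "((\<lambda>h. (max 0 h)\<^sup>2 / h) \<longlongrightarrow> 0) (at (0::real))"
    proof (rule Lim_null_comparison)
      have "norm ((max 0 h)\<^sup>2 / h) \<le> \<bar>h\<bar>" for h :: real
        by (cases "h \<ge> 0") (auto simp: power2_eq_square max_def)
      then show "\<forall>\<^sub>F h in at 0. norm ((max 0 h)\<^sup>2 / h) \<le> \<bar>h :: real\<bar>" by simp
      show "((\<lambda>h. \<bar>h\<bar>) \<longlongrightarrow> 0) (at (0::real))"
        by (rule tendsto_rabs_zero) (rule tendsto_ident_at)
    qed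
    then show ?thesis using 3 by (simp add: DERIV_def)
  qed
qed

lemma bump_deriv: "(bump has_real_derivative bump' e) (at e)"
proof -
  have "((\<lambda>e. (e - 1) * (2 - e)) has_real_derivative (3 - 2 * e)) (at e)"
    by (auto intro!: derivative_eq_intros simp: algebra_simps)
  from DERIV_chain2[OF has_derivative_max_0_power2 this]
  show ?thesis by (simp add: bump_def[abs_def] bump'_def)
qed

lemma bump_zero: "e \<le> 1 \<or> e \<ge> 2 \<Longrightarrow> bump e = 0" "e \<le> 1 \<or> e \<ge> 2 \<Longrightarrow> bump' e = 0"
proof -
  assume "e \<le> 1 \<or> e \<ge> 2"
  then have "(e - 1) * (2 - e) \<le> 0" by (auto simp: mult_le_0_iff)
  then show "bump e = 0" "bump' e = 0" by (auto simp: bump_def bump'_def)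
qed

lemma bump_pos: "1 < e \<Longrightarrow> e < 2 \<Longrightarrow> bump e > 0"
  by (simp add: bump_def less_max_iff_disj)

lemma bump_nonneg: "bump e \<ge> 0"
  by (simp add: bump_def)

lemma bump_continuous: "continuous_on UNIV bump" "continuous_on UNIV bump'"
  unfolding bump_def[abs_def] bump'_def[abs_def] by (intro continuous_intros)+

context finsler_chart
begin

subsection \<open>The divergence identity\<close>

lemma d_y_gi:
  assumes z: "z \<in> T"
  shows "d_y c (gi l j) z =
    - (\<Sum>i\<in>UNIV. \<Sum>k\<in>UNIV. gi l i z * d_y c (g i k) z * gi k j z)"
proof -
  have *: "(\<Sum>k\<in>UNIV. g i k z * d_y c (gi k j) z) = - (\<Sum>k\<in>UNIV. d_y c (g i k) z * gi k j z)" for i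
  proof -
    have "d_y c (\<lambda>z. \<Sum>k\<in>UNIV. g i k z * gi k j z) z = d_y c (\<lambda>z. if i = j then 1 else 0) z"
      by (rule d_y_cong_open[OF open_T z g_gi])
    moreover have "d_y c (\<lambda>z. \<Sum>k\<in>UNIV. g i k z * gi k j z) z =
        (\<Sum>k\<in>UNIV. g i k z * d_y c (gi k j) z + d_y c (g i k) z * gi k j z)"
      unfolding d_y_def
      by (rule dir_deriv_sum_mult) (rule smooth_on_differentiable[OF _ z], rule g_smooth gi_smooth)+
    ultimately show ?thesis by (simp add: d_y_def sum.distrib)
  qed
  have "d_y c (gi l j) z = (\<Sum>k\<in>UNIV. (\<Sum>i\<in>UNIV. gi l i z * g i k z) * d_y c (gi k j) z)"
    by (simp add: gi_g[OF z])
  also have "\<dots> = (\<Sum>i\<in>UNIV. gi l i z * (\<Sum>k\<in>UNIV. g i k z * d_y c (gi k j) z))"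
    unfolding sum_distrib_left sum_distrib_right by (subst sum.swap) (simp add: mult.assoc)
  finally show ?thesis
    by (simp add: * sum_negf sum_distrib_left mult.assoc)
qed

text \<open>Up to sign, the vertical derivative of g with all three indices raised, hence totally
  symmetric.\<close>

definition "dgi l j m z = (\<Sum>i\<in>UNIV. gi l i z * d_y i (gi j m) z)"

lemma dgi_eq:
  assumes z: "z \<in> T"
  shows "dgi l j m z = - (\<Sum>i\<in>UNIV. \<Sum>a\<in>UNIV. gi l i z * gi j a z * (\<Sum>b\<in>UNIV. d_y i (g a b) z * gi b m z))"
  by (simp add: dgi_def d_y_gi[OF z] sum_negf sum_distrib_left mult_ac)

lemma dgi_sym:
  assumes z: "z \<in> T"
  shows "dgi l j m z = dgi j l m z" "dgi l j m z = dgi l m j z"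
proof -
  have "d_y i (g a b) z = d_y a (g i b) z" for i a b
    using d_y_g_sym[OF z, of i a b] d_y_g_sym[OF z, of i b a] d_y_g_sym[OF z, of a i b] by simp
  then show "dgi l j m z = dgi j l m z"
    unfolding dgi_eq[OF z] by (subst sum.swap) (simp add: mult_ac)
  have "d_y i (gi j m) z = d_y i (gi m j) z" for i
    by (rule d_y_cong_open[OF open_T z gi_sym])
  then show "dgi l j m z = dgi l m j z" by (simp add: dgi_def)
qed

lemma d_y_det_g:
  assumes z: "z \<in> T"
  shows "d_y j (\<lambda>z. det (g_mat F z)) z = 2 * det (g_mat F z) * d_y j lam z"
proof -
  have "d_y j (\<lambda>z. det (g_mat F z)) z = det (g_mat F z) *
      (\<Sum>i\<in>UNIV. \<Sum>k\<in>UNIV. gi i k z * d_y j (g k i) z)"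
    unfolding d_y_def using det_g_pos[OF z] smooth_on_differentiable[OF g_smooth z]
    by (intro dir_deriv_det) auto
  then show ?thesis by (simp add: d_y_lam[OF z])
qed

text \<open>\<open>g\<close> is the Hessian of \<open>F\<^sup>2/2\<close>, and \<open>det g g\<^sup>j\<^sup>m\<close> is its cofactor matrix.\<close>

lemma cofactor_divergence_free:
  assumes z: "z \<in> T"
  shows "(\<Sum>j\<in>UNIV. d_y j (\<lambda>z. det (g_mat F z) * gi j m z) z) = 0"
proof -
  have "d_y j (\<lambda>z. det (g_mat F z) * gi j m z) z =
      det (g_mat F z) * (d_y j (gi j m) z + 2 * d_y j lam z * gi j m z)" for j
  proof -
    have "d_y j (\<lambda>z. det (g_mat F z) * gi j m z) z =
       det (g_mat F z) * d_y j (gi j m) z + d_y j (\<lambda>z. det (g_mat F z)) z * gi j m z"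
      unfolding d_y_def
      by (rule dir_deriv_mult) (rule smooth_on_differentiable[OF _ z], rule det_g_smooth gi_smooth)+
    then show ?thesis by (simp add: d_y_det_g[OF z] algebra_simps)
  qed
  moreover have "(\<Sum>j\<in>UNIV. d_y j (gi j m) z) = - (\<Sum>j\<in>UNIV. 2 * d_y j lam z * gi j m z)"
  proof -
    have "(\<Sum>j\<in>UNIV. d_y j (gi j m) z) =
      - (\<Sum>j\<in>UNIV. \<Sum>i\<in>UNIV. \<Sum>k\<in>UNIV. gi j i z * d_y k (g i j) z * gi k m z)"
      by (simp add: d_y_gi[OF z] sum_negf d_y_g_sym(1)[OF z])
    also have "\<dots> = - (\<Sum>k\<in>UNIV. (\<Sum>j\<in>UNIV. \<Sum>i\<in>UNIV. gi j i z * d_y k (g i j) z) * gi k m z)"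
      unfolding sum_distrib_right by (subst sum_triple_swap[symmetric]) simp
    finally show ?thesis by (simp add: d_y_lam[OF z])
  qed
  ultimately show ?thesis
    by (simp add: sum.distrib flip: sum_distrib_left)
qed

text \<open>The g-gradient of \<open>f\<close>. Next, \<open>v_field\<close> applies the Hessian to
  it, and \<open>X_field\<close> raises the index with the cofactor matrix of g.\<close>

definition "w_field f l z = (\<Sum>k\<in>UNIV. gi l k z * d_y k f z)"

definition "v_field f i z = (\<Sum>l\<in>UNIV. d_y l (d_y i f) z * w_field f l z)"

definition "X_field f j z = (\<Sum>i\<in>UNIV. (det (g_mat F z) * gi j i z) * v_field f i z)"

text \<open>The squared g-norm of the vertical Hessian.\<close>

definition "Q_form f z = (\<Sum>j\<in>UNIV. \<Sum>i\<in>UNIV. \<Sum>l\<in>UNIV. \<Sum>k\<in>UNIV.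
  gi j i z * d_y l (d_y i f) z * gi l k z * d_y j (d_y k f) z)"

text \<open>These are the properties of \<open>trN\<close> when the curvature conditions hold; the
  trace condition is then e = 0.\<close>

context
  fixes f :: "'n tm \<Rightarrow> real"
  assumes f_smooth: "smooth_on T f" and f_homog: "homog_on T 1 f"
    and f_trace: "\<And>z. z \<in> T \<Longrightarrow> (\<Sum>j\<in>UNIV. \<Sum>i\<in>UNIV. gi j i z * d_y j (d_y i f) z) = 0"
begin

lemma w_smooth: "smooth_on T (w_field f l)"
  unfolding w_field_def[abs_def]
  by (intro smooth_on_sum smooth_on_mult smooth_on_d_y gi_smooth f_smooth open_T)

lemma v_smooth: "smooth_on T (v_field f i)"
  unfolding v_field_def[abs_def]
  by (intro smooth_on_sum smooth_on_mult smooth_on_d_y w_smooth f_smooth open_T)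

lemma X_smooth: "smooth_on T (X_field f j)"
  unfolding X_field_def[abs_def]
  by (intro smooth_on_sum smooth_on_mult gi_smooth det_g_smooth v_smooth open_T)

text \<open>The derivative of the trace condition trades third derivatives of \<open>f\<close> for
  derivatives of g^-1.\<close>

lemma sum_gi_third:
  assumes z: "z \<in> T"
  shows "(\<Sum>j\<in>UNIV. \<Sum>i\<in>UNIV. gi j i z * d_y j (d_y l (d_y i f)) z) =
    - (\<Sum>j\<in>UNIV. \<Sum>i\<in>UNIV. d_y l (gi j i) z * d_y j (d_y i f) z)"
proof -
  have s: "smooth_on T (d_y j (d_y i f))" for i j
    by (intro smooth_on_d_y f_smooth)
  have "d_y l (\<lambda>z. \<Sum>j\<in>UNIV. \<Sum>i\<in>UNIV. gi j i z * d_y j (d_y i f) z) z = d_y l (\<lambda>z. 0) z"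
    by (rule d_y_cong_open[OF open_T z f_trace])
  moreover have "d_y l (\<lambda>z. \<Sum>j\<in>UNIV. \<Sum>i\<in>UNIV. gi j i z * d_y j (d_y i f) z) z =
     (\<Sum>j\<in>UNIV. d_y l (\<lambda>z. \<Sum>i\<in>UNIV. gi j i z * d_y j (d_y i f) z) z)"
    unfolding d_y_def[of l]
    by (intro dir_deriv_sum smooth_on_differentiable[OF _ z] smooth_on_sum smooth_on_mult gi_smooth s open_T)
  moreover have "d_y l (\<lambda>z. \<Sum>i\<in>UNIV. gi j i z * d_y j (d_y i f) z) z =
    (\<Sum>i\<in>UNIV. gi j i z * d_y l (d_y j (d_y i f)) z + d_y l (gi j i) z * d_y j (d_y i f) z)" for j
    unfolding d_y_def[of l]
    by (intro dir_deriv_sum_mult smooth_on_differentiable[OF _ z] gi_smooth s)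
  moreover have "d_y l (d_y j (d_y i f)) z = d_y j (d_y l (d_y i f)) z" for i j
    by (rule d_y_commute[OF open_T smooth_on_d_y[OF f_smooth] z])
  ultimately show ?thesis by (simp add: sum.distrib d_y_def[of l "\<lambda>z. 0"])
qed

text \<open>The cofactor matrix is divergence free, so only \<open>v_field\<close> is
  differentiated. Its third-derivative term and the derivative of g^-1 inside \<open>w_field\<close>
  give the same contraction of \<open>dgi\<close> with opposite signs; what remains is the squared
  Hessian.\<close>

lemma divergence_X:
  assumes z: "z \<in> T"
  shows "(\<Sum>j\<in>UNIV. d_y j (X_field f j) z) = det (g_mat F z) * Q_form f z"
proof -
  have s: "smooth_on T (d_y l (d_y i f))" for i l
    by (intro smooth_on_d_y f_smooth)
  have dw: "d_y j (w_field f l) z = (\<Sum>k\<in>UNIV. gi l k z * d_y j (d_y k f) z + d_y j (gi l k) z * d_y k f z)" for j l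
    unfolding w_field_def[abs_def] d_y_def[of j]
    by (intro dir_deriv_sum_mult smooth_on_differentiable[OF _ z] gi_smooth smooth_on_d_y f_smooth)
  have dv: "d_y j (v_field f i) z =
      (\<Sum>l\<in>UNIV. d_y l (d_y i f) z * d_y j (w_field f l) z + d_y j (d_y l (d_y i f)) z * w_field f l z)" for i j
    unfolding v_field_def[abs_def] d_y_def[of j]
    by (intro dir_deriv_sum_mult smooth_on_differentiable[OF _ z] w_smooth s)
  have "d_y j (X_field f j) z = (\<Sum>i\<in>UNIV. (det (g_mat F z) * gi j i z) * d_y j (v_field f i) z +
      d_y j (\<lambda>z. det (g_mat F z) * gi j i z) z * v_field f i z)" for j
    unfolding X_field_def[abs_def] d_y_def[of j]
    by (intro dir_deriv_sum_mult smooth_on_differentiable[OF _ z] smooth_on_mult gi_smooth det_g_smooth v_smooth open_T)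
  then have "(\<Sum>j\<in>UNIV. d_y j (X_field f j) z) =
      (\<Sum>j\<in>UNIV. \<Sum>i\<in>UNIV. (det (g_mat F z) * gi j i z) * d_y j (v_field f i) z) +
      (\<Sum>j\<in>UNIV. \<Sum>i\<in>UNIV. d_y j (\<lambda>z. det (g_mat F z) * gi j i z) z * v_field f i z)"
    by (simp add: sum.distrib)
  also have "(\<Sum>j\<in>UNIV. \<Sum>i\<in>UNIV. d_y j (\<lambda>z. det (g_mat F z) * gi j i z) z * v_field f i z) = 0"
    by (subst sum.swap) (simp add: cofactor_divergence_free[OF z] flip: sum_distrib_right)
  finally have 1: "(\<Sum>j\<in>UNIV. d_y j (X_field f j) z) =
      det (g_mat F z) * (\<Sum>j\<in>UNIV. \<Sum>i\<in>UNIV. gi j i z * d_y j (v_field f i) z)"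
    by (simp add: sum_distrib_left mult.assoc)
  have "(\<Sum>j\<in>UNIV. \<Sum>i\<in>UNIV. gi j i z * d_y j (v_field f i) z) =
      (\<Sum>j\<in>UNIV. \<Sum>i\<in>UNIV. \<Sum>l\<in>UNIV. gi j i z * d_y l (d_y i f) z * d_y j (w_field f l) z) +
      (\<Sum>j\<in>UNIV. \<Sum>i\<in>UNIV. \<Sum>l\<in>UNIV. gi j i z * d_y j (d_y l (d_y i f)) z * w_field f l z)"
    by (simp add: dv sum.distrib distrib_left sum_distrib_left mult.assoc)
  also have "(\<Sum>j\<in>UNIV. \<Sum>i\<in>UNIV. \<Sum>l\<in>UNIV. gi j i z * d_y j (d_y l (d_y i f)) z * w_field f l z) =
      (\<Sum>l\<in>UNIV. (\<Sum>j\<in>UNIV. \<Sum>i\<in>UNIV. gi j i z * d_y j (d_y l (d_y i f)) z) * w_field f l z)"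
    unfolding sum_distrib_right by (rule sum_triple_swap[symmetric])
  also have "\<dots> = - (\<Sum>l\<in>UNIV. \<Sum>j\<in>UNIV. \<Sum>i\<in>UNIV. d_y l (gi j i) z * d_y j (d_y i f) z * w_field f l z)"
    by (simp add: sum_gi_third[OF z] sum_distrib_right sum_negf)
  also have "(\<Sum>l\<in>UNIV. \<Sum>j\<in>UNIV. \<Sum>i\<in>UNIV. d_y l (gi j i) z * d_y j (d_y i f) z * w_field f l z) =
      (\<Sum>j\<in>UNIV. \<Sum>i\<in>UNIV. \<Sum>l\<in>UNIV. d_y l (gi j i) z * d_y j (d_y i f) z * w_field f l z)"
    by (rule sum_triple_swap)
  also have "\<dots> = (\<Sum>j\<in>UNIV. \<Sum>i\<in>UNIV. d_y j (d_y i f) z * (\<Sum>k\<in>UNIV. dgi k j i z * d_y k f z))"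
  proof -
    have "(\<Sum>l\<in>UNIV. d_y l (gi j i) z * w_field f l z) = (\<Sum>k\<in>UNIV. dgi k j i z * d_y k f z)" for i j
      unfolding w_field_def dgi_def sum_distrib_left sum_distrib_right
      by (subst sum.swap) (simp add: gi_sym[OF z, of _ _] mult_ac)
    then show ?thesis
      by (simp add: mult.left_commute mult.assoc flip: sum_distrib_left)
  qed
  also have "(\<Sum>j\<in>UNIV. \<Sum>i\<in>UNIV. \<Sum>l\<in>UNIV. gi j i z * d_y l (d_y i f) z * d_y j (w_field f l) z) =
      Q_form f z + (\<Sum>j\<in>UNIV. \<Sum>i\<in>UNIV. d_y j (d_y i f) z * (\<Sum>k\<in>UNIV. dgi k j i z * d_y k f z))"
  proof -
    have "(\<Sum>j\<in>UNIV. \<Sum>i\<in>UNIV. \<Sum>l\<in>UNIV. gi j i z * d_y l (d_y i f) z * (\<Sum>k\<in>UNIV. d_y j (gi l k) z * d_y k f z)) =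
      (\<Sum>i\<in>UNIV. \<Sum>l\<in>UNIV. d_y l (d_y i f) z * (\<Sum>k\<in>UNIV. dgi i l k z * d_y k f z))"
    proof -
      have dgi: "(\<Sum>j\<in>UNIV. \<Sum>k\<in>UNIV. gi i j z * d_y j (gi l k) z * d_y k f z) =
          (\<Sum>k\<in>UNIV. dgi i l k z * d_y k f z)" for i l
        unfolding dgi_def sum_distrib_right by (rule sum.swap)
      have "(\<Sum>j\<in>UNIV. \<Sum>i\<in>UNIV. \<Sum>l\<in>UNIV. gi j i z * d_y l (d_y i f) z * (\<Sum>k\<in>UNIV. d_y j (gi l k) z * d_y k f z)) =
        (\<Sum>i\<in>UNIV. \<Sum>l\<in>UNIV. \<Sum>j\<in>UNIV. gi j i z * d_y l (d_y i f) z * (\<Sum>k\<in>UNIV. d_y j (gi l k) z * d_y k f z))"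
        by (rule sum_triple_swap)
      also have "\<dots> = (\<Sum>i\<in>UNIV. \<Sum>l\<in>UNIV. d_y l (d_y i f) z *
          (\<Sum>j\<in>UNIV. \<Sum>k\<in>UNIV. gi i j z * d_y j (gi l k) z * d_y k f z))"
        by (simp add: sum_distrib_left mult_ac gi_sym[OF z, of _ _])
      finally show ?thesis unfolding dgi .
    qed
    also have "\<dots> = (\<Sum>j\<in>UNIV. \<Sum>i\<in>UNIV. d_y j (d_y i f) z * (\<Sum>k\<in>UNIV. dgi k j i z * d_y k f z))"
    proof -
      \<comment> \<open>Exchanging the outer indices of the totally symmetric \<open>dgi\<close>
        makes this term equal to the one from the third derivatives.\<close>
      have "dgi i l k z = dgi k l i z" for i l k
        by (rule trans[OF dgi_sym(2)[OF z] trans[OF dgi_sym(1)[OF z] dgi_sym(2)[OF z]]])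
      then show ?thesis by (subst sum.swap) simp
    qed
    moreover have "(\<Sum>j\<in>UNIV. \<Sum>i\<in>UNIV. \<Sum>l\<in>UNIV. gi j i z * d_y l (d_y i f) z * (\<Sum>k\<in>UNIV. gi l k z * d_y j (d_y k f) z)) =
       Q_form f z"
      by (simp add: Q_form_def sum_distrib_left mult.assoc)
    ultimately show ?thesis
      by (simp add: dw sum.distrib distrib_left)
  qed
  finally show ?thesis by (simp add: 1)
qed

text \<open>By Euler's relation dE is twice y with its index lowered, so contraction with g^-1
  returns y, and the Hessian of a function of degree 1 annihilates y.\<close>

lemma sum_dE_X:
  assumes z: "z \<in> T"
  shows "(\<Sum>j\<in>UNIV. d_y j E z * X_field f j z) = 0"
proof -
  have E: "d_y j E z = 2 * (\<Sum>a\<in>UNIV. snd z $ a * g a j z)" for j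
    using g_y[OF z, of j] g_sym[OF z, of j] by (simp add: mult.commute)
  have Eg: "(\<Sum>j\<in>UNIV. d_y j E z * gi j i z) = 2 * snd z $ i" for i
  proof -
    have "(\<Sum>j\<in>UNIV. d_y j E z * gi j i z) =
        2 * (\<Sum>a\<in>UNIV. snd z $ a * (\<Sum>j\<in>UNIV. g a j z * gi j i z))"
      unfolding E sum_distrib_left sum_distrib_right by (subst sum.swap) (simp add: mult.assoc)
    then show ?thesis by (simp add: g_gi[OF z])
  qed
  have vy: "(\<Sum>i\<in>UNIV. snd z $ i * v_field f i z) = 0"
  proof -
    have "(\<Sum>i\<in>UNIV. snd z $ i * d_y l (d_y i f) z) = 0" for l
    proof -
      have "homog_on T 0 (d_y l f)"
        using homog_on_d_y[OF conic_T f_homog f_smooth] by simp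
      from homog_on_euler_sum[OF conic_T this smooth_on_d_y[OF f_smooth] z]
      show ?thesis using d_y_commute[OF open_T f_smooth z] by simp
    qed
    moreover have "(\<Sum>i\<in>UNIV. snd z $ i * v_field f i z) =
        (\<Sum>l\<in>UNIV. (\<Sum>i\<in>UNIV. snd z $ i * d_y l (d_y i f) z) * w_field f l z)"
      unfolding v_field_def sum_distrib_left sum_distrib_right by (subst sum.swap) (simp add: mult.assoc)
    ultimately show ?thesis by simp
  qed
  have "(\<Sum>j\<in>UNIV. d_y j E z * X_field f j z) =
      det (g_mat F z) * (\<Sum>i\<in>UNIV. (\<Sum>j\<in>UNIV. d_y j E z * gi j i z) * v_field f i z)"
    unfolding X_field_def sum_distrib_left sum_distrib_right by (subst sum.swap) (simp add: mult_ac)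
  then show ?thesis
    using vy by (simp add: Eg mult.assoc flip: sum_distrib_left)
qed

end

end

lemma sum_quadruple_swap:
  fixes f :: "'a::finite \<Rightarrow> 'b::finite \<Rightarrow> 'c::finite \<Rightarrow> 'd::finite \<Rightarrow> real"
  shows "(\<Sum>j\<in>UNIV. \<Sum>k\<in>UNIV. \<Sum>a\<in>UNIV. \<Sum>b\<in>UNIV. f j k a b) =
    (\<Sum>a\<in>UNIV. \<Sum>b\<in>UNIV. \<Sum>j\<in>UNIV. \<Sum>k\<in>UNIV. f j k a b)"
proof -
  have "(\<Sum>k\<in>UNIV. \<Sum>a\<in>UNIV. \<Sum>b\<in>UNIV. f j k a b) = (\<Sum>a\<in>UNIV. \<Sum>b\<in>UNIV. \<Sum>k\<in>UNIV. f j k a b)" for j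
    by (rule sum_triple_swap)
  then show ?thesis by (simp only: sum_triple_swap[of "\<lambda>j a b. \<Sum>k\<in>UNIV. f j k a b"])
qed

section \<open>The Hessian in an orthonormal frame\<close>

context finsler_frame
begin

definition "hess_frame f a b z = (\<Sum>j\<in>UNIV. \<Sum>k\<in>UNIV. u a z $ j * u b z $ k * d_y j (d_y k f) z)"

text \<open>In the frame g^-1 is the sum of the u_a u_a, so the norm is a sum of squared components.
  This gives both its sign and, in \<open>Q_form_eq_0_imp\<close>, the equality case.\<close>

lemma Q_form_sum_squares:
  assumes z: "z \<in> W" and f: "smooth_on T f"
  shows "Q_form f z = (\<Sum>a\<in>UNIV. \<Sum>b\<in>UNIV. (hess_frame f a b z)\<^sup>2)"
proof -
  define H where "H j k = d_y j (d_y k f) z" for j k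
  have H_sym: "H j k = H k j" for j k
    unfolding H_def by (rule d_y_commute[OF open_T f WT[OF z]])
  let ?q = "\<lambda>a b. hess_frame f a b z"
  have Z: "(\<Sum>i\<in>UNIV. \<Sum>l\<in>UNIV. gi j i z * gi l k z * H i l) = (\<Sum>a\<in>UNIV. \<Sum>b\<in>UNIV. u a z $ j * u b z $ k * ?q a b)" for j k
  proof -
    have "(\<Sum>i\<in>UNIV. \<Sum>l\<in>UNIV. gi j i z * gi l k z * H i l) =
      (\<Sum>i\<in>UNIV. \<Sum>l\<in>UNIV. \<Sum>a\<in>UNIV. \<Sum>b\<in>UNIV. (u a z $ j * u a z $ i) * (u b z $ l * u b z $ k) * H i l)"
      unfolding sum_u_u[OF z, symmetric] unfolding sum_product unfolding sum_distrib_right ..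
    also have "\<dots> = (\<Sum>a\<in>UNIV. \<Sum>b\<in>UNIV. \<Sum>i\<in>UNIV. \<Sum>l\<in>UNIV. (u a z $ j * u a z $ i) * (u b z $ l * u b z $ k) * H i l)"
      by (rule sum_quadruple_swap)
    finally show ?thesis
      by (simp add: hess_frame_def H_def sum_distrib_left mult_ac)
  qed
  have "Q_form f z = (\<Sum>j\<in>UNIV. \<Sum>i\<in>UNIV. \<Sum>l\<in>UNIV. \<Sum>k\<in>UNIV. H j k * (gi j i z * gi l k z * H i l))"
    by (simp add: Q_form_def H_def[symmetric] H_sym[of _ _] mult_ac)
  also have "\<dots> = (\<Sum>j\<in>UNIV. \<Sum>k\<in>UNIV. H j k * (\<Sum>i\<in>UNIV. \<Sum>l\<in>UNIV. gi j i z * gi l k z * H i l))"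
    unfolding sum_distrib_left by (intro sum.cong refl sum_triple_swap[symmetric])
  also have "\<dots> = (\<Sum>j\<in>UNIV. \<Sum>k\<in>UNIV. \<Sum>a\<in>UNIV. \<Sum>b\<in>UNIV. ?q a b * (u a z $ j * u b z $ k * H j k))"
    unfolding Z by (simp add: sum_distrib_left mult_ac)
  also have "\<dots> = (\<Sum>a\<in>UNIV. \<Sum>b\<in>UNIV. \<Sum>j\<in>UNIV. \<Sum>k\<in>UNIV. ?q a b * (u a z $ j * u b z $ k * H j k))"
    by (rule sum_quadruple_swap)
  also have "\<dots> = (\<Sum>a\<in>UNIV. \<Sum>b\<in>UNIV. (?q a b)\<^sup>2)"
    unfolding sum_distrib_left[symmetric] by (simp add: hess_frame_def H_def power2_eq_square)
  finally show ?thesis .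
qed

lemma Q_form_eq_0_imp:
  assumes z: "z \<in> W" and f: "smooth_on T f" and Q: "Q_form f z = 0"
  shows "d_y j (d_y k f) z = 0"
proof -
  have "(\<Sum>b\<in>UNIV. (hess_frame f a b z)\<^sup>2) = 0" for a
    using Q unfolding Q_form_sum_squares[OF z f]
    by (subst (asm) sum_nonneg_eq_0_iff) (auto intro: sum_nonneg)
  then have q: "hess_frame f a b z = 0" for a b
    by (subst (asm) sum_nonneg_eq_0_iff) auto
  have "d_y j (d_y k f) z = (\<Sum>i\<in>UNIV. \<Sum>l\<in>UNIV.
      (\<Sum>a\<in>UNIV. u a z $ i * U a j z) * (\<Sum>b\<in>UNIV. u b z $ l * U b k z) * d_y i (d_y l f) z)"
    by (simp add: u_U[OF z] mult.assoc flip: sum_distrib_left)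
  also have "\<dots> = (\<Sum>i\<in>UNIV. \<Sum>l\<in>UNIV. \<Sum>a\<in>UNIV. \<Sum>b\<in>UNIV.
      (u a z $ i * U a j z) * (u b z $ l * U b k z) * d_y i (d_y l f) z)"
    unfolding sum_product unfolding sum_distrib_right ..
  also have "\<dots> = (\<Sum>a\<in>UNIV. \<Sum>b\<in>UNIV. \<Sum>i\<in>UNIV. \<Sum>l\<in>UNIV.
      (u a z $ i * U a j z) * (u b z $ l * U b k z) * d_y i (d_y l f) z)"
    by (rule sum_quadruple_swap)
  also have "\<dots> = (\<Sum>a\<in>UNIV. \<Sum>b\<in>UNIV. U a j z * U b k z * hess_frame f a b z)"
    by (simp add: hess_frame_def sum_distrib_left mult_ac)
  finally show ?thesis by (simp add: q)
qed

end

context finsler_chart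
begin

lemma frame_through:
  assumes "z \<in> T"
  shows "\<exists>m u. finsler_frame S F (slit m) m u \<and> z \<in> slit m"
proof -
  have "snd z \<noteq> 0" using assms by auto
  then have "\<exists>m. snd z $ m \<noteq> 0" by (simp add: vec_eq_iff)
  then obtain m where m: "snd z $ m \<noteq> 0" by blast
  obtain u where "adapted_frame F (slit m) m u" using adapted_frame_exists by blast
  then have "finsler_frame S F (slit m) m u"
    using conic_slit by unfold_locales (auto simp: slit_def)
  moreover have "z \<in> slit m" using assms m by (auto simp: slit_def)
  ultimately show ?thesis by blast
qed

lemma Q_form_nonneg:
  assumes "z \<in> T" "smooth_on T f"
  shows "Q_form f z \<ge> 0"
proof -
  obtain m u where "finsler_frame S F (slit m) m u" "z \<in> slit m"
    using frame_through[OF assms(1)] by blast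
  then show ?thesis
    using finsler_frame.Q_form_sum_squares[of S F "slit m" m u z f] assms(2)
    by (auto intro!: sum_nonneg)
qed

lemma sphere_nonempty: "sphere (0 :: real ^ 'n) 1 \<noteq> {}"
  using norm_axis_1[of undefined] by (metis empty_iff mem_sphere_0)

text \<open>The extrema of F on the Euclidean unit sphere, spread over the fibre by
  homogeneity.\<close>

lemma F_bounds:
  assumes x: "x \<in> S"
  shows "\<exists>c M. 0 < c \<and> (\<forall>y. y \<noteq> 0 \<longrightarrow> c * norm y \<le> F (x, y) \<and> F (x, y) \<le> M * norm y)"
proof -
  have cont: "continuous_on (sphere 0 1) (\<lambda>y. F (x, y))"
    by (rule continuous_on_compose2[OF F_cont]) (use x in \<open>auto intro!: continuous_intros\<close>)
  obtain y0 where y0: "y0 \<in> sphere 0 1" "\<And>y. y \<in> sphere 0 1 \<Longrightarrow> F (x, y0) \<le> F (x, y)"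
    using continuous_attains_inf[OF compact_sphere sphere_nonempty cont] by blast
  obtain y1 where y1: "\<And>y. y \<in> sphere 0 1 \<Longrightarrow> F (x, y) \<le> F (x, y1)"
    using continuous_attains_sup[OF compact_sphere sphere_nonempty cont] by blast
  have "F (x, y0) > 0" using y0(1) x by (intro F_pos) auto
  moreover have "F (x, y0) * norm y \<le> F (x, y) \<and> F (x, y) \<le> F (x, y1) * norm y" if "y \<noteq> 0" for y
  proof -
    have s: "(1 / norm y) *\<^sub>R y \<in> sphere 0 1" using that by simp
    have "F (x, y) = F (x, (1 / norm y) *\<^sub>R y) * norm y"
      using F_scale[OF x, of "1 / norm y" y] that by simp
    then show ?thesis
      using mult_right_mono[OF y0(2)[OF s], of "norm y"] mult_right_mono[OF y1[OF s], of "norm y"] by simp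
  qed
  ultimately show ?thesis by blast
qed

text \<open>Near the origin and far out, F^2 leaves the interval (1, 2) on which \<open>bump\<close>
  is positive.\<close>

lemma F_sq_bounds:
  assumes x: "x \<in> S"
  shows "\<exists>r R. 0 < r \<and> 0 < R \<and> (\<forall>y. y \<noteq> 0 \<longrightarrow> norm y < r \<longrightarrow> E (x, y) \<le> 1) \<and>
    (\<forall>y. norm y \<ge> R \<longrightarrow> E (x, y) \<ge> 2)"
proof -
  obtain c M where c: "0 < c" and M: "\<And>y. y \<noteq> 0 \<Longrightarrow> c * norm y \<le> F (x, y) \<and> F (x, y) \<le> M * norm y"
    using F_bounds[OF x] by blast
  have small: "E (x, y) \<le> 1" if "y \<noteq> 0" "norm y < 1 / (\<bar>M\<bar> + 1)" for y
  proof -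
    have "F (x, y) \<le> M * norm y" using M[OF that(1)] by simp
    also have "\<dots> \<le> (\<bar>M\<bar> + 1) * norm y" by (intro mult_right_mono) auto
    also have "\<dots> \<le> 1" using that(2) by (simp add: field_simps)
    finally show ?thesis
      using F_nonneg[OF x, of y] by (simp add: F_sq_def power_le_one)
  qed
  have large: "E (x, y) \<ge> 2" if "norm y \<ge> 2 / c" for y
  proof -
    have "0 < 2 / c" using c by simp
    with that have "y \<noteq> 0" by auto
    have "2 \<le> c * norm y" using that c by (simp add: field_simps)
    also have "\<dots> \<le> F (x, y)" using M[OF \<open>y \<noteq> 0\<close>] by simp
    finally have "2\<^sup>2 \<le> (F (x, y))\<^sup>2" by (intro power_mono) auto
    then show ?thesis by (simp add: F_sq_def)
  qed
  have "0 < 1 / (\<bar>M\<bar> + 1)" "0 < 2 / c" using c by (auto intro: divide_pos_pos)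
  with small large show ?thesis by blast
qed

definition cutoff :: "real ^ 'n \<Rightarrow> ('n tm \<Rightarrow> real) \<Rightarrow> real ^ 'n \<Rightarrow> real" where
  "cutoff x Y y = (if y = 0 then 0 else bump (E (x, y)) * Y (x, y))"

lemma has_derivative_slice:
  assumes "smooth_on T Y" "(x, y) \<in> T"
  shows "((\<lambda>y. Y (x, y)) has_derivative (\<lambda>v. dir_deriv Y (x, y) (0, v))) (at y)"
proof -
  have "((\<lambda>y. (x, y)) has_derivative (\<lambda>v. (0, v))) (at y)"
    by (intro has_derivative_Pair has_derivative_const has_derivative_ident)
  from diff_chain_at[OF this smooth_on_has_derivative[OF assms]]
  show ?thesis by (simp add: o_def)
qed

lemma cutoff_deriv:
  assumes x: "x \<in> S" and Y: "smooth_on T Y" and y: "y \<noteq> 0"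
  shows "(cutoff x Y has_derivative (\<lambda>v. bump (E (x, y)) * dir_deriv Y (x, y) (0, v) +
    bump' (E (x, y)) * dir_deriv E (x, y) (0, v) * Y (x, y))) (at y)"
proof -
  have xy: "(x, y) \<in> T" using x y by simp
  have "((\<lambda>y. bump (E (x, y))) has_derivative
      (\<lambda>v. bump' (E (x, y)) * dir_deriv E (x, y) (0, v))) (at y)"
    using diff_chain_at[OF has_derivative_slice[OF E_smooth xy] bump_deriv[unfolded has_field_derivative_def]]
    by (simp add: o_def)
  from has_derivative_mult[OF this has_derivative_slice[OF Y xy]]
  show ?thesis
    by (rule has_derivative_transform_within_open[of _ _ _ _ "- {0}"]) (use y in \<open>auto simp: cutoff_def\<close>)
qed

text \<open>\<open>Y\<close> may be singular at the zero section, but \<open>bump\<close> of F^2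
  vanishes on a whole punctured ball around it, so the extension by 0 is C^1 there.\<close>

lemma cutoff_C1:
  assumes x: "x \<in> S" and Y: "smooth_on T Y"
  shows "cutoff x Y differentiable at y" "continuous_on UNIV (\<lambda>y. dir_deriv (cutoff x Y) y v)"
    "dir_deriv (cutoff x Y) 0 v = 0"
proof -
  obtain r where r: "0 < r" "\<And>y. y \<noteq> 0 \<Longrightarrow> norm y < r \<Longrightarrow> E (x, y) \<le> 1"
    using F_sq_bounds[OF x] by blast
  have near: "(cutoff x Y has_derivative (\<lambda>v. 0)) (at y)" if "y \<in> ball 0 r" for y
  proof (rule has_derivative_transform_within_open[of "\<lambda>y. 0" _ _ _ "ball 0 r"])
    show "0 = cutoff x Y w" if "w \<in> ball 0 r" for w
      using r(2)[of w] that bump_zero(1)[of "E (x, w)"] by (auto simp: cutoff_def)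
  qed (use that in auto)
  have near': "dir_deriv (cutoff x Y) y v = 0" if "y \<in> ball 0 r" for y
    using dir_deriv_eqI[OF near[OF that]] .
  show "dir_deriv (cutoff x Y) 0 v = 0" using near'[of 0] r(1) by simp
  show "cutoff x Y differentiable at y"
    using cutoff_deriv[OF x Y, of y] near[of 0] r(1) unfolding differentiable_def by (cases "y = 0") auto
  have "continuous_on (- {0}) (\<lambda>y. bump (E (x, y)) * dir_deriv Y (x, y) (0, v) +
    bump' (E (x, y)) * dir_deriv E (x, y) (0, v) * Y (x, y))"
  proof -
    have slice: "continuous_on (- {0}) (\<lambda>y. Z (x, y))" if "smooth_on T Z" for Z :: "'n tm \<Rightarrow> real"
      by (rule continuous_on_compose2[OF smooth_on_continuous[OF that]])
        (use x in \<open>auto intro!: continuous_intros\<close>)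
    show ?thesis
      by (intro continuous_intros slice[OF Y] slice[OF smooth_on_dir_deriv[OF Y]]
          slice[OF smooth_on_dir_deriv[OF E_smooth]]
          continuous_on_compose2[OF bump_continuous(1) slice[OF E_smooth]]
          continuous_on_compose2[OF bump_continuous(2) slice[OF E_smooth]]) auto
  qed
  then have "continuous_on (- {0}) (\<lambda>y. dir_deriv (cutoff x Y) y v)"
    by (rule continuous_on_eq) (use dir_deriv_eqI[OF cutoff_deriv[OF x Y]] in auto)
  moreover have "continuous_on (ball 0 r) (\<lambda>y. dir_deriv (cutoff x Y) y v)"
    by (rule continuous_on_eq[OF continuous_on_const]) (use near' in auto)
  ultimately have "continuous_on (ball 0 r \<union> - {0}) (\<lambda>y. dir_deriv (cutoff x Y) y v)"
    by (intro continuous_on_open_Un) auto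
  moreover have "ball 0 r \<union> - {0 :: real ^ 'n} = UNIV" using r(1) by auto
  ultimately show "continuous_on UNIV (\<lambda>y. dir_deriv (cutoff x Y) y v)" by simp
qed

text \<open>Alexandrov's argument: the vector field \<open>X\<close> is tangent to the level sets of \<open>F\<close> and has
  divergence \<open>det g \<bar>Hess f\<bar>\<^sup>2\<close>, so cutting it off with a function of \<open>F\<close> and integrating over
  the fibre shows that the Hessian vanishes.\<close>

lemma hessian_eq_0:
  fixes f :: "'n tm \<Rightarrow> real"
  assumes f: "smooth_on T f" "homog_on T 1 f"
    and f_trace: "\<And>z. z \<in> T \<Longrightarrow> (\<Sum>j\<in>UNIV. \<Sum>i\<in>UNIV. gi j i z * d_y j (d_y i f) z) = 0"
    and z: "z \<in> T"
  shows "d_y j (d_y k f) z = 0"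
proof -
  obtain x y where xy: "z = (x, y)" "x \<in> S" "y \<noteq> 0" using z by auto
  note X = X_smooth[OF f f_trace]
  obtain R where R: "R > 0" "\<And>y. norm y \<ge> R \<Longrightarrow> E (x, y) \<ge> 2"
    using F_sq_bounds[OF xy(2)] by blast
  define K where "K = cbox (- ((R + 1) *\<^sub>R One)) ((R + 1) *\<^sub>R (One :: real ^ 'n))"
  define G where "G y = (\<Sum>j\<in>UNIV. dir_deriv (cutoff x (X_field f j)) y (axis j 1))" for y
  have int: "integral K (\<lambda>y. dir_deriv (cutoff x (X_field f j)) y (axis j 1)) = 0" for j
    unfolding K_def
  proof (rule integral_dir_deriv_eq_0)
    show "cutoff x (X_field f j) y = 0" if "norm y \<ge> R" for y
      using R(2)[OF that] bump_zero(1)[of "E (x, y)"] by (simp add: cutoff_def)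
    show "norm (axis j (1::real)) \<le> 1" by (simp add: norm_axis_1)
    show "cutoff x (X_field f j) differentiable at y" for y
      by (rule cutoff_C1(1)[OF xy(2) X])
    show "continuous_on UNIV (\<lambda>y. dir_deriv (cutoff x (X_field f j)) y (axis j 1))"
      by (rule cutoff_C1(2)[OF xy(2) X])
  qed
  have Gc: "continuous_on UNIV G"
    unfolding G_def by (intro continuous_on_sum cutoff_C1[OF xy(2) X])
  have "integral K G = (\<Sum>j\<in>UNIV. integral K (\<lambda>y. dir_deriv (cutoff x (X_field f j)) y (axis j 1)))"
    unfolding G_def K_def
    by (intro integral_sum finite integrable_continuous continuous_on_subset[OF cutoff_C1(2)[OF xy(2) X]]) auto
  then have intG: "integral K G = 0" by (simp add: int)
  \<comment> \<open>The derivative of \<open>bump\<close> is multiplied by dE(X) = 0, so only the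
    divergence of the field remains.\<close>
  have G: "G y = bump (E (x, y)) * (det (g_mat F (x, y)) * Q_form f (x, y))" if "y \<noteq> 0" for y
  proof -
    have T: "(x, y) \<in> T" using xy that by simp
    have "G y = (\<Sum>j\<in>UNIV. bump (E (x, y)) * d_y j (X_field f j) (x, y) +
      bump' (E (x, y)) * (d_y j E (x, y) * X_field f j (x, y)))"
      unfolding G_def d_y_def
      by (rule sum.cong[OF refl]) (simp add: dir_deriv_eqI[OF cutoff_deriv[OF xy(2) X that]])
    then show ?thesis
      using divergence_X[OF f f_trace T] sum_dE_X[OF f f_trace T]
      by (simp add: sum.distrib flip: sum_distrib_left)
  qed
  have G_nonneg: "G y \<ge> 0" for y
  proof (cases "y = 0")
    case True
    then show ?thesis by (simp add: G_def cutoff_C1(3)[OF xy(2) X])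
  next
    case False
    then have T: "(x, y) \<in> T" using xy by simp
    show ?thesis
      unfolding G[OF False] using Q_form_nonneg[OF T f(1)] det_g_pos[OF T] bump_nonneg by simp
  qed
  have inK: "w \<in> K" if "norm w < R" for w
  proof -
    have "\<bar>w \<bullet> i\<bar> < R" if "i \<in> Basis" for i
      using Basis_le_norm[OF that, of w] \<open>norm w < R\<close> by linarith
    then show ?thesis by (fastforce simp: K_def mem_box abs_less_iff)
  qed
  have G0: "G w = 0" if "w \<in> K" for w
  proof -
    have "box (- ((R + 1) *\<^sub>R One)) ((R + 1) *\<^sub>R (One :: real ^ 'n)) \<noteq> {}"
      using R(1) by (simp add: box_ne_empty inner_minus_left)
    from integral_cbox_eq_0_iff[OF continuous_on_subset[OF Gc] this G_nonneg] intG that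
    show ?thesis by (simp add: K_def)
  qed
  \<comment> \<open>The multiple of y with F^2 = 3/2, inside (1, 2), where the cut-off is positive.
    Homogeneity of degree -1 carries the vanishing of the Hessian back to \<open>z\<close>.\<close>
  define t where "t = sqrt (3/2 / E (x, y))"
  have E: "E (x, y) > 0" using F_pos[OF z] xy by (simp add: F_sq_def)
  have t: "t > 0" using E by (simp add: t_def)
  have Et: "E (x, t *\<^sub>R y) = 3/2"
    using homog_onD[OF E_homog _ t, of x y] z xy E by (simp add: t_def)
  have "norm (t *\<^sub>R y) < R" using R(2)[of "t *\<^sub>R y"] Et by force
  then have "G (t *\<^sub>R y) = 0" by (intro G0 inK)
  moreover have T': "(x, t *\<^sub>R y) \<in> T" using xy t by simp
  ultimately have Q: "Q_form f (x, t *\<^sub>R y) = 0"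
    using G[of "t *\<^sub>R y"] xy(3) t bump_pos[of "3/2"] Et det_g_pos[OF T'] by simp
  obtain m u where "finsler_frame S F (slit m) m u" "(x, t *\<^sub>R y) \<in> slit m"
    using frame_through[OF T'] by blast
  from finsler_frame.Q_form_eq_0_imp[OF this f(1) Q]
  have "d_y j (d_y k f) (x, t *\<^sub>R y) = 0" .
  moreover have "homog_on T (1 - 1 - 1) (d_y j (d_y k f))"
    by (intro homog_on_d_y conic_T f smooth_on_d_y)
  ultimately show ?thesis
    using homog_onD[of T _ "d_y j (d_y k f)" x y t] z xy t by simp
qed

end

section \<open>Consequences of the curvature conditions in a chart\<close>

locale flat_chart = finsler_chart S F for S :: "(real ^ 'n::finite) set" and F :: "'n tm \<Rightarrow> real" +
  assumes J_zero: "\<And>W m u \<omega> z \<gamma>. conic_open W \<Longrightarrow> W \<subseteq> S \<times> UNIV \<Longrightarrow> adapted_frame F W m u \<Longrightarrow>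
      chern_connection F W m u \<omega> \<Longrightarrow> z \<in> W \<Longrightarrow> \<gamma> \<noteq> m \<Longrightarrow> mean_landsberg F m u \<omega> \<gamma> z = 0"
    and e_zero: "\<And>W m u \<omega> z. conic_open W \<Longrightarrow> W \<subseteq> S \<times> UNIV \<Longrightarrow> adapted_frame F W m u \<Longrightarrow>
      chern_connection F W m u \<omega> \<Longrightarrow> z \<in> W \<Longrightarrow> berwald_scalar F m u \<omega> z = 0"
    and card_ge_2: "CARD('n) \<ge> 2"
begin

text \<open>The hypotheses are applied to a constructed pair, a Gram-Schmidt frame through
  \<open>z\<close> and its \<open>chern_form\<close>.\<close>

lemma curvature_conditions:
  assumes "z \<in> T"
  shows "(\<Sum>l\<in>UNIV. snd z $ l * d_y k (h l) z) = 0"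
    "(\<Sum>k\<in>UNIV. \<Sum>l\<in>UNIV. gi k l z * d_y k (h l) z) = 0"
proof -
  obtain m u where fr: "finsler_frame S F (slit m) m u" and z: "z \<in> slit m"
    using frame_through[OF assms] by blast
  interpret fr: finsler_frame S F "slit m" m u by (rule fr)
  note c = fr.chern_connection_chern_form
  note J = J_zero[OF fr.conic_W fr.W_sub fr.frame c] and e = e_zero[OF fr.conic_W fr.W_sub fr.frame c]
  show "(\<Sum>l\<in>UNIV. snd z $ l * d_y k (h l) z) = 0"
    by (rule fr.mean_landsberg_consequence[OF c z J[OF z]])
  show "(\<Sum>k\<in>UNIV. \<Sum>l\<in>UNIV. gi k l z * d_y k (h l) z) = 0"
    by (rule fr.berwald_scalar_consequence[OF c z J e[OF z]])
qed

text \<open>The relation y^l h_l = \<Pi> is differentiated in y^k; J = 0 removes the term in which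
  h_l is differentiated.\<close>

lemma h_eq_d_y_trN:
  assumes z: "z \<in> T"
  shows "h k z = d_y k trN z"
proof -
  have "d_y k trN z = d_y k (\<lambda>z. \<Sum>l\<in>UNIV. snd z $ l * h l z) z"
    by (rule d_y_cong_open[OF open_T z]) (simp add: sum_y_h)
  also have "\<dots> = (\<Sum>l\<in>UNIV. snd z $ l * d_y k (h l) z + d_y k (\<lambda>z. snd z $ l) z * h l z)"
    unfolding d_y_def[of k]
    by (intro dir_deriv_sum_mult smooth_on_differentiable[OF _ z] smooth_on_snd_nth h_smooth open_T)
  finally show ?thesis
    by (simp add: sum.distrib curvature_conditions(1)[OF z] d_y_snd)
qed

text \<open>The vertical derivatives of the h_k form the Hessian of \<Pi>, a function of degree 1,
  and e = 0 makes it trace-free, so \<open>hessian_eq_0\<close> applies.\<close>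

lemma d_y_h:
  assumes z: "z \<in> T"
  shows "d_y j (h k) z = 0"
proof -
  have hd: "d_y j (h k) z = d_y j (d_y k trN) z" if "z \<in> T" for j k z
    by (rule d_y_cong_open[OF open_T that h_eq_d_y_trN])
  have "d_y j (d_y k trN) z = 0"
    by (rule hessian_eq_0[OF trN_smooth trN_homog _ z])
      (use curvature_conditions(2) hd in simp)
  then show ?thesis using hd[OF z] by simp
qed

text \<open>Vanishing vertical derivatives give constancy since a fibre without its origin is
  connected in dimension at least 2.\<close>

lemma h_const:
  assumes x: "x \<in> S" and y: "y \<noteq> 0" "y' \<noteq> 0"
  shows "h k (x, y) = h k (x, y')"
proof -
  have "(\<lambda>y. h k (x, y)) constant_on (- {0})"
  proof (rule has_derivative_zero_connected_constant_on[of _ "{}"])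
    show "connected (- {0 :: real ^ 'n})"
      by (rule connected_punctured_universe) (use card_ge_2 in simp)
    have D: "((\<lambda>y. h k (x, y)) has_derivative (\<lambda>v. 0)) (at y)" if "y \<noteq> 0" for y
    proof -
      have xy: "(x, y) \<in> T" using x that by simp
      have "dir_deriv (h k) (x, y) (0, v) = 0" for v
        using dir_deriv_tm[OF smooth_on_differentiable[OF h_smooth xy], of k "(0, v)"] by (simp add: d_y_h[OF xy])
      then show ?thesis using has_derivative_slice[OF h_smooth xy, of k] by simp
    qed
    then show "\<forall>y\<in>- {0} - {}. ((\<lambda>y. h k (x, y)) has_derivative (\<lambda>v. 0)) (at y within - {0})"
      by (auto intro: has_derivative_at_withinI)
    show "continuous_on (- {0}) (\<lambda>y. h k (x, y))"
      using D by (auto intro!: continuous_at_imp_continuous_on has_derivative_continuous)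
  qed (auto simp: open_Compl)
  then show ?thesis using y by (auto simp: constant_on_def)
qed

end

section \<open>The maximal density\<close>

lemma Ck_on_slice:
  assumes "open S" "y \<in> B"
  shows "Ck_on k (S \<times> B) f \<Longrightarrow> Ck_on k S (\<lambda>x. f (x, y))"
proof (induction k arbitrary: f)
  case 0
  then have "continuous_on (S \<times> B) f" by simp
  then show ?case
    using assms(2) by (auto intro!: continuous_on_compose2[of "S \<times> B" f] continuous_intros)
next
  case (Suc k)
  show ?case
  proof (rule Ck_on_SucI[OF assms(1)])
    fix x assume "x \<in> S"
    then have xy: "(x, y) \<in> S \<times> B" using assms(2) by simp
    have "((\<lambda>x. (x, y)) has_derivative (\<lambda>v. (v, 0))) (at x)"
      by (intro has_derivative_Pair has_derivative_const has_derivative_ident)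
    from diff_chain_at[OF this Ck_on_Suc_has_derivative[OF Suc.prems xy]]
    show "((\<lambda>x. f (x, y)) has_derivative (\<lambda>v. dir_deriv f (x, y) (v, 0))) (at x)"
      by (simp add: o_def)
  next
    show "Ck_on k S (\<lambda>x. dir_deriv f (x, y) (v, 0))" for v
      by (rule Suc.IH) (use Suc.prems in simp)
  qed
qed

lemma smooth_on_slice: "open S \<Longrightarrow> y \<in> B \<Longrightarrow> smooth_on (S \<times> B) f \<Longrightarrow> smooth_on S (\<lambda>x. f (x, y))"
  unfolding smooth_on_def using Ck_on_slice[of S y B _ f] by auto

context finsler_chart
begin

text \<open>This is ln \<sigma> of the overview. The supremum is attained because \<lambda> has
  degree 0 and the unit sphere is compact.\<close>

definition "rho x = (SUP y\<in>- {0}. lam (x, y))"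

definition "grad z = (\<chi> k. d_x k lam z)"

lemma rho_attained:
  assumes x: "x \<in> S"
  shows "\<exists>y. norm y = 1 \<and> rho x = lam (x, y)" "y' \<noteq> 0 \<Longrightarrow> lam (x, y') \<le> rho x"
proof -
  have cont: "continuous_on (sphere 0 1) (\<lambda>y. lam (x, y))"
    by (rule continuous_on_compose2[OF smooth_on_continuous[OF lam_smooth]])
      (use x in \<open>auto intro!: continuous_intros\<close>)
  obtain y0 where y0: "norm y0 = 1" "\<And>y. norm y = 1 \<Longrightarrow> lam (x, y) \<le> lam (x, y0)"
    using continuous_attains_sup[OF compact_sphere sphere_nonempty cont] by auto
  have max: "lam (x, y) \<le> lam (x, y0)" if "y \<noteq> 0" for y
  proof -
    have "lam (x, (1 / norm y) *\<^sub>R y) = lam (x, y)"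
      using homog_onD[OF lam_homog, of x y "1 / norm y"] x that by simp
    then show ?thesis using y0(2)[of "(1 / norm y) *\<^sub>R y"] that by simp
  qed
  have "y0 \<noteq> 0" using y0(1) by auto
  have "rho x = lam (x, y0)"
    unfolding rho_def by (rule cSup_eq_maximum) (use max \<open>y0 \<noteq> 0\<close> in auto)
  then show "\<exists>y. norm y = 1 \<and> rho x = lam (x, y)" "y' \<noteq> 0 \<Longrightarrow> lam (x, y') \<le> rho x"
    using y0(1) max by auto
qed

text \<open>At a maximum along the fibre the vertical derivatives of \<lambda> vanish, so its
  horizontal and partial derivatives agree.\<close>

lemma grad_at_max:
  assumes x: "x \<in> S" and y: "y \<noteq> 0" "lam (x, y) = rho x"
  shows "grad (x, y) $ k = h k (x, y)"
proof -
  have xy: "(x, y) \<in> T" using x y by simp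
  have "(\<lambda>v. dir_deriv lam (x, y) (0, v)) = (\<lambda>v. 0)"
  proof (rule differential_zero_maxmin[OF _ _ has_derivative_slice[OF lam_smooth xy]])
    show "y \<in> - {0}" "open (- {0 :: real ^ 'n})" using y by auto
    show "(\<forall>w\<in>- {0}. lam (x, w) \<le> lam (x, y)) \<or> (\<forall>w\<in>- {0}. lam (x, y) \<le> lam (x, w))"
      using rho_attained(2)[OF x] y(2) by simp
  qed
  then have "d_y m lam (x, y) = 0" for m by (simp add: d_y_def fun_eq_iff)
  then show ?thesis by (simp add: grad_def h_def del_def)
qed

lemma dir_deriv_lam_grad: "z \<in> T \<Longrightarrow> dir_deriv lam z (v, 0) = v \<bullet> grad z"
  using dir_deriv_tm[OF smooth_on_differentiable[OF lam_smooth], of z "(v, 0)"]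
  by (simp add: grad_def inner_vec_def)

lemma grad_continuous: "continuous_on T grad"
  unfolding grad_def[abs_def]
  by (rule smooth_on_continuous[OF smooth_on_vec_lambda[OF open_T smooth_on_d_x[OF lam_smooth]]])

text \<open>The bound is uniform in the fibre direction and in both base points, because the
  maximisers to which it is applied vary with the base point without control. It follows from
  uniform continuity of the x-gradient on a compact set.\<close>

lemma lam_first_order:
  assumes x: "x \<in> S" and e: "e > 0"
  shows "\<exists>d>0. ball x d \<subseteq> S \<and> (\<forall>x1\<in>ball x d. \<forall>x2\<in>ball x d. \<forall>y. norm y = 1 \<longrightarrow>
    (x2 - x1) \<bullet> grad (x1, y) - e * norm (x2 - x1) \<le> lam (x2, y) - lam (x1, y))"
proof -
  obtain d0 where d0: "d0 > 0" "cball x d0 \<subseteq> S"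
    using open_S x open_contains_cball by blast
  define K where "K = cball x d0 \<times> sphere (0 :: real ^ 'n) 1"
  have "K \<subseteq> T" using d0 by (auto simp: K_def)
  then have "uniformly_continuous_on K grad"
    by (intro compact_uniformly_continuous continuous_on_subset[OF grad_continuous])
      (auto simp: K_def compact_Times)
  then obtain d1 where d1: "d1 > 0" "\<And>z z'. z \<in> K \<Longrightarrow> z' \<in> K \<Longrightarrow> dist z' z < d1 \<Longrightarrow> dist (grad z') (grad z) < e"
    using e unfolding uniformly_continuous_on_def by metis
  \<comment> \<open>Two points of the ball are less than 2 d apart, which is within the modulus
    \<open>d1\<close> of uniform continuity.\<close>
  define d where "d = min d0 (d1 / 2)"
  have d: "d > 0" using d0 d1 by (simp add: d_def)
  have "(x2 - x1) \<bullet> grad (x1, y) - e * norm (x2 - x1) \<le> lam (x2, y) - lam (x1, y)"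
    if x1: "x1 \<in> ball x d" and x2: "x2 \<in> ball x d" and y: "norm y = 1" for x1 x2 y
  proof -
    define \<phi> where "\<phi> s = lam (x1 + s *\<^sub>R (x2 - x1), y)" for s
    have seg: "x1 + s *\<^sub>R (x2 - x1) \<in> ball x d" if "0 \<le> s" "s \<le> 1" for s
    proof -
      have "(1 - s) *\<^sub>R x1 + s *\<^sub>R x2 \<in> ball x d"
        using convex_ball[of x d] x1 x2 that unfolding convex_alt by blast
      then show ?thesis by (simp add: algebra_simps)
    qed
    have inK: "(w, y) \<in> K" if "w \<in> ball x d" for w
      using that y by (auto simp: K_def d_def)
    have "(\<phi> has_real_derivative (x2 - x1) \<bullet> grad (x1 + s *\<^sub>R (x2 - x1), y)) (at s)"
      if "0 \<le> s" "s \<le> 1" for s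
    proof -
      have T: "(x1 + s *\<^sub>R (x2 - x1), y) \<in> T"
        using inK[OF seg[OF that]] \<open>K \<subseteq> T\<close> by blast
      have "((\<lambda>s. (x1 + s *\<^sub>R (x2 - x1), y)) has_derivative (\<lambda>c. (c *\<^sub>R (x2 - x1), 0))) (at s)"
        by (intro has_derivative_Pair has_derivative_const) (auto intro!: derivative_eq_intros)
      from diff_chain_at[OF this smooth_on_has_derivative[OF lam_smooth T]]
      have "(\<phi> has_derivative (\<lambda>c. c * ((x2 - x1) \<bullet> grad (x1 + s *\<^sub>R (x2 - x1), y)))) (at s)"
        unfolding \<phi>_def[abs_def] by (simp add: o_def dir_deriv_lam_grad[OF T])
      moreover have "(\<lambda>c. c * p) = (*) p" for p :: real by (simp add: fun_eq_iff)
      ultimately show ?thesis by (simp add: has_field_derivative_def)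
    qed
    from MVT2[of 0 1 \<phi>, OF _ this]
    obtain s where s: "0 < s" "s < 1" "\<phi> 1 - \<phi> 0 = (x2 - x1) \<bullet> grad (x1 + s *\<^sub>R (x2 - x1), y)"
      by auto
    have "dist (x1 + s *\<^sub>R (x2 - x1), y) (x1, y) = s * norm (x2 - x1)"
      using s by (simp add: dist_Pair_Pair dist_norm)
    also have "\<dots> \<le> norm (x2 - x1)" using s by (simp add: mult_left_le_one_le)
    also have "\<dots> \<le> dist x2 x + dist x x1" by (metis dist_norm dist_triangle)
    also have "\<dots> < d1" using x1 x2 by (simp add: d_def dist_commute)
    finally have near: "dist (grad (x1 + s *\<^sub>R (x2 - x1), y)) (grad (x1, y)) < e"
      using s by (intro d1(2) inK seg x1) auto
    have "(x2 - x1) \<bullet> (grad (x1, y) - grad (x1 + s *\<^sub>R (x2 - x1), y)) \<le>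
        norm (x2 - x1) * norm (grad (x1, y) - grad (x1 + s *\<^sub>R (x2 - x1), y))"
      by (rule norm_cauchy_schwarz)
    also have "\<dots> \<le> norm (x2 - x1) * e"
      using near by (intro mult_left_mono) (auto simp: dist_norm norm_minus_commute)
    finally show ?thesis
      using s(3) by (simp add: \<phi>_def inner_diff_right mult.commute)
  qed
  moreover have "ball x d \<subseteq> S" using d0(2) by (auto simp: d_def)
  ultimately show ?thesis using d by blast
qed

lemma F_zero: "x \<in> S \<Longrightarrow> F (x, 0) = 0"
  using F_scale[of x 2 0] by simp

end

section \<open>Change of charts\<close>

lemma dir_deriv_fibre_linear:
  fixes f f' :: "'n::finite tm \<Rightarrow> real"
  assumes L: "linear L" and eq: "\<And>y. y \<noteq> 0 \<Longrightarrow> f (x, y) = f' (x', L y)" and y: "y \<noteq> 0"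
    and d: "f differentiable at (x, y)" "f' differentiable at (x', L y)"
  shows "dir_deriv f (x, y) (0, v) = dir_deriv f' (x', L y) (0, L v)"
proof -
  have "((\<lambda>y. (x, y)) has_derivative (\<lambda>v. (0, v))) (at y)"
    by (intro has_derivative_Pair has_derivative_const has_derivative_ident)
  from diff_chain_at[OF this dir_deriv_works[OF d(1)]]
  have 1: "((\<lambda>y. f (x, y)) has_derivative (\<lambda>v. dir_deriv f (x, y) (0, v))) (at y)"
    by (simp add: o_def)
  have "((\<lambda>y. (x', L y)) has_derivative (\<lambda>v. (0, L v))) (at y)"
    by (intro has_derivative_Pair has_derivative_const linear_imp_has_derivative L)
  from diff_chain_at[OF this dir_deriv_works[OF d(2)]]
  have "((\<lambda>y. f' (x', L y)) has_derivative (\<lambda>v. dir_deriv f' (x', L y) (0, L v))) (at y)"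
    by (simp add: o_def)
  then have 2: "((\<lambda>y. f (x, y)) has_derivative (\<lambda>v. dir_deriv f' (x', L y) (0, L v))) (at y)"
    by (rule has_derivative_transform_within_open[of _ _ _ _ "- {0}"]) (use eq y in auto)
  show ?thesis using has_derivative_unique[OF 1 2] by (rule fun_cong)
qed

text \<open>On one fibre g = M^T g' M, so \<lambda> and \<lambda>' differ by the constant ln |det M|
  and so do their maxima. Only y-derivatives occur: the base point stays fixed and \<open>L\<close>
  is the sole datum of the transition map.\<close>

lemma exp_rho_transform:
  fixes F F' :: "'n::finite tm \<Rightarrow> real"
  assumes "finsler_chart S F" "finsler_chart S' F'" and x: "x \<in> S" "x' \<in> S'"
    and L: "linear L" and eq: "\<And>y. F (x, y) = F' (x', L y)"
  shows "exp (finsler_chart.rho F x) = \<bar>det (matrix L)\<bar> * exp (finsler_chart.rho F' x')"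
proof -
  interpret C: finsler_chart S F by (rule assms(1))
  interpret C': finsler_chart S' F' by (rule assms(2))
  define M where "M = matrix L"
  \<comment> \<open>Injectivity of \<open>L\<close> is read off from the structures: F is positive
    on nonzero vectors, while F' vanishes at the zero vector.\<close>
  have Lnz: "L y \<noteq> 0" if "y \<noteq> 0" for y
  proof
    assume "L y = 0"
    then have "F (x, y) = 0" using eq[of y] C'.F_zero[OF x(2)] by simp
    then show False using C.F_pos[of "(x, y)"] x that by simp
  qed
  have inj: "inj L" using Lnz by (intro linear_injective_0[OF L, THEN iffD2]) blast
  then have surj: "surj L" by (intro linear_injective_imp_surjective[OF L]) simp_all
  have detM: "det M \<noteq> 0"
    using det_nz_iff_inj[OF L] inj by (simp add: M_def)
  have Laxis: "L (axis j 1) = (\<Sum>b\<in>UNIV. M $ b $ j *\<^sub>R axis b 1)" for j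
  proof -
    have "L (axis j 1) $ b = M $ b $ j" for b by (simp add: M_def matrix_def)
    then show ?thesis
      using basis_expansion[of "L (axis j 1)"] by (simp add: scalar_mult_eq_scaleR)
  qed
  have trans: "d_y j f (x, y) = (\<Sum>b\<in>UNIV. M $ b $ j * d_y b f' (x', L y))"
    if "\<And>y. y \<noteq> 0 \<Longrightarrow> f (x, y) = f' (x', L y)" "y \<noteq> 0" "f differentiable at (x, y)"
      "f' differentiable at (x', L y)" for f f' :: "'n tm \<Rightarrow> real" and j y
  proof -
    have "d_y j f (x, y) = dir_deriv f' (x', L y) (0, L (axis j 1))"
      unfolding d_y_def by (rule dir_deriv_fibre_linear[OF L that])
    then show ?thesis
      using dir_deriv_tm[OF that(4), of "(0, L (axis j 1))"] by (simp add: M_def matrix_def)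
  qed
  have Exy: "d_y i (F_sq F) (x, y) = (\<Sum>a\<in>UNIV. M $ a $ i * d_y a (F_sq F') (x', L y))"
    if "y \<noteq> 0" for i y
  proof (rule trans[OF _ that])
    show "F_sq F (x, y) = F_sq F' (x', L y)" for y using eq[of y] by (simp add: F_sq_def)
    show "F_sq F differentiable at (x, y)"
      using that x by (intro smooth_on_differentiable[OF C.E_smooth]) simp
    show "F_sq F' differentiable at (x', L y)"
      using Lnz[OF that] x by (intro smooth_on_differentiable[OF C'.E_smooth]) simp
  qed
  have g: "g_mat F (x, y) = transpose M ** g_mat F' (x', L y) ** M" if y: "y \<noteq> 0" for y
  proof -
    have T': "(x', L y) \<in> C'.T" using Lnz[OF y] x by simp
    have s: "smooth_on C'.T (\<lambda>z. M $ a $ i * d_y a (F_sq F') z)" for a i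
      by (intro smooth_on_mult smooth_on_const smooth_on_d_y C'.E_smooth C'.open_T)
    have "d_y j (d_y i (F_sq F)) (x, y) =
        (\<Sum>b\<in>UNIV. M $ b $ j * d_y b (\<lambda>z. \<Sum>a\<in>UNIV. M $ a $ i * d_y a (F_sq F') z) (x', L y))" for i j
    proof (rule trans[OF _ y])
      show "d_y i (F_sq F) (x, y) = (\<Sum>a\<in>UNIV. M $ a $ i * d_y a (F_sq F') (x', L y))" if "y \<noteq> 0" for y
        by (rule Exy[OF that])
      show "d_y i (F_sq F) differentiable at (x, y)"
        using y x by (intro smooth_on_differentiable[OF smooth_on_d_y[OF C.E_smooth]]) simp
      show "(\<lambda>z. \<Sum>a\<in>UNIV. M $ a $ i * d_y a (F_sq F') z) differentiable at (x', L y)"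
        by (rule smooth_on_differentiable[OF smooth_on_sum[OF C'.open_T s] T'])
    qed
    moreover have "d_y b (\<lambda>z. \<Sum>a\<in>UNIV. M $ a $ i * d_y a (F_sq F') z) (x', L y) =
        (\<Sum>a\<in>UNIV. M $ a $ i * d_y b (d_y a (F_sq F')) (x', L y))" for b i
    proof -
      have "d_y b (\<lambda>z. \<Sum>a\<in>UNIV. M $ a $ i * d_y a (F_sq F') z) (x', L y) =
        (\<Sum>a\<in>UNIV. d_y b (\<lambda>z. M $ a $ i * d_y a (F_sq F') z) (x', L y))"
        unfolding d_y_def[of b] by (intro dir_deriv_sum smooth_on_differentiable[OF s T'])
      also have "\<dots> = (\<Sum>a\<in>UNIV. M $ a $ i * d_y b (d_y a (F_sq F')) (x', L y))"
        unfolding d_y_def[of b]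
        by (intro sum.cong refl dir_deriv_cmult
            smooth_on_differentiable[OF smooth_on_d_y[OF C'.E_smooth] T'])
      finally show ?thesis .
    qed
    ultimately have "g_mat F (x, y) $ i $ j =
        (\<Sum>b\<in>UNIV. (\<Sum>a\<in>UNIV. M $ a $ i * (1/2 * d_y b (d_y a (F_sq F')) (x', L y))) * M $ b $ j)" for i j
      by (simp add: g_mat_def sum_divide_distrib sum_distrib_left sum_distrib_right mult_ac)
    then show ?thesis
      by (simp add: vec_eq_iff matrix_matrix_mult_def transpose_def g_mat_def)
  qed
  have lam: "C.lam (x, y) = ln \<bar>det M\<bar> + C'.lam (x', L y)" if "y \<noteq> 0" for y
  proof -
    have "det (g_mat F (x, y)) = (det M)\<^sup>2 * det (g_mat F' (x', L y))"
      unfolding g[OF that] by (simp add: det_mul power2_eq_square)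
    moreover have "det (g_mat F' (x', L y)) > 0"
      using C'.det_g_pos[of "(x', L y)"] Lnz[OF that] x by simp
    moreover have "ln ((det M)\<^sup>2) = 2 * ln \<bar>det M\<bar>"
      using detM by (metis ln_realpow of_nat_numeral power2_abs zero_less_abs_iff)
    ultimately show ?thesis
      using detM by (simp add: C.lam_def C'.lam_def ln_mult add_divide_distrib)
  qed
  have "C.rho x = ln \<bar>det M\<bar> + C'.rho x'"
  proof (rule antisym)
    obtain y where "norm y = 1" "C.rho x = C.lam (x, y)" using C.rho_attained(1)[OF x(1)] by blast
    moreover from this have "y \<noteq> 0" by auto
    ultimately show "C.rho x \<le> ln \<bar>det M\<bar> + C'.rho x'"
      using lam[of y] C'.rho_attained(2)[OF x(2) Lnz[of y]] by simp
    obtain y' where "norm y' = 1" "C'.rho x' = C'.lam (x', y')" using C'.rho_attained(1)[OF x(2)] by blast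
    moreover obtain y where "y' = L y" using surj by blast
    moreover have "y \<noteq> 0"
      using \<open>norm y' = 1\<close> \<open>y' = L y\<close> linear_0[OF L] by auto
    ultimately show "ln \<bar>det M\<bar> + C'.rho x' \<le> C.rho x"
      using lam[of y] C.rho_attained(2)[OF x(1), of y] by simp
  qed
  then show ?thesis using detM by (simp add: exp_add M_def)
qed

section \<open>The density and its logarithmic differential\<close>

context flat_chart
begin

text \<open>By \<open>h_const\<close> any nonzero vector represents the fibre; a fixed one makes
  smoothness in x that of a slice of h_k.\<close>

definition "theta x = (\<chi> k. h k (x, axis undefined 1))"

lemma theta_smooth: "smooth_on S theta"
  unfolding theta_def[abs_def]
  by (intro smooth_on_vec_lambda open_S smooth_on_slice[of S _ "- {0}"] h_smooth)
    (simp add: axis_eq_0_iff)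

lemma theta_eq: "x \<in> S \<Longrightarrow> y \<noteq> 0 \<Longrightarrow> theta x $ k = h k (x, y)"
  unfolding theta_def using h_const[of x "axis undefined 1" y k] by (simp add: axis_eq_0_iff)

text \<open>A maximiser at \<open>x1\<close> competes at \<open>x2\<close>, and its x-gradient is
  \<open>theta x1\<close>, whichever maximiser it is.\<close>

lemma rho_lower:
  assumes x: "x1 \<in> S" "x2 \<in> S"
    and est: "\<And>y. norm y = 1 \<Longrightarrow> (x2 - x1) \<bullet> grad (x1, y) - e * norm (x2 - x1) \<le> lam (x2, y) - lam (x1, y)"
  shows "(x2 - x1) \<bullet> theta x1 - e * norm (x2 - x1) \<le> rho x2 - rho x1"
proof -
  obtain y where y: "norm y = 1" "rho x1 = lam (x1, y)" using rho_attained(1)[OF x(1)] by blast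
  then have "y \<noteq> 0" by auto
  have "grad (x1, y) = theta x1"
    using grad_at_max[OF x(1) \<open>y \<noteq> 0\<close> y(2)[symmetric]] theta_eq[OF x(1) \<open>y \<noteq> 0\<close>]
    by (simp add: vec_eq_iff)
  with est[OF y(1)] rho_attained(2)[OF x(2) \<open>y \<noteq> 0\<close>] y(2) show ?thesis by simp
qed

text \<open>Danskin's envelope argument: at every maximiser of \<open>lam (x, _)\<close> the \<open>x\<close>-gradient is the
  same covector \<open>theta x\<close>, so the maximum is differentiable.\<close>

lemma rho_has_derivative:
  assumes x: "x \<in> S"
  shows "(rho has_derivative (\<lambda>v. v \<bullet> theta x)) (at x)"
  unfolding has_derivative_at_alt
proof (intro conjI allI impI)
  show "bounded_linear (\<lambda>v. v \<bullet> theta x)" by (rule bounded_linear_inner_left)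
  fix e :: real assume e: "e > 0"
  obtain d where d: "d > 0" "ball x d \<subseteq> S"
    "\<And>x1 x2 y. x1 \<in> ball x d \<Longrightarrow> x2 \<in> ball x d \<Longrightarrow> norm y = 1 \<Longrightarrow>
      (x2 - x1) \<bullet> grad (x1, y) - e/2 * norm (x2 - x1) \<le> lam (x2, y) - lam (x1, y)"
    using lam_first_order[OF x, of "e/2"] e by auto
  have "isCont theta x"
    using smooth_on_continuous[OF theta_smooth] open_S x by (simp add: continuous_on_eq_continuous_at)
  then obtain d' where d': "d' > 0" "\<And>x'. dist x' x < d' \<Longrightarrow> dist (theta x') (theta x) < e/2"
    using e unfolding continuous_at_eps_delta by (metis half_gt_zero)
  have "norm (rho x' - rho x - (x' - x) \<bullet> theta x) \<le> e * norm (x' - x)"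
    if "norm (x' - x) < min d d'" for x'
  proof -
    have b: "x \<in> ball x d" "x' \<in> ball x d" using that d(1) by (auto simp: dist_norm norm_minus_commute)
    have S: "x \<in> S" "x' \<in> S" using b d(2) by auto
    have 1: "(x' - x) \<bullet> theta x - e/2 * norm (x' - x) \<le> rho x' - rho x"
      by (rule rho_lower[OF S d(3)[OF b]])
    \<comment> \<open>With the roles exchanged, the lower bound becomes an upper bound for
      \<open>rho x' - rho x\<close> with \<open>theta\<close> taken at x'; continuity of
      \<open>theta\<close> brings it back to x.\<close>
    have 2: "(x - x') \<bullet> theta x' - e/2 * norm (x - x') \<le> rho x - rho x'"
      by (rule rho_lower[OF S(2,1) d(3)[OF b(2,1)]])
    have "(x' - x) \<bullet> (theta x' - theta x) \<le> norm (x' - x) * norm (theta x' - theta x)"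
      by (rule norm_cauchy_schwarz)
    also have "\<dots> \<le> norm (x' - x) * (e/2)"
      using d'(2)[of x'] that by (intro mult_left_mono) (auto simp: dist_norm)
    finally have 3: "(x' - x) \<bullet> theta x' - (x' - x) \<bullet> theta x \<le> e/2 * norm (x' - x)"
      by (simp add: inner_diff_right mult.commute)
    have 4: "(x - x') \<bullet> theta x' = - ((x' - x) \<bullet> theta x')" by (simp add: inner_diff_left)
    have 5: "norm (x - x') = norm (x' - x)" by (rule norm_minus_commute)
    have "e/2 * norm (x' - x) + e/2 * norm (x' - x) = e * norm (x' - x)" by (simp add: field_simps)
    moreover have "e/2 * norm (x' - x) \<ge> 0" using e by simp
    ultimately show ?thesis
      using 1 2 3 unfolding 4 5 real_norm_def abs_le_iff by linarith
  qed
  then show "\<exists>d>0. \<forall>x'. norm (x' - x) < d \<longrightarrow> norm (rho x' - rho x - (x' - x) \<bullet> theta x) \<le> e * norm (x' - x)"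
    using d(1) d'(1) by (intro exI[of _ "min d d'"]) auto
qed

text \<open>The differential of \<open>rho\<close> is \<open>theta\<close>, which is smooth, so
  differentiability improves to smoothness.\<close>

lemma rho_smooth: "smooth_on S rho"
proof (rule smooth_onI_deriv[OF open_S rho_has_derivative])
  show "smooth_on S (\<lambda>x. v \<bullet> theta x)" for v
    by (rule smooth_on_bounded_linear_compose[OF bounded_linear_inner_right open_S theta_smooth])
qed

text \<open>The distortion is \<lambda> - \<open>rho\<close>, the Reeb field is horizontal, and on
  horizontal vectors d\<lambda> is h_k dx^k, the differential of \<open>rho\<close>.\<close>

lemma S_curvature_rho:
  assumes x: "x \<in> S" and y: "y \<noteq> 0"
  shows "S_curvature F (\<lambda>x. exp (rho x)) (x, y) = 0"
proof -
  have xy: "(x, y) \<in> T" using x y by simp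
  define a where "a = (1 / F (x, y)) *\<^sub>R y"
  have "distortion F (\<lambda>x. exp (rho x)) z = lam z - rho (fst z)" if "z \<in> T" for z
    using det_g_pos[OF that] by (simp add: distortion_def lam_def ln_div ln_sqrt)
  then have "S_curvature F (\<lambda>x. exp (rho x)) (x, y) =
      dir_deriv (\<lambda>z. lam z - rho (fst z)) (x, y) (reeb F (x, y))"
    unfolding S_curvature_def by (rule dir_deriv_cong_open[OF open_T xy])
  also have "\<dots> = dir_deriv lam (x, y) (reeb F (x, y)) - fst (reeb F (x, y)) \<bullet> theta x"
  proof (rule dir_deriv_eqI, rule has_derivative_diff[OF smooth_on_has_derivative[OF lam_smooth xy]])
    have "(fst has_derivative fst) (at (x, y))"
      by (rule bounded_linear_imp_has_derivative[OF bounded_linear_fst])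
    from diff_chain_at[OF this, of rho "\<lambda>v. v \<bullet> theta x"] rho_has_derivative[OF x]
    show "((\<lambda>z. rho (fst z)) has_derivative (\<lambda>V. fst V \<bullet> theta x)) (at (x, y))"
      by (simp add: o_def)
  qed
  also have "dir_deriv lam (x, y) (reeb F (x, y)) = (\<Sum>k\<in>UNIV. h k (x, y) * a $ k)"
    unfolding dir_deriv_del[OF lam_smooth xy]
    by (simp add: reeb_def hlift_def delta_y_def a_def del_def h_def)
  also have "fst (reeb F (x, y)) \<bullet> theta x = (\<Sum>k\<in>UNIV. h k (x, y) * a $ k)"
    by (simp add: reeb_def hlift_def a_def inner_vec_def theta_eq[OF x y] mult.commute)
  finally show ?thesis by simp
qed

end

section \<open>From charts to the manifold\<close>

lemma flat_chart_of_structure: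
  fixes A :: "('m::{t2_space, second_countable_topology}, real ^ 'n::finite) chart set"
  assumes "CARD('n) \<ge> 2" "smooth_atlas A" "finsler_structure A F" "mean_landsberg_zero A F"
    "berwald_scalar_zero A F" "c \<in> A"
  shows "flat_chart (chart_img c) (F c)"
proof
  have "\<forall>c\<in>A. open (chart_img c)"
    using assms(2) unfolding smooth_atlas_def by blast
  then show "open (chart_img c)" using assms(6) by blast
  note F = assms(3)[unfolded finsler_structure_def]
  show "continuous_on (chart_img c \<times> UNIV) (F c)" "smooth_on (chart_img c \<times> (- {0})) (F c)"
    using F assms(6) by blast+
  show "F c (x, y) \<ge> 0" if "x \<in> chart_img c" for x y
    using F assms(6) that by blast
  show "F c (x, t *\<^sub>R y) = t * F c (x, y)" if "x \<in> chart_img c" "t > 0" for x y t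
    using F assms(6) that by blast
  show "v \<bullet> (g_mat (F c) (x, y) *v v) > 0" if "x \<in> chart_img c" "y \<noteq> 0" "v \<noteq> 0" for x y v
    using F assms(6) that by blast
  show "2 \<le> CARD('n)" by (rule assms(1))
  show "mean_landsberg (F c) m u \<omega> \<gamma> z = 0"
    if "conic_open W" "W \<subseteq> chart_img c \<times> UNIV" "adapted_frame (F c) W m u"
      "chern_connection (F c) W m u \<omega>" "z \<in> W" "\<gamma> \<noteq> m" for W m u \<omega> z \<gamma>
  proof -
    have "local_chern_frame c (F c) W m u \<omega>" using that by (simp add: local_chern_frame_def)
    moreover have "\<gamma> \<in> - {m}" using that by simp
    ultimately show ?thesis
      using assms(4,6) that(5) unfolding mean_landsberg_zero_def by blast
  qed
  show "berwald_scalar (F c) m u \<omega> z = 0"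
    if "conic_open W" "W \<subseteq> chart_img c \<times> UNIV" "adapted_frame (F c) W m u"
      "chern_connection (F c) W m u \<omega>" "z \<in> W" for W m u \<omega> z
  proof -
    have "local_chern_frame c (F c) W m u \<omega>" using that by (simp add: local_chern_frame_def)
    then show ?thesis
      using assms(5,6) that(5) unfolding berwald_scalar_zero_def by blast
  qed
qed

theorem corollary1:
  fixes A :: "('m::{t2_space, second_countable_topology}, real ^ 'n::finite) chart set"
    and F :: "('m, real ^ 'n) chart \<Rightarrow> 'n tm \<Rightarrow> real"
  assumes "CARD('n) \<ge> 2"
    and "smooth_atlas A"
    and "de_rham_H1_trivial A"
    and "finsler_structure A F"
    and "mean_landsberg_zero A F"
    and "berwald_scalar_zero A F"
  shows "\<exists>\<sigma>. volume_density A \<sigma> \<and> S_curvature_zero A F \<sigma>"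
proof -
  \<comment> \<open>The same formula in every chart, so that consistency on overlaps is
    \<open>exp_rho_transform\<close>.\<close>
  define \<sigma> where "\<sigma> c x = exp (finsler_chart.rho (F c) x)" for c x
  have flat: "flat_chart (chart_img c) (F c)" if "c \<in> A" for c
    by (rule flat_chart_of_structure[OF assms(1,2,4,5,6) that])
  then have chart: "finsler_chart (chart_img c) (F c)" if "c \<in> A" for c
    using that by (simp add: flat_chart_def)
  have "smooth_on (chart_img c) (\<sigma> c)" if "c \<in> A" for c
    unfolding \<sigma>_def[abs_def]
    by (intro smooth_on_exp flat_chart.rho_smooth[OF flat[OF that]] finsler_chart.open_S[OF chart[OF that]])
  moreover have "\<sigma> c x = \<bar>det (matrix (dir_deriv (transition c c') x))\<bar> * \<sigma> c' (transition c c' x)"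
    if c: "c \<in> A" "c' \<in> A" and x: "x \<in> overlap c c'" for c c' x
  proof -
    obtain p where p: "p \<in> chart_dom c" "p \<in> chart_dom c'" "x = snd c p"
      using x by (auto simp: overlap_def)
    have "homeomorphism (chart_dom c) (chart_img c) (snd c) (chart_inv c)"
      using assms(2) c(1) unfolding smooth_atlas_def by blast
    then have "chart_inv c x = p" using p by (simp add: homeomorphism_def)
    then have x': "transition c c' x \<in> chart_img c'"
      using p(2) by (simp add: transition_def chart_img_def chart_dom_def)
    have "smooth_on (overlap c c') (transition c c')"
      using assms(2) c unfolding smooth_atlas_def by blast
    then have L: "linear (dir_deriv (transition c c') x)"
      by (intro dir_deriv_linear smooth_on_differentiable[OF _ x])
    have xc: "x \<in> chart_img c" using p by (auto simp: chart_img_def chart_dom_def)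
    have "F c (x, y) = F c' (transition c c' x, dir_deriv (transition c c') x y)" for y
      using assms(4) c x unfolding finsler_structure_def by blast
    from exp_rho_transform[OF chart[OF c(1)] chart[OF c(2)] xc x' L this]
    show ?thesis by (simp add: \<sigma>_def)
  qed
  ultimately have "volume_density A \<sigma>"
    unfolding volume_density_def by (auto simp: \<sigma>_def)
  moreover have "S_curvature_zero A F \<sigma>"
    unfolding S_curvature_zero_def \<sigma>_def[abs_def]
    using flat_chart.S_curvature_rho[OF flat] by blast
  ultimately show ?thesis by blast
qed

end
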